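(* Let $1<p<+\infty$, $\varepsilon_0>0$, $\lambda>0$, and let $a\in L^\infty(\mathbb{R}_+\times(0,1))$ be such that $a\ge 0$ and $a\ge\lambda>0$ in $\mathbb{R}_+\times(x_0-\varepsilon_0,x_0+\varepsilon_0)\subset\mathbb{R}_+\times(0,1)$ for some $x_0\in(0,1)$. Then there exist positive constants $C,\gamma$ depending only on $p$, $\|a\|_{L^\infty(\mathbb{R}_+\times(0,1))}$, $\varepsilon_0$, and $\lambda$ such that for all $\rho_0,\xi_0\in L^p(0,1)$ the unique (broad) solution $(\rho,\xi)$ of $$\begin{cases}\rho_t-\rho_x=-\tfrac12 a(\rho-\xi) & \text{in }\mathbb{R}_+\times(0,1),\\ \xi_t+\xi_x=\tfrac12 a(\rho-\xi) & \text{in }\mathbb{R}_+\times(0,1),\\ \rho(t,0)+\xi(t,0)=\rho(t,1)+\xi(t,1)=0 & \text{in }\mathbb{R}_+,\end{cases}$$ with the initial condition $\rho(0,\cdot)=\rho_0$ and $\xi(0,\cdot)=\xi_0$ satisfies $$\|(\rho,\xi)(t,\cdot)\|_{L^p(0,1)}\le C e^{-\gamma t}\,\|(\rho_0,\xi_0)\|_{L^p(0,1)},\qquad t\ge 0.$$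
   Context: $\mathbb{R}_+=(0,+\infty)$, and $\|(f,g)\|_{L^p(0,1)}^p=\int_0^1(|f|^p+|g|^p)\,dx$. Broad solution: for $T>0$, a broad solution on $(0,T)$ of the system is a pair $(\rho,\xi)\in C([0,T];[L^p(0,1)]^2)\cap C([0,1];[L^p(0,T)]^2)$ that obeys the characteristic rules, i.e. with $F=-\tfrac12a(\rho-\xi)$ and $G=\tfrac12a(\rho-\xi)$, for a.e. $(t,x)\in(0,T)\times(0,1)$: $\rho(t,x)=\rho_0(x+t)+\int_0^tF(s,x+t-s)\,ds$ if $x+t<1$, and $\rho(t,x)=\rho(t+x-1,1)+\int_{t+x-1}^tF(s,x+t-s)\,ds$ if $x+t>1$; $\xi(t,x)=\xi_0(x-t)+\int_0^tG(s,x-t+s)\,ds$ if $x>t$, and $\xi(t,x)=\xi(t-x,0)+\int_{t-x}^tG(s,x-t+s)\,ds$ if $x<t$; and the boundary conditions $\rho(\cdot,0)=-\xi(\cdot,0)$, $\rho(\cdot,1)=-\xi(\cdot,1)$ hold a.e. in $(0,T)$. A solution on $\mathbb{R}_+$ is one whose restriction to $(0,T)$ is a broad solution for every $T>0$. *)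

theory Defs
  imports "HOL-Probability.Essential_Supremum"
begin

text \<open>
  Elements of \<open>L\<^sup>p(S)\<close> and \<open>L\<^sup>\<infinity>(D)\<close> are represented by everywhere defined functions that are
  Lebesgue measurable on the domain; two of them are the same element iff they agree almost
  everywhere there.
\<close>

definition Lp_space :: "real \<Rightarrow> real set \<Rightarrow> (real \<Rightarrow> real) set" where
  "Lp_space p S = {f. f \<in> borel_measurable (lebesgue_on S) \<and>
     integrable (lebesgue_on S) (\<lambda>x. \<bar>f x\<bar> powr p)}"

definition Lp_pair_norm :: "real \<Rightarrow> real set \<Rightarrow> (real \<Rightarrow> real) \<Rightarrow> (real \<Rightarrow> real) \<Rightarrow> real" where
  "Lp_pair_norm p S f g =
     (LINT x|lebesgue_on S. \<bar>f x\<bar> powr p + \<bar>g x\<bar> powr p) powr (1 / p)"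

definition Linf_space :: "(real \<times> real) set \<Rightarrow> (real \<times> real \<Rightarrow> real) set" where
  "Linf_space D = {f. f \<in> borel_measurable (lebesgue_on D) \<and>
     esssup (lebesgue_on D) (\<lambda>z. ereal \<bar>f z\<bar>) < \<infinity>}"

definition Linf_norm :: "(real \<times> real) set \<Rightarrow> (real \<times> real \<Rightarrow> real) \<Rightarrow> real" where
  "Linf_norm D f = real_of_ereal (esssup (lebesgue_on D) (\<lambda>z. ereal \<bar>f z\<bar>))"

definition continuous_into_Lp_pair ::
  "real \<Rightarrow> real set \<Rightarrow> real set \<Rightarrow> (real \<Rightarrow> real \<Rightarrow> real) \<Rightarrow> (real \<Rightarrow> real \<Rightarrow> real) \<Rightarrow> bool" where
  "continuous_into_Lp_pair p I S u v \<longleftrightarrow>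
     (\<forall>r\<in>I. u r \<in> Lp_space p S \<and> v r \<in> Lp_space p S) \<and>
     (\<forall>r\<in>I. ((\<lambda>s. Lp_pair_norm p S (\<lambda>y. u s y - u r y) (\<lambda>y. v s y - v r y)) \<longlongrightarrow> 0) (at r within I))"

text \<open>
  An element of \<open>C([0,T];[L\<^sup>p(0,1)]\<^sup>2) \<inter> C([0,1];[L\<^sup>p(0,T)]\<^sup>2)\<close> is an a.e.-class on \<open>(0,T) \<times> (0,1)\<close>
  together with its continuous traces \<open>\<rho>(t,\<cdot>)\<close> and \<open>\<rho>(\<cdot>,x)\<close>. By Fubini, the representative can be
  altered on null sets of lines so that all of its slices, at every \<open>t \<in> [0,T]\<close> and at every
  \<open>x \<in> [0,1]\<close>, represent these traces. Such representatives are the functions used here; in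
  particular \<open>\<rho> t 0\<close> and \<open>\<rho> t 1\<close> below are the traces on the lateral boundary.
\<close>

definition solution_space ::
  "real \<Rightarrow> real \<Rightarrow> (real \<Rightarrow> real \<Rightarrow> real) \<Rightarrow> (real \<Rightarrow> real \<Rightarrow> real) \<Rightarrow> bool" where
  "solution_space p T \<rho> \<xi> \<longleftrightarrow>
     (\<lambda>(t, x). \<rho> t x) \<in> borel_measurable (lebesgue_on ({0<..<T} \<times> {0<..<1})) \<and>
     (\<lambda>(t, x). \<xi> t x) \<in> borel_measurable (lebesgue_on ({0<..<T} \<times> {0<..<1})) \<and>
     continuous_into_Lp_pair p {0..T} {0<..<1} \<rho> \<xi> \<and>
     continuous_into_Lp_pair p {0..1} {0<..<T} (\<lambda>x t. \<rho> t x) (\<lambda>x t. \<xi> t x)"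

text \<open>
  The integrals along characteristics are taken with respect to \<open>lebesgue_on\<close> rather than \<open>lborel\<close>,
  as the integrands need not be Borel measurable.
\<close>

definition characteristic_rules ::
  "real \<Rightarrow> (real \<Rightarrow> real \<Rightarrow> real) \<Rightarrow> (real \<Rightarrow> real) \<Rightarrow> (real \<Rightarrow> real) \<Rightarrow>
   (real \<Rightarrow> real \<Rightarrow> real) \<Rightarrow> (real \<Rightarrow> real \<Rightarrow> real) \<Rightarrow> bool" where
  "characteristic_rules T a \<rho>0 \<xi>0 \<rho> \<xi> \<longleftrightarrow>
     (let F = (\<lambda>t x. - (1 / 2) * a t x * (\<rho> t x - \<xi> t x));
          G = (\<lambda>t x. (1 / 2) * a t x * (\<rho> t x - \<xi> t x))
      in AE (t, x) in lebesgue_on ({0<..<T} \<times> {0<..<1}).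
        (x + t < 1 \<longrightarrow>
           \<rho> t x = \<rho>0 (x + t) + (LINT s|lebesgue_on {0..t}. F s (x + t - s))) \<and>
        (x + t > 1 \<longrightarrow>
           \<rho> t x = \<rho> (t + x - 1) 1 + (LINT s|lebesgue_on {t + x - 1..t}. F s (x + t - s))) \<and>
        (x > t \<longrightarrow>
           \<xi> t x = \<xi>0 (x - t) + (LINT s|lebesgue_on {0..t}. G s (x - t + s))) \<and>
        (x < t \<longrightarrow>
           \<xi> t x = \<xi> (t - x) 0 + (LINT s|lebesgue_on {t - x..t}. G s (x - t + s))))"

definition broad_solution_on ::
  "real \<Rightarrow> real \<Rightarrow> (real \<Rightarrow> real \<Rightarrow> real) \<Rightarrow> (real \<Rightarrow> real) \<Rightarrow> (real \<Rightarrow> real) \<Rightarrow>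
   (real \<Rightarrow> real \<Rightarrow> real) \<Rightarrow> (real \<Rightarrow> real \<Rightarrow> real) \<Rightarrow> bool" where
  "broad_solution_on p T a \<rho>0 \<xi>0 \<rho> \<xi> \<longleftrightarrow>
     solution_space p T \<rho> \<xi> \<and>
     characteristic_rules T a \<rho>0 \<xi>0 \<rho> \<xi> \<and>
     (AE t in lebesgue_on {0<..<T}. \<rho> t 0 = - \<xi> t 0) \<and>
     (AE t in lebesgue_on {0<..<T}. \<rho> t 1 = - \<xi> t 1)"

definition broad_solution ::
  "real \<Rightarrow> (real \<Rightarrow> real \<Rightarrow> real) \<Rightarrow> (real \<Rightarrow> real) \<Rightarrow> (real \<Rightarrow> real) \<Rightarrow>
   (real \<Rightarrow> real \<Rightarrow> real) \<Rightarrow> (real \<Rightarrow> real \<Rightarrow> real) \<Rightarrow> bool" where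
  "broad_solution p a \<rho>0 \<xi>0 \<rho> \<xi> \<longleftrightarrow>
     (\<forall>T>0. broad_solution_on p T a \<rho>0 \<xi>0 \<rho> \<xi>) \<and>
     (AE x in lebesgue_on {0<..<1}. \<rho> 0 x = \<rho>0 x \<and> \<xi> 0 x = \<xi>0 x)"

text \<open>
  Equality of two pairs as elements of the solution spaces, i.e. equality of all traces.
\<close>

definition same_solution ::
  "(real \<Rightarrow> real \<Rightarrow> real) \<Rightarrow> (real \<Rightarrow> real \<Rightarrow> real) \<Rightarrow>
   (real \<Rightarrow> real \<Rightarrow> real) \<Rightarrow> (real \<Rightarrow> real \<Rightarrow> real) \<Rightarrow> bool" where
  "same_solution \<rho> \<xi> \<rho>' \<xi>' \<longleftrightarrow>
     (\<forall>t\<ge>0. AE x in lebesgue_on {0<..<1}. \<rho> t x = \<rho>' t x \<and> \<xi> t x = \<xi>' t x) \<and>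
     (\<forall>x\<in>{0..1}. AE t in lebesgue_on {0<..}. \<rho> t x = \<rho>' t x \<and> \<xi> t x = \<xi>' t x)"

end

theory Submission
  imports Defs
begin

text \<open>
  The system is unfolded to a single equation on the circle of length two. Put
  \<open>h t y = \<rho> t y\<close> for \<open>y \<in> (0, 1)\<close> and
  \<open>h t y = - \<xi> t (- y)\<close> for \<open>y \<in> (-1, 0)\<close>. The boundary conditions say that
  \<open>h\<close> is continuous at \<open>0\<close> and two-periodic, and \<open>h\<close> satisfies
  \<open>h\<^sub>t - h\<^sub>y = - a / 2 * (h t y + h t (- y))\<close> with \<open>a\<close> extended evenly.
  In characteristic coordinates, \<open>h t y = g t (y + t)\<close>, this is the ordinary differential
  equation \<open>g\<^sub>t = - b / 2 * (g t z + g t (2 * t - z))\<close>, coupled only through a moving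
  reflection (\<open>circle_flow\<close>).

  Existence (\<open>ex_circle_flow\<close>). Positive and negative parts of \<open>g\<close> solve a system
  with nonnegative coefficients whose Picard iterates increase. They stay below an explicit supersolution,
  because integrating the initial value along \<open>s \<mapsto> 2 * s - z\<close> gives a bound uniform in
  \<open>z\<close>. So the limit is finite and solves the equation at every point. It is dominated by a
  function of \<open>z\<close> in \<open>L\<^sup>p\<close>, which together with continuity of translations
  makes all traces continuous (\<open>broad_solution_of_flow\<close>).

  Decay. Let the energy be the integral of \<open>\<bar>g t z\<bar> powr p\<close> over the circle; it is the
  \<open>p\<close>-th power of the norm in the claim. By convexity its decrease is at least
  \<open>p / 4\<close> times the integral of \<open>b * (j u + j v) * (u + v)\<close>, where \<open>u\<close>
  and \<open>v\<close> are the values of \<open>g\<close> at a point and its mirror image and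
  \<open>j x = sgn x * \<bar>x\<bar> powr (p - 1)\<close> (\<open>energy_dissipation\<close>). By homogeneity
  and compactness this density dominates \<open>\<bar>u + v\<bar> powr p\<close> up to a small multiple of
  \<open>\<bar>u\<bar> powr p + \<bar>v\<bar> powr p\<close> (\<open>powr_coercive\<close>), for all
  \<open>p > 1\<close> alike. If the loss during two units of time is small, then \<open>g\<close> hardly
  changes along characteristics, and \<open>u + v\<close> is small in the strip where the damping is
  effective. So the profile at the initial time is nearly opposite to its translates by \<open>2 * y\<close>
  for all \<open>y\<close> in the strip; hence it is nearly invariant under small translations, nearly
  constant, and nearly its own negative, that is, small (\<open>periodic_poincare\<close>,
  \<open>observability\<close>). Hence the energy shrinks by a fixed factor over every time interval of length
  two (\<open>uniform_contraction\<close>). The factor depends on the coefficient only through its bounds and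
  on the strip only through its width.

  Uniqueness (\<open>broad_solution_AE_unique\<close>). The difference of two solutions is estimated in
  \<open>L\<^sup>1\<close>. Since characteristics need positive time to cross the interval, the boundary
  traces are controlled by the sources after finitely many reflections, and Gronwall's argument applies. By
  uniqueness the decay of the constructed solution is the decay of every solution.
\<close>

section \<open>Powers of absolute values\<close>

text \<open>
  The odd extension of the power function. For \<open>q = p - 1\<close> it is, up to the factor
  \<open>p\<close>, the derivative of \<open>\<bar>x\<bar> powr p\<close>; for \<open>q = p\<close> it turns
  functions in \<open>L\<^sup>p\<close> into functions in \<open>L\<^sup>1\<close>.
\<close>

definition signed_powr :: "real \<Rightarrow> real \<Rightarrow> real" where
  "signed_powr q x = sgn x * \<bar>x\<bar> powr q"

lemma signed_powr_minus [simp]: "signed_powr q (- x) = - signed_powr q x"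
  by (simp add: signed_powr_def sgn_minus)

lemma abs_signed_powr: "\<bar>signed_powr q x\<bar> = \<bar>x\<bar> powr q"
  by (cases "x = 0") (auto simp: signed_powr_def abs_mult)

lemma abs_add_powr_le:
  fixes a b p :: real
  assumes "0 \<le> p"
  shows "\<bar>a + b\<bar> powr p \<le> 2 powr p * (\<bar>a\<bar> powr p + \<bar>b\<bar> powr p)"
proof -
  have "\<bar>a + b\<bar> powr p \<le> (2 * max \<bar>a\<bar> \<bar>b\<bar>) powr p"
    by (rule powr_mono2) (use assms in auto)
  also have "\<dots> = 2 powr p * max \<bar>a\<bar> \<bar>b\<bar> powr p"
    by (rule powr_mult)
  also have "\<dots> \<le> 2 powr p * (\<bar>a\<bar> powr p + \<bar>b\<bar> powr p)"
    by (intro mult_left_mono) (auto simp: max_def)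
  finally show ?thesis .
qed

lemma abs_diff_powr_le:
  fixes a b p :: real
  assumes "0 \<le> p"
  shows "\<bar>a - b\<bar> powr p \<le> 2 powr p * (\<bar>a\<bar> powr p + \<bar>b\<bar> powr p)"
  using abs_add_powr_le[OF assms, of a "- b"] by simp

text \<open>
  After division by \<open>a powr p\<close> this says that \<open>u powr p + v powr p \<le> 1\<close> when
  \<open>u + v = 1\<close>, which holds because \<open>u powr p \<le> u\<close> on \<open>[0, 1]\<close>.
\<close>

lemma powr_superadditive:
  fixes a b p :: real
  assumes "1 \<le> p" "0 \<le> b" "b \<le> a"
  shows "(a - b) powr p \<le> a powr p - b powr p"
proof (cases "a = 0")
  case False
  then have a: "0 < a" using assms by simp
  have *: "x powr p \<le> x" if "0 \<le> x" "x \<le> 1" for x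
  proof -
    have "x powr p \<le> x powr 1" by (rule powr_mono') (use that assms in auto)
    then show ?thesis using that by simp
  qed
  have "((a - b) / a) powr p + (b / a) powr p \<le> (a - b) / a + b / a"
    by (intro add_mono *) (use assms a in \<open>auto simp: field_simps\<close>)
  also have "\<dots> = 1" using a by (simp add: field_simps)
  finally have "((a - b) powr p + b powr p) / a powr p \<le> 1"
    using assms a by (simp add: powr_divide add_divide_distrib)
  then show ?thesis using a by (simp add: field_simps)
qed (use assms in auto)

text \<open>
  The inverse of \<open>signed_powr p\<close> is Hoelder continuous with exponent \<open>1 / p\<close>.
  Through this estimate, continuity of translations in \<open>L\<^sup>p\<close> reduces to the case of
  \<open>L\<^sup>1\<close>. Numbers of equal sign are covered by superadditivity, numbers of opposite sign by
  the triangle inequality.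
\<close>

lemma abs_diff_powr_le_signed_powr:
  fixes a b p :: real
  assumes p: "1 \<le> p"
  shows "\<bar>a - b\<bar> powr p \<le> 2 powr p * \<bar>signed_powr p a - signed_powr p b\<bar>"
proof -
  have 2: "1 \<le> (2::real) powr p" using p by (simp add: ge_one_powr_ge_zero)
  have pos: "\<bar>a - b\<bar> powr p \<le> 2 powr p * \<bar>signed_powr p a - signed_powr p b\<bar>" if "0 \<le> b" "b \<le> a" for a b :: real
  proof -
    have "\<bar>a - b\<bar> powr p \<le> 1 * \<bar>signed_powr p a - signed_powr p b\<bar>"
      using powr_superadditive[OF p that] that by (auto simp: signed_powr_def sgn_if split: if_splits)
    also have "\<dots> \<le> 2 powr p * \<bar>signed_powr p a - signed_powr p b\<bar>" by (intro mult_right_mono 2) auto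
    finally show ?thesis .
  qed
  have neg: "\<bar>a - b\<bar> powr p \<le> 2 powr p * \<bar>signed_powr p a - signed_powr p b\<bar>" if "b \<le> 0" "0 \<le> a" for a b :: real
    using abs_diff_powr_le[of p a b] p that by (auto simp: signed_powr_def sgn_if split: if_splits)
  have sym: "\<bar>b - a\<bar> powr p \<le> 2 powr p * \<bar>signed_powr p b - signed_powr p a\<bar> \<longleftrightarrow>
      \<bar>a - b\<bar> powr p \<le> 2 powr p * \<bar>signed_powr p a - signed_powr p b\<bar>" for a b :: real
    by (simp add: abs_minus_commute)
  have le: "\<bar>a - b\<bar> powr p \<le> 2 powr p * \<bar>signed_powr p a - signed_powr p b\<bar>" if "b \<le> a" for a b :: real
  proof -
    consider "0 \<le> b" | "b \<le> 0" "0 \<le> a" | "a \<le> 0" by linarith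
    then show ?thesis
    proof cases
      case 3
      have "\<bar>(-b) - (-a)\<bar> powr p \<le> 2 powr p * \<bar>signed_powr p (-b) - signed_powr p (-a)\<bar>"
        by (rule pos) (use 3 that in auto)
      then show ?thesis by (simp add: abs_minus_commute)
    qed (use pos neg that in auto)
  qed
  then show ?thesis using sym[of a b] by (metis linear)
qed

lemma signed_powr_mono: "0 \<le> q \<Longrightarrow> x \<le> y \<Longrightarrow> signed_powr q x \<le> signed_powr q y"
  by (auto simp: signed_powr_def sgn_if powr_mono2 intro: order_trans[of _ 0])

lemma signed_powr_strict_mono: "0 < q \<Longrightarrow> x < y \<Longrightarrow> signed_powr q x < signed_powr q y"
  by (auto simp: signed_powr_def sgn_if powr_less_mono2 intro: less_le_trans[of _ 0] le_less_trans[of _ 0])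

lemma isCont_signed_powr:
  assumes "0 < q" shows "isCont (signed_powr q) x"
proof -
  have *: "signed_powr q = (\<lambda>x. max 0 x powr q - max 0 (- x) powr q)"
    using assms by (auto simp: signed_powr_def sgn_if fun_eq_iff)
  have "continuous_on UNIV (\<lambda>x::real. max 0 x powr q - max 0 (- x) powr q)"
    using assms by (intro continuous_intros continuous_on_powr') auto
  then show ?thesis unfolding * by (simp add: continuous_on_eq_continuous_at)
qed

lemma continuous_on_signed_powr [continuous_intros]:
  assumes "0 < q" "continuous_on S f" shows "continuous_on S (\<lambda>x. signed_powr q (f x))"
proof -
  have "continuous_on UNIV (signed_powr q)" 
    using isCont_signed_powr[OF assms(1)] by (simp add: continuous_on_eq_continuous_at)
  from continuous_on_compose2[OF this assms(2)] show ?thesis by simp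
qed

lemma borel_measurable_signed_powr [measurable]: "signed_powr q \<in> borel_measurable borel"
  unfolding signed_powr_def[abs_def] by measurable

lemma powr_tangent:
  fixes a b p :: real
  assumes p: "1 < p"
  shows "\<bar>a\<bar> powr p + p * signed_powr (p - 1) a * (b - a) \<le> \<bar>b\<bar> powr p"
proof -
  have D: "((\<lambda>x. \<bar>x\<bar> powr p) has_real_derivative p * signed_powr (p - 1) x) (at x)" for x
  proof (cases "x = 0")
    case True
    have "((\<lambda>h. signed_powr (p - 1) h) \<longlongrightarrow> signed_powr (p - 1) 0) (at 0)"
      using isCont_signed_powr[of "p - 1" 0] p by (simp add: isCont_def)
    moreover have "signed_powr (p - 1) h = \<bar>h\<bar> powr p / h" for h
      by (cases "h = 0") (auto simp: signed_powr_def sgn_if powr_diff)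
    ultimately show ?thesis using True p
      by (simp add: DERIV_def signed_powr_def)
  next
    case False
    then consider "0 < x" | "x < 0" by linarith
    then show ?thesis
    proof cases
      case 1
      have "((\<lambda>x. x powr p) has_real_derivative p * signed_powr (p - 1) x) (at x)"
        using 1 by (auto intro!: derivative_eq_intros simp: signed_powr_def)
      then show ?thesis
        by (rule has_field_derivative_transform_within_open[of _ _ _ "{0<..}"]) (use 1 in auto)
    next
      case 2
      have "((\<lambda>x. (- x) powr p) has_real_derivative p * signed_powr (p - 1) x) (at x)"
        using 2 by (auto intro!: derivative_eq_intros simp: signed_powr_def)
      then show ?thesis
        by (rule has_field_derivative_transform_within_open[of _ _ _ "{..<0}"]) (use 2 in auto)
    qed
  qed
  have "convex_on UNIV (\<lambda>x::real. \<bar>x\<bar> powr p)"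
    by (rule convex_on_realI[of _ _ "\<lambda>x. p * signed_powr (p - 1) x"])
       (use D p in \<open>auto intro!: mult_left_mono signed_powr_mono\<close>)
  from convex_on_imp_above_tangent[OF this, of a b] D[of a] 
  show ?thesis by (fastforce simp: algebra_simps)
qed

text \<open>
  The expression \<open>(signed_powr (p - 1) u + signed_powr (p - 1) v) * (u + v)\<close> is the density with
  which energy is lost. It is positive unless \<open>u = - v\<close>, since \<open>signed_powr (p - 1)\<close>
  is odd and strictly increasing, and it is homogeneous of degree \<open>p\<close>. Hence it is bounded below
  by a positive constant on the compact set of those \<open>(u, v)\<close> of maximum norm one where the claim
  does not already hold with the \<open>\<delta>\<close>-term alone; homogeneity carries this to all
  \<open>(u, v)\<close>. For \<open>p < 2\<close> the \<open>\<delta>\<close>-term cannot be avoided: near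
  \<open>v = - u\<close> the density is only of second order in \<open>u + v\<close>.
\<close>

lemma powr_coercive:
  fixes p \<delta> :: real
  assumes p: "1 < p" and \<delta>: "0 < \<delta>"
  shows "\<exists>C>0. \<forall>u v. \<bar>u + v\<bar> powr p \<le>
    \<delta> * (\<bar>u\<bar> powr p + \<bar>v\<bar> powr p) + C * ((signed_powr (p - 1) u + signed_powr (p - 1) v) * (u + v))"
proof -
  define B where "B u v = (signed_powr (p - 1) u + signed_powr (p - 1) v) * (u + v)" for u v
  have Bpos: "0 < B u v" if "u + v \<noteq> 0" for u v
  proof (cases "0 < u + v")
    case True
    then have "signed_powr (p - 1) (- v) < signed_powr (p - 1) u" using p by (intro signed_powr_strict_mono) auto
    then show ?thesis using True by (simp add: B_def)
  next
    case False
    then have "signed_powr (p - 1) u < signed_powr (p - 1) (- v)" using p that by (intro signed_powr_strict_mono) auto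
    then show ?thesis using False that by (auto simp: B_def intro!: mult_neg_neg)
  qed
  have Bnn: "0 \<le> B u v" for u v using Bpos[of u v] by (cases "u + v = 0") (auto simp: B_def)
  define K where "K = {z :: real \<times> real. max \<bar>fst z\<bar> \<bar>snd z\<bar> = 1 \<and>
     \<delta> * (\<bar>fst z\<bar> powr p + \<bar>snd z\<bar> powr p) \<le> \<bar>fst z + snd z\<bar> powr p}"
  have "closed K" unfolding K_def
    by (intro closed_Collect_conj closed_Collect_eq closed_Collect_le)
       (use p in \<open>auto intro!: continuous_intros continuous_on_powr'\<close>)
  moreover have "bounded K"
    by (rule bounded_subset[of "{-1..1} \<times> {-1..1}"]) (auto simp: K_def bounded_Times)
  ultimately have "compact K" by (simp add: compact_eq_bounded_closed)
  have contB: "continuous_on K (\<lambda>z. B (fst z) (snd z))"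
    unfolding B_def using p by (intro continuous_intros) auto
  have "\<exists>m>0. \<forall>z\<in>K. m \<le> B (fst z) (snd z)"
  proof (cases "K = {}")
    case False
    from continuous_attains_inf[OF \<open>compact K\<close> False contB] obtain z0
      where z0: "z0 \<in> K" "\<forall>z\<in>K. B (fst z0) (snd z0) \<le> B (fst z) (snd z)" by blast
    have "fst z0 + snd z0 \<noteq> 0"
    proof
      assume "fst z0 + snd z0 = 0"
      moreover have "\<delta> * (\<bar>fst z0\<bar> powr p + \<bar>snd z0\<bar> powr p) \<le> \<bar>fst z0 + snd z0\<bar> powr p"
        using z0(1) by (simp add: K_def)
      ultimately have "\<delta> * (\<bar>fst z0\<bar> powr p + \<bar>snd z0\<bar> powr p) \<le> 0" using p by simp
      then have "\<bar>fst z0\<bar> powr p + \<bar>snd z0\<bar> powr p \<le> 0" using \<delta> by (simp add: mult_le_0_iff)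
      then have "fst z0 = 0 \<and> snd z0 = 0" 
        by (smt (verit) powr_ge_zero powr_gt_zero)
      with z0(1) show False by (simp add: K_def)
    qed
    then show ?thesis using z0 Bpos by blast
  qed (auto intro: exI[of _ 1])
  then obtain m where m: "m > 0" "\<And>z. z \<in> K \<Longrightarrow> m \<le> B (fst z) (snd z)" by blast
  define C where "C = 2 powr p / m"
  have C: "0 < C" using m by (simp add: C_def)
  have main: "\<bar>u + v\<bar> powr p \<le> \<delta> * (\<bar>u\<bar> powr p + \<bar>v\<bar> powr p) + C * B u v" for u v
  proof (cases "u = 0 \<and> v = 0")
    case True then show ?thesis using p by (simp add: B_def)
  next
    case False
    define s where "s = max \<bar>u\<bar> \<bar>v\<bar>"
    have s: "0 < s" using False by (auto simp: s_def)
    define u' v' where "u' = u / s" and "v' = v / s"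
    have uv: "u = s * u'" "v = s * v'" using s by (auto simp: u'_def v'_def)
    have max1: "max \<bar>u'\<bar> \<bar>v'\<bar> = 1"
      using s by (auto simp: u'_def v'_def s_def max_def)
    have unit: "\<bar>u' + v'\<bar> powr p \<le> \<delta> * (\<bar>u'\<bar> powr p + \<bar>v'\<bar> powr p) + C * B u' v'"
    proof (cases "(u', v') \<in> K")
      case True
      have "\<bar>u' + v'\<bar> powr p \<le> 2 powr p" 
        by (rule powr_mono2) (use max1 p in \<open>auto simp: max_def split: if_splits\<close>)
      also have "\<dots> = C * m" using m by (simp add: C_def)
      also have "\<dots> \<le> C * B u' v'" using m(2)[OF True] C by simp
      also have "\<dots> \<le> \<delta> * (\<bar>u'\<bar> powr p + \<bar>v'\<bar> powr p) + C * B u' v'" using \<delta> by simp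
      finally show ?thesis .
    next
      case False
      then have "\<bar>u' + v'\<bar> powr p \<le> \<delta> * (\<bar>u'\<bar> powr p + \<bar>v'\<bar> powr p)"
        using max1 by (simp add: K_def)
      then show ?thesis using C Bnn[of u' v'] by (smt (verit) mult_nonneg_nonneg)
    qed
    have h1: "\<bar>s * x\<bar> powr p = s powr p * \<bar>x\<bar> powr p" for x
      using s by (simp add: abs_mult powr_mult)
    have h2: "signed_powr (p - 1) (s * x) * s = s powr p * signed_powr (p - 1) x" for x
      using s by (simp add: signed_powr_def abs_mult powr_mult sgn_mult powr_diff)
    have h3: "B u v = s powr p * B u' v'"
    proof -
      have "B u v = (signed_powr (p - 1) (s * u') * s + signed_powr (p - 1) (s * v') * s) * (u' + v')"
        unfolding B_def uv by (simp add: algebra_simps)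
      then show ?thesis unfolding h2 B_def by (simp add: algebra_simps)
    qed
    have "\<bar>u + v\<bar> powr p = s powr p * \<bar>u' + v'\<bar> powr p"
      using h1[of "u' + v'"] by (simp add: uv algebra_simps)
    also have "\<dots> \<le> s powr p * (\<delta> * (\<bar>u'\<bar> powr p + \<bar>v'\<bar> powr p) + C * B u' v')"
      by (intro mult_left_mono unit) auto
    also have "\<dots> = \<delta> * (\<bar>u\<bar> powr p + \<bar>v\<bar> powr p) + C * B u v"
      unfolding h3 by (simp add: h1 uv algebra_simps)
    finally show ?thesis .
  qed
  then show ?thesis using C unfolding B_def by blast
qed

section \<open>Integrals of periodic functions\<close>

lemma set_nn_integral_shift:
  fixes f :: "real \<Rightarrow> ennreal"
  assumes [measurable]: "f \<in> borel_measurable borel"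
  shows "(\<integral>\<^sup>+x\<in>{a..<b}. f (x + h) \<partial>lborel) = (\<integral>\<^sup>+x\<in>{a + h..<b + h}. f x \<partial>lborel)"
proof -
  have "(\<integral>\<^sup>+x. f x * indicator {a + h..<b + h} x \<partial>lborel) =
      ennreal \<bar>1\<bar> * (\<integral>\<^sup>+x. f (h + 1 * x) * indicator {a + h..<b + h} (h + 1 * x) \<partial>lborel)"
    by (rule nn_integral_real_affine) auto
  also have "\<dots> = (\<integral>\<^sup>+x. f (x + h) * indicator {a..<b} x \<partial>lborel)"
    by (auto intro!: nn_integral_cong simp: indicator_def add.commute)
  finally show ?thesis by simp
qed

lemma periodic_add_int:
  fixes f :: "real \<Rightarrow> 'a"
  assumes per: "\<And>x. f (x + 2) = f x"
  shows "f (x + 2 * of_int k) = f x"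
proof -
  have nat: "f (x + 2 * of_nat n) = f x" for n x
  proof (induction n)
    case (Suc n)
    then show ?case using per[of "x + 2 * of_nat n"] by (simp add: algebra_simps)
  qed simp
  show ?thesis
  proof (cases "0 \<le> k")
    case True
    then show ?thesis using nat[of x "nat k"] by simp
  next
    case False
    then show ?thesis using nat[of "x + 2 * of_int k" "nat (- k)"] by simp
  qed
qed

lemma set_nn_integral_periodic_window:
  fixes f :: "real \<Rightarrow> ennreal"
  assumes f[measurable]: "f \<in> borel_measurable borel"
    and per: "\<And>x. f (x + 2) = f x"
  shows "(\<integral>\<^sup>+x\<in>{c..<c + 2}. f x \<partial>lborel) = (\<integral>\<^sup>+x\<in>{0..<2}. f x \<partial>lborel)"
proof -
  define k where "k = \<lfloor>c / 2\<rfloor>"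
  define r where "r = c - 2 * of_int k"
  have r: "0 \<le> r" "r < 2" unfolding r_def k_def by linarith+
  have c: "c = r + 2 * of_int k" by (simp add: r_def)
  have "(\<integral>\<^sup>+x\<in>{c..<c + 2}. f x \<partial>lborel) = (\<integral>\<^sup>+x\<in>{r..<r + 2}. f x \<partial>lborel)"
  proof -
    have "c + 2 = (r + 2) + 2 * of_int k" by (simp add: c)
    then show ?thesis
      using set_nn_integral_shift[OF f, where a = r and b = "r + 2" and h = "2 * of_int k"]
      unfolding periodic_add_int[of f, OF per] by (metis c)
  qed
  also have "\<dots> = (\<integral>\<^sup>+x. f x * indicator {r..<2} x + f x * indicator {2..<r + 2} x \<partial>lborel)"
    using r by (intro nn_integral_cong) (auto simp: indicator_def)
  also have "\<dots> = (\<integral>\<^sup>+x\<in>{r..<2}. f x \<partial>lborel) + (\<integral>\<^sup>+x\<in>{2..<r + 2}. f x \<partial>lborel)"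
    by (rule nn_integral_add) auto
  also have "(\<integral>\<^sup>+x\<in>{2..<r + 2}. f x \<partial>lborel) = (\<integral>\<^sup>+x\<in>{0..<r}. f x \<partial>lborel)"
    using set_nn_integral_shift[OF f, where a = 0 and b = r and h = 2] by (simp add: per)
  also have "(\<integral>\<^sup>+x\<in>{r..<2}. f x \<partial>lborel) + (\<integral>\<^sup>+x\<in>{0..<r}. f x \<partial>lborel) =
      (\<integral>\<^sup>+x. f x * indicator {r..<2} x + f x * indicator {0..<r} x \<partial>lborel)"
    by (rule nn_integral_add[symmetric]) auto
  also have "\<dots> = (\<integral>\<^sup>+x\<in>{0..<2}. f x \<partial>lborel)"
    using r by (intro nn_integral_cong) (auto simp: indicator_def)
  finally show ?thesis .
qed

text \<open>
  Rotations and reflections preserve the length measure of the circle of length two, and the circle may be cut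
  open at any point. Reflection moves the end points of the half-open interval, which costs a null set.
\<close>

lemma set_nn_integral_periodic_affine:
  fixes f :: "real \<Rightarrow> ennreal"
  assumes f[measurable]: "f \<in> borel_measurable borel"
    and per: "\<And>x. f (x + 2) = f x" and s: "s = 1 \<or> s = -1"
  shows "(\<integral>\<^sup>+x\<in>{a..<a + 2}. f (c + s * x) \<partial>lborel) = (\<integral>\<^sup>+x\<in>{0..<2}. f x \<partial>lborel)"
proof -
  have per': "f (c + s * (x + 2)) = f (c + s * x)" for x
    using s per[of "c + x"] per[of "c - x - 2"] by (auto simp: algebra_simps)
  have "(\<integral>\<^sup>+x\<in>{a..<a + 2}. f (c + s * x) \<partial>lborel) = (\<integral>\<^sup>+x\<in>{0..<2}. f (c + s * x) \<partial>lborel)"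
    by (rule set_nn_integral_periodic_window[of "\<lambda>x. f (c + s * x)"]) (use per' in auto)
  also have "\<dots> = (\<integral>\<^sup>+x\<in>{0..<2}. f x \<partial>lborel)"
    using s
  proof
    assume "s = 1"
    then show ?thesis
      using set_nn_integral_shift[OF f, where a = 0 and b = 2 and h = c] set_nn_integral_periodic_window[OF f per, of c]
      by (simp add: add.commute)
  next
    assume [simp]: "s = -1"
    have "(\<integral>\<^sup>+x\<in>{c - 2..<c - 2 + 2}. f x \<partial>lborel) =
        ennreal \<bar>- 1\<bar> * (\<integral>\<^sup>+x. f (c + (- 1) * x) * indicator {c - 2..<c - 2 + 2} (c + (- 1) * x) \<partial>lborel)"
      by (rule nn_integral_real_affine) auto
    also have "\<dots> = (\<integral>\<^sup>+x. f (c + (- 1) * x) * indicator {c - 2..<c - 2 + 2} (c + (- 1) * x) \<partial>lborel)"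
      by simp
    also have "\<dots> = (\<integral>\<^sup>+x\<in>{0..<2}. f (c + s * x) \<partial>lborel)"
    proof (rule nn_integral_cong_AE)
      have "AE x in lborel. x \<noteq> (0::real)" "AE x in lborel. x \<noteq> (2::real)"
        by (rule AE_lborel_singleton)+
      then show "AE x in lborel. f (c + (- 1) * x) * indicator {c - 2..<c - 2 + 2} (c + (- 1) * x) =
          f (c + s * x) * indicator {0..<2} x"
        by eventually_elim (auto simp: indicator_def)
    qed
    finally show ?thesis using set_nn_integral_periodic_window[OF f per, of "c - 2"] by simp
  qed
  finally show ?thesis .
qed

lemma set_nn_integral_periodic_multiple:
  fixes f :: "real \<Rightarrow> ennreal"
  assumes f[measurable]: "f \<in> borel_measurable borel"
    and per: "\<And>x. f (x + 2) = f x"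
  shows "(\<integral>\<^sup>+x\<in>{c..<c + 2 * real n}. f x \<partial>lborel) = of_nat n * (\<integral>\<^sup>+x\<in>{0..<2}. f x \<partial>lborel)"
proof (induction n)
  case (Suc n)
  have "(\<integral>\<^sup>+x\<in>{c..<c + 2 * real (Suc n)}. f x \<partial>lborel) =
     (\<integral>\<^sup>+x. f x * indicator {c..<c + 2 * real n} x +
        f x * indicator {c + 2 * real n..<(c + 2 * real n) + 2} x \<partial>lborel)"
    by (intro nn_integral_cong) (auto simp: indicator_def)
  also have "\<dots> = (\<integral>\<^sup>+x\<in>{c..<c + 2 * real n}. f x \<partial>lborel) +
      (\<integral>\<^sup>+x\<in>{c + 2 * real n..<(c + 2 * real n) + 2}. f x \<partial>lborel)"
    by (rule nn_integral_add) auto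
  finally show ?case
    unfolding Suc set_nn_integral_periodic_window[OF f per] by (simp add: algebra_simps)
qed simp

section \<open>Continuity of translations\<close>

definition shift_dist :: "(real \<Rightarrow> real) \<Rightarrow> real \<Rightarrow> ennreal" where
  "shift_dist f h = (\<integral>\<^sup>+x. ennreal \<bar>f (x + h) - f x\<bar> \<partial>lborel)"

lemma nn_integral_shift:
  fixes f :: "real \<Rightarrow> ennreal"
  assumes [measurable]: "f \<in> borel_measurable borel"
  shows "(\<integral>\<^sup>+x. f (x + h) \<partial>lborel) = (\<integral>\<^sup>+x. f x \<partial>lborel)"
  using nn_integral_real_affine[of f 1 h] by (simp add: add.commute)

text \<open>
  Both the function and its translate are replaced by an approximation, and both replacements cost the same
  because the Lebesgue measure is translation invariant.
\<close>

lemma shift_dist_le_approx: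
  assumes [measurable]: "f \<in> borel_measurable borel" "g \<in> borel_measurable borel"
  shows "shift_dist f h \<le> 2 * (\<integral>\<^sup>+x. ennreal \<bar>f x - g x\<bar> \<partial>lborel) + shift_dist g h"
proof -
  have "shift_dist f h \<le> (\<integral>\<^sup>+x. ennreal \<bar>f (x + h) - g (x + h)\<bar> + ennreal \<bar>f x - g x\<bar> +
      ennreal \<bar>g (x + h) - g x\<bar> \<partial>lborel)"
    unfolding shift_dist_def
    by (intro nn_integral_mono) (simp flip: ennreal_plus add: ennreal_leI)
  also have "\<dots> = (\<integral>\<^sup>+x. ennreal \<bar>f (x + h) - g (x + h)\<bar> \<partial>lborel) +
      (\<integral>\<^sup>+x. ennreal \<bar>f x - g x\<bar> \<partial>lborel) + shift_dist g h"
    unfolding shift_dist_def by (simp add: nn_integral_add)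
  also have "(\<integral>\<^sup>+x. ennreal \<bar>f (x + h) - g (x + h)\<bar> \<partial>lborel) = (\<integral>\<^sup>+x. ennreal \<bar>f x - g x\<bar> \<partial>lborel)"
    by (rule nn_integral_shift[of "\<lambda>x. ennreal \<bar>f x - g x\<bar>"]) auto
  finally show ?thesis by (simp add: mult_2)
qed

lemma tendsto_shift_dist_approx:
  assumes [measurable]: "f \<in> borel_measurable borel"
    and ex: "\<And>e. 0 < e \<Longrightarrow> \<exists>g. g \<in> borel_measurable borel \<and>
      (\<integral>\<^sup>+x. ennreal \<bar>f x - g x\<bar> \<partial>lborel) \<le> ennreal e \<and> (shift_dist g \<longlongrightarrow> 0) (at 0)"
  shows "(shift_dist f \<longlongrightarrow> 0) (at 0)"
proof (rule order_tendstoI)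
  fix a :: ennreal assume "0 < a"
  obtain e where e: "0 < e" "ennreal (3 * e) \<le> a"
  proof (cases a)
    case (real r)
    then show ?thesis using \<open>0 < a\<close> by (intro that[of "r / 3"]) auto
  qed (use that[of 1] in auto)
  from ex[OF e(1)] obtain g where [measurable]: "g \<in> borel_measurable borel" and
    g: "(\<integral>\<^sup>+x. ennreal \<bar>f x - g x\<bar> \<partial>lborel) \<le> ennreal e" "(shift_dist g \<longlongrightarrow> 0) (at 0)" by blast
  have "\<forall>\<^sub>F h in at 0. shift_dist g h < ennreal e"
    using order_tendstoD(2)[OF g(2)] e by simp
  then show "\<forall>\<^sub>F h in at 0. shift_dist f h < a"
  proof eventually_elim
    case (elim h)
    have "shift_dist f h \<le> 2 * (\<integral>\<^sup>+x. ennreal \<bar>f x - g x\<bar> \<partial>lborel) + shift_dist g h"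
      by (rule shift_dist_le_approx) auto
    also have "\<dots> \<le> 2 * ennreal e + shift_dist g h"
      by (intro add_mono mult_left_mono g) auto
    also have "\<dots> < 2 * ennreal e + ennreal e"
      using elim
      by (simp add: ennreal_mult_eq_top_iff)
    also have "2 * ennreal e + ennreal e = ennreal (3 * e)"
      using e(1) by (simp add: ennreal_plus[symmetric] ennreal_numeral[symmetric] ennreal_mult[symmetric]
          del: ennreal_plus ennreal_numeral)
    finally show ?case using e(2) by simp
  qed
qed simp

text \<open>
  For an open set \<open>U\<close> and a point \<open>x \<in> U\<close>, also \<open>x + h \<in> U\<close> for
  all small \<open>h\<close>; so the measure of the part of \<open>U\<close> that leaves \<open>U\<close>
  tends to zero by dominated convergence. The part that enters \<open>U\<close> has the same measure as the
  part that leaves it under the opposite translation.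
\<close>

lemma tendsto_shift_dist_open:
  fixes U :: "real set"
  assumes U: "open U" and fin: "emeasure lborel U < \<infinity>"
  shows "(shift_dist (indicator U) \<longlongrightarrow> 0) (at 0)"
proof -
  have [measurable]: "U \<in> sets borel" using U by simp
  define w where "w h = (\<integral>\<^sup>+x. indicator U x * indicator (- U) (x + h) \<partial>lborel)" for h :: real
  have eq: "shift_dist (indicator U) h = w (- h) + w h" for h
  proof -
    have "shift_dist (indicator U) h = (\<integral>\<^sup>+x. indicator U (x + h) * indicator (- U) ((x + h) + (- h)) +
        indicator U x * indicator (- U) (x + h) \<partial>lborel)"
      unfolding shift_dist_def by (intro nn_integral_cong) (auto simp: indicator_def)
    also have "\<dots> = (\<integral>\<^sup>+x. indicator U (x + h) * indicator (- U) ((x + h) + (- h)) \<partial>lborel) + w h"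
      unfolding w_def by (rule nn_integral_add) auto
    also have "(\<integral>\<^sup>+x. indicator U (x + h) * indicator (- U) ((x + h) + (- h)) \<partial>lborel) = w (- h)"
      unfolding w_def
      by (rule nn_integral_shift[of "\<lambda>x. indicator U x * indicator (- U) (x + (- h))"]) auto
    finally show ?thesis .
  qed
  have w: "(w \<longlongrightarrow> 0) (at 0)"
    unfolding tendsto_at_iff_sequentially
  proof safe
    fix X :: "nat \<Rightarrow> real" assume X: "X \<longlonglongrightarrow> 0"
    have "(\<lambda>i. w (X i)) \<longlonglongrightarrow> integral\<^sup>N lborel (\<lambda>x::real. 0)"
      unfolding w_def
    proof (rule nn_integral_dominated_convergence[where w = "indicator U"])
      show "AE x in lborel. (\<lambda>i. indicator U x * indicator (- U) (x + X i)) \<longlonglongrightarrow> (0::ennreal)"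
      proof (rule AE_I2)
        fix x :: real
        show "(\<lambda>i. indicator U x * indicator (- U) (x + X i)) \<longlonglongrightarrow> (0::ennreal)"
        proof (cases "x \<in> U")
          case True
          have "(\<lambda>i. x + X i) \<longlonglongrightarrow> x + 0" by (intro tendsto_intros X)
          then have "\<forall>\<^sub>F i in sequentially. x + X i \<in> U"
            using U True by (auto dest: topological_tendstoD)
          then have "\<forall>\<^sub>F i in sequentially. indicator U x * indicator (- U) (x + X i) = (0::ennreal)"
            by eventually_elim auto
          then show ?thesis by (rule tendsto_eventually)
        qed simp
      qed
      show "\<And>j. AE x in lborel. indicator U x * indicator (- U) (x + X j) \<le> (indicator U x :: ennreal)"
        by (auto simp: indicator_def)
    qed (use fin in auto)
    then show "(w \<circ> X) \<longlonglongrightarrow> 0" by (simp add: comp_def)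
  qed
  have "((\<lambda>h. w (- h)) \<longlongrightarrow> 0) (at 0)"
  proof (rule filterlim_compose[OF w])
    have "((\<lambda>h::real. - h) \<longlongrightarrow> - 0) (at 0)" by (intro tendsto_intros)
    then show "filterlim uminus (at 0) (at (0::real))"
      by (auto simp: filterlim_at eventually_at_filter)
  qed
  from tendsto_add[OF this w] show ?thesis unfolding eq[abs_def] by simp
qed

text \<open>
  By outer regularity the indicator is an \<open>L\<^sup>1\<close>-limit of indicators of open sets.
\<close>

lemma tendsto_shift_dist_indicator:
  fixes A :: "real set"
  assumes A[measurable]: "A \<in> sets borel" and fin: "emeasure lborel A < \<infinity>"
  shows "(shift_dist (indicator A) \<longlongrightarrow> 0) (at 0)"
proof (rule tendsto_shift_dist_approx)
  fix e :: real assume e: "0 < e"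
  obtain U where U: "open U" "A \<subseteq> U" "emeasure lebesgue (U - A) < ennreal e"
  proof -
    have "A \<in> sets lebesgue" using A by (intro sets_completionI_sets) simp
    from sets_lebesgue_outer_open[OF this e] show ?thesis using that by metis
  qed
  have [measurable]: "U \<in> sets borel" using U by simp
  have UA: "emeasure lborel (U - A) < ennreal e" using U(3) by simp
  have "emeasure lborel U = emeasure lborel A + emeasure lborel (U - A)"
    using U(2) by (subst plus_emeasure) (auto intro: arg_cong2[where f = emeasure])
  also have "\<dots> < \<infinity>" using fin UA by (auto simp: less_top[symmetric] top_unique)
  finally have "(shift_dist (indicator U) \<longlongrightarrow> 0) (at 0)"
    by (intro tendsto_shift_dist_open U)
  moreover have "(\<integral>\<^sup>+x. ennreal \<bar>indicator A x - indicator U x\<bar> \<partial>lborel) = emeasure lborel (U - A)"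
    using U(2) by (subst nn_integral_indicator[symmetric])
      (auto intro!: nn_integral_cong simp: indicator_def simp del: nn_integral_indicator)
  ultimately show "\<exists>g. g \<in> borel_measurable borel \<and>
      (\<integral>\<^sup>+x. ennreal \<bar>indicator A x - g x\<bar> \<partial>lborel) \<le> ennreal e \<and> (shift_dist g \<longlongrightarrow> 0) (at 0)"
    using UA by (intro exI[of _ "indicator U"]) auto
qed auto

lemma tendsto_shift_dist:
  fixes f :: "real \<Rightarrow> real"
  assumes "integrable lborel f"
  shows "(shift_dist f \<longlongrightarrow> 0) (at 0)"
  using assms
proof (induction rule: integrable_induct)
  case (base A c)
  have [measurable]: "A \<in> sets borel" using base by simp
  have "((\<lambda>h. ennreal \<bar>c\<bar> * shift_dist (indicator A) h) \<longlongrightarrow> ennreal \<bar>c\<bar> * 0) (at 0)"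
    using base by (intro tendsto_shift_dist_indicator ennreal_tendsto_cmult) auto
  moreover have "shift_dist (\<lambda>x. indicator A x *\<^sub>R c) h = ennreal \<bar>c\<bar> * shift_dist (indicator A) h" for h
    unfolding shift_dist_def by (subst nn_integral_cmult[symmetric])
      (auto intro!: nn_integral_cong simp: ennreal_mult[symmetric] abs_mult[symmetric] algebra_simps)
  ultimately show ?case by simp
next
  case (add f g)
  have [measurable]: "f \<in> borel_measurable borel" "g \<in> borel_measurable borel" using add by auto
  have "((\<lambda>h. shift_dist f h + shift_dist g h) \<longlongrightarrow> 0 + 0) (at 0)"
    by (intro tendsto_add add)
  then show ?case unfolding add_0
  proof (rule tendsto_sandwich[OF _ _ tendsto_const, rotated 2])
    have "shift_dist (\<lambda>x. f x + g x) h \<le>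
      (\<integral>\<^sup>+x. ennreal \<bar>f (x + h) - f x\<bar> + ennreal \<bar>g (x + h) - g x\<bar> \<partial>lborel)" for h
      unfolding shift_dist_def
      by (intro nn_integral_mono) (simp flip: ennreal_plus add: ennreal_leI)
    then show "\<forall>\<^sub>F h in at 0. shift_dist (\<lambda>x. f x + g x) h \<le> shift_dist f h + shift_dist g h"
      by (simp add: nn_integral_add shift_dist_def)
  qed auto
next
  case (lim f s)
  have [measurable]: "f \<in> borel_measurable borel" "\<And>i. s i \<in> borel_measurable borel" using lim by auto
  show ?case
  proof (rule tendsto_shift_dist_approx)
    fix e :: real assume e: "0 < e"
    have "(\<lambda>i. \<integral>\<^sup>+x. ennreal (norm (f x - s i x)) \<partial>lborel) \<longlonglongrightarrow> 0"
      by (rule nn_integral_dominated_convergence_norm[where w = "\<lambda>x. 2 * norm (f x)"])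
         (use lim in \<open>auto simp: integrable_iff_bounded ennreal_mult nn_integral_cmult ennreal_mult_less_top\<close>)
    then have "\<forall>\<^sub>F i in sequentially. (\<integral>\<^sup>+x. ennreal (norm (f x - s i x)) \<partial>lborel) < ennreal e"
      by (rule order_tendstoD(2)) (use e in simp)
    then obtain i where "(\<integral>\<^sup>+x. ennreal (norm (f x - s i x)) \<partial>lborel) < ennreal e"
      using eventually_happens' sequentially_bot by blast
    with lim show "\<exists>g. g \<in> borel_measurable borel \<and>
      (\<integral>\<^sup>+x. ennreal \<bar>f x - g x\<bar> \<partial>lborel) \<le> ennreal e \<and> (shift_dist g \<longlongrightarrow> 0) (at 0)"
      by (intro exI[of _ "s i"]) (auto intro: less_imp_le)
  qed auto
qed

text \<open>
  Both kinds of traces of a function \<open>g t (x + t)\<close>, the one at a fixed time and the one at a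
  fixed place, are of the form \<open>P r (w + c * r)\<close> with \<open>c = 1\<close> or
  \<open>c = -1\<close>, where \<open>r\<close> is the parameter that is held fixed and \<open>P\<close>
  depends continuously on \<open>r\<close> for every fixed characteristic. The change of \<open>P\<close> is
  controlled by dominated convergence and the change of the argument by the continuity of translations,
  applied to \<open>signed_powr p\<close> of the truncated function \<open>P r0\<close>.
\<close>

lemma tendsto_moving_slice:
  fixes P :: "real \<Rightarrow> real \<Rightarrow> real"
  assumes p: "1 \<le> p" and I: "bounded I" "r0 \<in> I" and c: "c = 1 \<or> c = -1"
    and P[measurable]: "\<And>r. P r \<in> borel_measurable borel"
    and E[measurable]: "E \<in> borel_measurable borel"
    and bd: "\<And>r z. r \<in> I \<Longrightarrow> \<bar>P r z\<bar> \<le> E z"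
    and fin: "\<And>R. (\<integral>\<^sup>+z\<in>{- R..R}. ennreal (E z powr p) \<partial>lborel) < \<infinity>"
    and cont: "\<And>z. continuous_on I (\<lambda>r. P r z)"
  shows "((\<lambda>r. \<integral>\<^sup>+w\<in>{0..T}. ennreal (\<bar>P r (w + c * r) - P r0 (w + c * r0)\<bar> powr p) \<partial>lborel) \<longlongrightarrow> 0)
    (at r0 within I)"
proof -
  obtain B where B: "\<And>r. r \<in> I \<Longrightarrow> \<bar>r\<bar> \<le> B" using I(1) by (auto simp: bounded_iff)
  define R where "R = \<bar>T\<bar> + B"
  have R: "w + c * r \<in> {- R..R}" if "w \<in> {0..T}" "r \<in> I" for w r
    using B[OF that(2)] that(1) c by (auto simp: R_def abs_le_iff)
  define F where "F x = signed_powr p (P r0 x * indicator {- R..R} x)" for x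
  have [measurable]: "F \<in> borel_measurable borel" unfolding F_def by measurable
  have Enn: "0 \<le> E z" for z using bd[OF I(2), of z] by linarith
  have "integrable lborel F"
  proof (rule integrableI_bounded)
    have "(\<integral>\<^sup>+x. ennreal (norm (F x)) \<partial>lborel) \<le> (\<integral>\<^sup>+z\<in>{- R..R}. ennreal (E z powr p) \<partial>lborel)"
      using bd[OF I(2)] p
      by (intro nn_integral_mono) (auto simp: F_def abs_signed_powr indicator_def intro!: ennreal_leI powr_mono2)
    then show "(\<integral>\<^sup>+x. ennreal (norm (F x)) \<partial>lborel) < \<infinity>" using fin[of R] by (rule le_less_trans)
  qed auto
  then have sd: "(shift_dist F \<longlongrightarrow> 0) (at 0)" by (rule tendsto_shift_dist)
  have "filterlim (\<lambda>r. c * (r - r0)) (at 0) (at r0 within I)"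
  proof -
    have "((\<lambda>r. c * (r - r0)) \<longlongrightarrow> c * (r0 - r0)) (at r0 within I)" by (intro tendsto_intros)
    then show ?thesis using c by (auto simp: filterlim_at eventually_at_filter)
  qed
  from filterlim_compose[OF sd this]
  have lim2: "((\<lambda>r. shift_dist F (c * (r - r0))) \<longlongrightarrow> 0) (at r0 within I)" .
  define H where "H r = (\<integral>\<^sup>+z. ennreal (\<bar>P r z - P r0 z\<bar> powr p) * indicator {- R..R} z \<partial>lborel)" for r
  have lim1: "(H \<longlongrightarrow> 0) (at r0 within I)"
    unfolding tendsto_at_iff_sequentially
  proof safe
    fix X :: "nat \<Rightarrow> real" assume X: "\<forall>i. X i \<in> I - {r0}" "X \<longlonglongrightarrow> r0"
    have "(\<lambda>i. H (X i)) \<longlonglongrightarrow> integral\<^sup>N lborel (\<lambda>x::real. 0)"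
      unfolding H_def
    proof (rule nn_integral_dominated_convergence
        [where w = "\<lambda>z. ennreal (2 powr p * 2) * (ennreal (E z powr p) * indicator {- R..R} z)"])
      show "AE z in lborel. ennreal (\<bar>P (X j) z - P r0 z\<bar> powr p) * indicator {- R..R} z
          \<le> ennreal (2 powr p * 2) * (ennreal (E z powr p) * indicator {- R..R} z)" for j
      proof (rule AE_I2)
        fix z
        have "\<bar>P (X j) z - P r0 z\<bar> powr p \<le> 2 powr p * (\<bar>P (X j) z\<bar> powr p + \<bar>P r0 z\<bar> powr p)"
          using p by (intro abs_diff_powr_le) auto
        also have "\<dots> \<le> 2 powr p * (E z powr p + E z powr p)"
          using bd[of "X j" z] bd[OF I(2), of z] X p
          by (intro mult_left_mono add_mono powr_mono2) auto
        finally show "ennreal (\<bar>P (X j) z - P r0 z\<bar> powr p) * indicator {- R..R} z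
            \<le> ennreal (2 powr p * 2) * (ennreal (E z powr p) * indicator {- R..R} z)"
          by (auto simp: indicator_def ennreal_mult[symmetric] intro!: ennreal_leI)
      qed
      show "AE z in lborel. (\<lambda>i. ennreal (\<bar>P (X i) z - P r0 z\<bar> powr p) * indicator {- R..R} z) \<longlonglongrightarrow> 0"
      proof (rule AE_I2)
        fix z
        have "(\<lambda>i. P (X i) z) \<longlonglongrightarrow> P r0 z"
          using cont[of z] X I(2) unfolding continuous_on_sequentially by (auto simp: comp_def)
        then have "(\<lambda>i. \<bar>P (X i) z - P r0 z\<bar>) \<longlonglongrightarrow> 0" 
          by (intro tendsto_rabs_zero LIM_zero)
        then have "(\<lambda>i. \<bar>P (X i) z - P r0 z\<bar> powr p) \<longlonglongrightarrow> 0"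
          by (rule tendsto_zero_powrI[OF _ tendsto_const]) (use p in auto)
        then have "(\<lambda>i. ennreal (\<bar>P (X i) z - P r0 z\<bar> powr p)) \<longlonglongrightarrow> ennreal 0"
          by (rule tendsto_ennrealI)
        then show "(\<lambda>i. ennreal (\<bar>P (X i) z - P r0 z\<bar> powr p) * indicator {- R..R} z) \<longlonglongrightarrow> 0"
          by (cases "z \<in> {- R..R}") auto
      qed
      show "(\<integral>\<^sup>+z. ennreal (2 powr p * 2) * (ennreal (E z powr p) * indicator {- R..R} z) \<partial>lborel) < \<infinity>"
        using fin[of R] by (subst nn_integral_cmult) (auto simp: ennreal_mult_less_top)
    qed auto
    then show "(H \<circ> X) \<longlonglongrightarrow> 0" by (simp add: comp_def)
  qed
  have le: "(\<integral>\<^sup>+w\<in>{0..T}. ennreal (\<bar>P r (w + c * r) - P r0 (w + c * r0)\<bar> powr p) \<partial>lborel) \<le>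
      ennreal (2 powr p) * (H r + ennreal (2 powr p) * shift_dist F (c * (r - r0)))" if r: "r \<in> I" for r
  proof -
    have "(\<integral>\<^sup>+w\<in>{0..T}. ennreal (\<bar>P r (w + c * r) - P r0 (w + c * r0)\<bar> powr p) \<partial>lborel) \<le>
       (\<integral>\<^sup>+w. ennreal (2 powr p) * (ennreal (\<bar>P r (w + c * r) - P r0 (w + c * r)\<bar> powr p) * indicator {- R..R} (w + c * r)
         + ennreal (2 powr p) * ennreal \<bar>F ((w + c * r0) + c * (r - r0)) - F (w + c * r0)\<bar>) \<partial>lborel)"
    proof (rule nn_integral_mono)
      fix w
      show "ennreal (\<bar>P r (w + c * r) - P r0 (w + c * r0)\<bar> powr p) * indicator {0..T} w \<le>
        ennreal (2 powr p) * (ennreal (\<bar>P r (w + c * r) - P r0 (w + c * r)\<bar> powr p) * indicator {- R..R} (w + c * r)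
         + ennreal (2 powr p) * ennreal \<bar>F ((w + c * r0) + c * (r - r0)) - F (w + c * r0)\<bar>)"
      proof (cases "w \<in> {0..T}")
        case True
        have i: "indicator {- R..R} (w + c * r) = (1::real)" "indicator {- R..R} (w + c * r0) = (1::real)"
          "indicator {- R..R} (w + c * r) = (1::ennreal)"
          using R[OF True r] R[OF True I(2)] by (auto simp: indicator_def)
        have e: "(w + c * r0) + c * (r - r0) = w + c * r" by (simp add: algebra_simps)
        have "\<bar>P r (w + c * r) - P r0 (w + c * r0)\<bar> powr p \<le>
            2 powr p * (\<bar>P r (w + c * r) - P r0 (w + c * r)\<bar> powr p + \<bar>P r0 (w + c * r) - P r0 (w + c * r0)\<bar> powr p)"
          using p abs_add_powr_le[of p "P r (w + c * r) - P r0 (w + c * r)" "P r0 (w + c * r) - P r0 (w + c * r0)"] by simp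
        also have "\<bar>P r0 (w + c * r) - P r0 (w + c * r0)\<bar> powr p \<le> 2 powr p * \<bar>F (w + c * r) - F (w + c * r0)\<bar>"
          using abs_diff_powr_le_signed_powr[OF p, of "P r0 (w + c * r)" "P r0 (w + c * r0)"] by (simp add: F_def i)
        finally show ?thesis
          using True unfolding e i
          by (simp add: ennreal_mult[symmetric] ennreal_plus[symmetric] ennreal_leI del: ennreal_plus)
      qed simp
    qed
    also have "\<dots> = ennreal (2 powr p) * ((\<integral>\<^sup>+w. ennreal (\<bar>P r (w + c * r) - P r0 (w + c * r)\<bar> powr p) * indicator {- R..R} (w + c * r) \<partial>lborel)
         + ennreal (2 powr p) * (\<integral>\<^sup>+w. ennreal \<bar>F ((w + c * r0) + c * (r - r0)) - F (w + c * r0)\<bar> \<partial>lborel))"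
      by (simp add: nn_integral_cmult nn_integral_add)
    also have "(\<integral>\<^sup>+w. ennreal (\<bar>P r (w + c * r) - P r0 (w + c * r)\<bar> powr p) * indicator {- R..R} (w + c * r) \<partial>lborel) = H r"
      unfolding H_def
      by (rule nn_integral_shift[of "\<lambda>z. ennreal (\<bar>P r z - P r0 z\<bar> powr p) * indicator {- R..R} z"]) auto
    also have "(\<integral>\<^sup>+w. ennreal \<bar>F ((w + c * r0) + c * (r - r0)) - F (w + c * r0)\<bar> \<partial>lborel) = shift_dist F (c * (r - r0))"
      unfolding shift_dist_def
      by (rule nn_integral_shift[of "\<lambda>z. ennreal \<bar>F (z + c * (r - r0)) - F z\<bar>"]) auto
    finally show ?thesis .
  qed
  have "((\<lambda>r. ennreal (2 powr p) * (H r + ennreal (2 powr p) * shift_dist F (c * (r - r0)))) \<longlongrightarrow>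
     ennreal (2 powr p) * (0 + ennreal (2 powr p) * 0)) (at r0 within I)"
    by (intro ennreal_tendsto_cmult tendsto_add lim1 lim2) auto
  then show ?thesis unfolding mult_zero_right add_0
  proof (rule tendsto_sandwich[OF _ _ tendsto_const, rotated 2])
    show "\<forall>\<^sub>F r in at r0 within I. (\<integral>\<^sup>+w\<in>{0..T}. ennreal (\<bar>P r (w + c * r) - P r0 (w + c * r0)\<bar> powr p) \<partial>lborel)
        \<le> ennreal (2 powr p) * (H r + ennreal (2 powr p) * shift_dist F (c * (r - r0)))"
      using le by (auto simp: eventually_at_filter)
  qed auto
qed

section \<open>Existence for the equation on the circle\<close>

lemma measurable_binary:
  assumes "case_prod f \<in> borel_measurable (borel \<Otimes>\<^sub>M borel)"
    "u \<in> borel_measurable N" "v \<in> borel_measurable N"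
  shows "(\<lambda>x. f (u x) (v x)) \<in> borel_measurable N"
  using measurable_compose[OF measurable_Pair[OF assms(2,3)] assms(1)] by simp

text \<open>
  The damping coefficient in characteristic coordinates: \<open>b s z\<close> is the value at time
  \<open>s\<close> and place \<open>z - s\<close> of the coefficient \<open>a\<close> after its even,
  two-periodic extension in space. Evenness of the extension becomes \<open>b s (2 * s - z) = b s z\<close>.
\<close>

locale damping =
  fixes b :: "real \<Rightarrow> real \<Rightarrow> real" and M :: real
  assumes b_meas: "case_prod b \<in> borel_measurable (borel \<Otimes>\<^sub>M borel)"
    and b_nonneg: "0 \<le> b s z" and b_le: "b s z \<le> M" and M_pos: "0 < M"
    and b_per: "b s (z + 2) = b s z" and b_refl: "b s (2 * s - z) = b s z"
begin

lemmas b_measurable [measurable (raw)] = measurable_binary[OF b_meas]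

text \<open>
  The equation \<open>g' = - b / 2 * (g + g \<circ> reflection)\<close> for
  \<open>g = u True - u False\<close> follows from a system with nonnegative coefficients in which the rate of
  \<open>u \<sigma>\<close> is driven by \<open>u (\<not> \<sigma>)\<close>, and where \<open>u True\<close>
  and \<open>u False\<close> start from the positive and the negative part of the initial value. The Picard
  iterates of that system increase, so they may take values in the extended nonnegative reals and converge by
  monotone convergence. As \<open>ennreal\<close> sends negative numbers to zero, \<open>ennreal (f z)\<close>
  and \<open>ennreal (- f z)\<close> are the two parts of \<open>f z\<close>.
\<close>

primrec picard :: "(real \<Rightarrow> real) \<Rightarrow> nat \<Rightarrow> bool \<Rightarrow> real \<Rightarrow> real \<Rightarrow> ennreal" where
  "picard f 0 = (\<lambda>\<sigma> t z. 0)"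
| "picard f (Suc n) = (\<lambda>\<sigma> t z. ennreal (if \<sigma> then f z else - f z) +
     (\<integral>\<^sup>+s. ennreal (b s z / 2) * (picard f n (\<not> \<sigma>) s z + picard f n (\<not> \<sigma>) s (2 * s - z)) * indicator {0..t} s \<partial>lborel))"

lemma picard_measurable:
  assumes [measurable]: "f \<in> borel_measurable borel"
  shows "case_prod (picard f n \<sigma>) \<in> borel_measurable (borel \<Otimes>\<^sub>M borel)"
proof (induction n arbitrary: \<sigma>)
  case (Suc n)
  note [measurable (raw)] = measurable_binary[OF Suc]
  have [measurable]: "(\<lambda>x. indicator {0..fst (fst x)} (snd x) :: ennreal) \<in>
      borel_measurable ((borel \<Otimes>\<^sub>M borel) \<Otimes>\<^sub>M (borel :: real measure))"
    unfolding indicator_def atLeastAtMost_iff by measurable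
  show ?case
    unfolding picard.simps split_beta' by measurable
qed (simp add: case_prod_unfold)

lemma picard_periodic:
  assumes "\<And>z. f (z + 2) = f z"
  shows "picard f n \<sigma> t (z + 2) = picard f n \<sigma> t z"
proof (induction n arbitrary: \<sigma> t z)
  case (Suc n)
  have "picard f n \<sigma> s (2 * s - (z + 2)) = picard f n \<sigma> s (2 * s - z)" for \<sigma> s
    using Suc[of \<sigma> s "2 * s - (z + 2)"] by (simp add: algebra_simps)
  then show ?case by (simp add: assms Suc b_per)
qed simp

lemma picard_mono: "picard f n \<sigma> t z \<le> picard f (Suc n) \<sigma> t z"
proof (induction n arbitrary: \<sigma> t z)
  case (Suc n)
  have step: "ennreal (if \<sigma> then f z else - f z) +
      (\<integral>\<^sup>+s. ennreal (b s z / 2) * (v (\<not> \<sigma>) s z + v (\<not> \<sigma>) s (2 * s - z)) * indicator {0..t} s \<partial>lborel)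
    \<le> ennreal (if \<sigma> then f z else - f z) +
      (\<integral>\<^sup>+s. ennreal (b s z / 2) * (w (\<not> \<sigma>) s z + w (\<not> \<sigma>) s (2 * s - z)) * indicator {0..t} s \<partial>lborel)"
    if "\<And>\<sigma> s z. v \<sigma> s z \<le> w \<sigma> s z" for v w
    by (intro add_left_mono nn_integral_mono mult_right_mono mult_left_mono add_mono that) auto
  from step[OF Suc] show ?case
    by (simp only: picard.simps(2)[of f "Suc n"] picard.simps(2)[of f n])
qed simp

text \<open>
  The point \<open>2 * s - z\<close> moves around the circle at speed two, so integrating along it is the same
  as integrating over a bounded number of periods. This gives a bound that is uniform in \<open>z\<close>
  although the function itself may be unbounded.
\<close>

lemma reflected_L1_bound:
  assumes [measurable]: "f \<in> borel_measurable borel" and per: "\<And>z. f (z + 2) = f z"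
    and fin: "(\<integral>\<^sup>+z\<in>{0..<2}. ennreal \<bar>f z\<bar> \<partial>lborel) < \<infinity>"
  shows "\<exists>K\<ge>0. \<forall>t\<le>T::real. \<forall>z. (\<integral>\<^sup>+s. ennreal \<bar>f (2 * s - z)\<bar> * indicator {0..t} s \<partial>lborel) \<le> ennreal K"
proof -
  obtain N :: nat where N: "T < real N" using reals_Archimedean2 by blast
  define m where "m = enn2real (\<integral>\<^sup>+z\<in>{0..<2}. ennreal \<bar>f z\<bar> \<partial>lborel)"
  have m: "(\<integral>\<^sup>+z\<in>{0..<2}. ennreal \<bar>f z\<bar> \<partial>lborel) = ennreal m" "0 \<le> m"
    using fin by (auto simp: m_def)
  show ?thesis
  proof (intro exI[of _ "real N * m"] conjI allI impI)
    fix t z assume t: "t \<le> T"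
    let ?X = "\<integral>\<^sup>+s. ennreal \<bar>f (2 * s - z)\<bar> * indicator {0..t} s \<partial>lborel"
    have "?X \<le> ennreal \<bar>2\<bar> * ?X" 
      using mult_right_mono[of 1 "ennreal \<bar>2\<bar>" ?X] by simp
    also have "ennreal \<bar>2\<bar> * ?X =
        ennreal \<bar>2\<bar> * (\<integral>\<^sup>+s. ennreal \<bar>f (- z + 2 * s)\<bar> * indicator {- z..2 * t - z} (- z + 2 * s) \<partial>lborel)"
      by (intro arg_cong2[where f = "(*)"] nn_integral_cong refl) (auto simp: indicator_def algebra_simps)
    also have "\<dots> = (\<integral>\<^sup>+y. ennreal \<bar>f y\<bar> * indicator {- z..2 * t - z} y \<partial>lborel)"
      by (rule nn_integral_real_affine[symmetric]) auto
    also have "\<dots> \<le> (\<integral>\<^sup>+y\<in>{- z..<- z + 2 * real N}. ennreal \<bar>f y\<bar> \<partial>lborel)"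
      using N t by (intro nn_integral_mono) (auto simp: indicator_def)
    also have "\<dots> = of_nat N * ennreal m"
      unfolding m(1)[symmetric] by (rule set_nn_integral_periodic_multiple) (auto simp: per)
    also have "\<dots> = ennreal (real N * m)"
      using m by (simp add: ennreal_mult ennreal_of_nat_eq_real_of_nat)
    finally show "?X \<le> ennreal (real N * m)" .
  qed (use m in auto)
qed

text \<open>
  The right-hand side is a supersolution of the system: with growth rate \<open>2 * M\<close> the terms that
  do not involve the reflected initial value are absorbed, and the reflected initial value contributes at most
  a constant. The resulting bound is pointwise, with the same constant for all \<open>z\<close>; this yields a
  solution that is finite and satisfies the equation at every single point.
\<close>

lemma picard_bound:
  assumes [measurable]: "f \<in> borel_measurable borel" and per: "\<And>z. f (z + 2) = f z"
    and fin: "(\<integral>\<^sup>+z\<in>{0..<2}. ennreal \<bar>f z\<bar> \<partial>lborel) < \<infinity>"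
  shows "\<exists>K\<ge>0. \<forall>n \<sigma> z. \<forall>t\<in>{0..T}. picard f n \<sigma> t z \<le> ennreal ((\<bar>f z\<bar> + K) * exp (2 * M * t))"
proof -
  from reflected_L1_bound[OF assms] obtain K0 where K0: "0 \<le> K0"
    "\<And>t z. t \<le> T \<Longrightarrow> (\<integral>\<^sup>+s. ennreal \<bar>f (2 * s - z)\<bar> * indicator {0..t} s \<partial>lborel) \<le> ennreal K0"
    by blast
  \<comment> \<open>With this choice the contribution \<open>M / 2 * K0\<close> of the reflected initial value is \<open>K / 2\<close>.\<close>
  define K where "K = M * K0"
  have K: "0 \<le> K" using K0 M_pos by (simp add: K_def)
  have bd: "picard f n \<sigma> t z \<le> ennreal ((\<bar>f z\<bar> + K) * exp (2 * M * t))" if "t \<in> {0..T}" for n \<sigma> t z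
    using that
  proof (induction n arbitrary: \<sigma> t z)
    case (Suc n)
    define e where "e = exp (2 * M * t)"
    have t: "0 \<le> t" "t \<le> T" using Suc.prems by auto
    have e1: "1 \<le> e" using t M_pos by (simp add: e_def)
    have int_exp: "(\<integral>\<^sup>+s. ennreal (exp (2 * M * s)) * indicator {0..t} s \<partial>lborel) = ennreal ((e - 1) / (2 * M))"
    proof -
      have "(\<integral>\<^sup>+s. ennreal (exp (2 * M * s)) * indicator {0..t} s \<partial>lborel) =
          ennreal (exp (2 * M * t) / (2 * M) - exp (2 * M * 0) / (2 * M))"
        by (rule nn_integral_FTC_Icc) (use t M_pos in \<open>auto intro!: derivative_eq_intros\<close>)
      then show ?thesis by (simp add: e_def diff_divide_distrib)
    qed
    have "(\<integral>\<^sup>+s. ennreal (b s z / 2) * (picard f n (\<not> \<sigma>) s z + picard f n (\<not> \<sigma>) s (2 * s - z)) * indicator {0..t} s \<partial>lborel)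
       \<le> (\<integral>\<^sup>+s. ennreal (M / 2 * (\<bar>f z\<bar> + 2 * K)) * (ennreal (exp (2 * M * s)) * indicator {0..t} s) +
            ennreal (M / 2 * e) * (ennreal \<bar>f (2 * s - z)\<bar> * indicator {0..t} s) \<partial>lborel)"
    proof (rule nn_integral_mono)
      fix s
      show "ennreal (b s z / 2) * (picard f n (\<not> \<sigma>) s z + picard f n (\<not> \<sigma>) s (2 * s - z)) * indicator {0..t} s \<le>
        ennreal (M / 2 * (\<bar>f z\<bar> + 2 * K)) * (ennreal (exp (2 * M * s)) * indicator {0..t} s) +
            ennreal (M / 2 * e) * (ennreal \<bar>f (2 * s - z)\<bar> * indicator {0..t} s)"
      proof (cases "s \<in> {0..t}")
        case True
        then have s: "s \<in> {0..T}" using t by auto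
        have es: "exp (2 * M * s) \<le> e" using True M_pos by (simp add: e_def)
        have "ennreal (b s z / 2) * (picard f n (\<not> \<sigma>) s z + picard f n (\<not> \<sigma>) s (2 * s - z)) \<le>
          ennreal (M / 2) * (ennreal ((\<bar>f z\<bar> + K) * exp (2 * M * s)) + ennreal ((\<bar>f (2 * s - z)\<bar> + K) * exp (2 * M * s)))"
          using b_le by (intro mult_mono add_mono Suc.IH s ennreal_leI) auto
        also have "\<dots> = ennreal (M / 2 * (\<bar>f z\<bar> + 2 * K) * exp (2 * M * s) + M / 2 * exp (2 * M * s) * \<bar>f (2 * s - z)\<bar>)"
          using K M_pos by (simp add: ennreal_mult[symmetric] ennreal_plus[symmetric] del: ennreal_plus)
            (simp add: algebra_simps)
        also have "\<dots> \<le> ennreal (M / 2 * (\<bar>f z\<bar> + 2 * K) * exp (2 * M * s) + M / 2 * e * \<bar>f (2 * s - z)\<bar>)"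
          using es M_pos by (intro ennreal_leI add_left_mono mult_right_mono mult_left_mono) auto
        finally show ?thesis
          using True K M_pos e1 by (simp add: ennreal_mult[symmetric] ennreal_plus[symmetric] del: ennreal_plus)
      qed simp
    qed
    also have "\<dots> = ennreal (M / 2 * (\<bar>f z\<bar> + 2 * K)) * ennreal ((e - 1) / (2 * M)) +
        ennreal (M / 2 * e) * (\<integral>\<^sup>+s. ennreal \<bar>f (2 * s - z)\<bar> * indicator {0..t} s \<partial>lborel)"
      unfolding int_exp[symmetric] by (subst nn_integral_add; simp add: nn_integral_cmult)
    also have "\<dots> \<le> ennreal (M / 2 * (\<bar>f z\<bar> + 2 * K)) * ennreal ((e - 1) / (2 * M)) + ennreal (M / 2 * e) * ennreal K0"
      by (intro add_left_mono mult_left_mono K0 t) auto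
    also have "\<dots> = ennreal ((\<bar>f z\<bar> + 2 * K) * (e - 1) / 4 + e * K / 2)"
    proof -
      have 1: "ennreal (M / 2 * (\<bar>f z\<bar> + 2 * K)) * ennreal ((e - 1) / (2 * M)) = ennreal ((\<bar>f z\<bar> + 2 * K) * (e - 1) / 4)"
        using K M_pos e1 by (subst ennreal_mult[symmetric]) (auto intro!: arg_cong[where f = ennreal])
      have 2: "ennreal (M / 2 * e) * ennreal K0 = ennreal (e * K / 2)"
        using K0 M_pos e1 by (subst ennreal_mult[symmetric]) (auto simp: field_simps K_def)
      show ?thesis unfolding 1 2 using K e1 by (intro ennreal_plus[symmetric]) auto
    qed
    finally have I: "(\<integral>\<^sup>+s. ennreal (b s z / 2) * (picard f n (\<not> \<sigma>) s z + picard f n (\<not> \<sigma>) s (2 * s - z)) * indicator {0..t} s \<partial>lborel)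
       \<le> ennreal ((\<bar>f z\<bar> + 2 * K) * (e - 1) / 4 + e * K / 2)" .
    have "picard f (Suc n) \<sigma> t z \<le> ennreal \<bar>f z\<bar> + ennreal ((\<bar>f z\<bar> + 2 * K) * (e - 1) / 4 + e * K / 2)"
      unfolding picard.simps by (intro add_mono I) (auto intro!: ennreal_leI)
    also have "\<dots> = ennreal (\<bar>f z\<bar> + ((\<bar>f z\<bar> + 2 * K) * (e - 1) / 4 + e * K / 2))"
      using K e1 by (intro ennreal_plus[symmetric]) auto
    also have "\<dots> \<le> ennreal ((\<bar>f z\<bar> + K) * e)"
    proof (rule ennreal_leI)
      have "(\<bar>f z\<bar> + K) * e - (\<bar>f z\<bar> + ((\<bar>f z\<bar> + 2 * K) * (e - 1) / 4 + e * K / 2)) =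
          3 / 4 * \<bar>f z\<bar> * (e - 1) + K / 2" by (simp add: field_simps)
      moreover have "0 \<le> 3 / 4 * \<bar>f z\<bar> * (e - 1) + K / 2" using e1 K by simp
      ultimately show "\<bar>f z\<bar> + ((\<bar>f z\<bar> + 2 * K) * (e - 1) / 4 + e * K / 2) \<le> (\<bar>f z\<bar> + K) * e" by linarith
    qed
    finally show ?case by (simp add: e_def)
  qed simp
  show ?thesis using K bd by blast
qed

end

text \<open>
  A solution in characteristic coordinates of the equation obtained by unfolding the interval to the circle of
  length two: \<open>g t (x + t) = \<rho> t x\<close> and \<open>g t (t - x) = - \<xi> t x\<close> for
  \<open>x\<close> in \<open>[0, 1]\<close>. The boundary conditions express continuity across
  \<open>0\<close> and across \<open>1\<close> on the circle. The point \<open>2 * s - z\<close> is the mirror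
  image of \<open>z\<close> at time \<open>s\<close>.
\<close>

locale circle_flow = damping +
  fixes g :: "real \<Rightarrow> real \<Rightarrow> real"
  assumes g_meas: "case_prod g \<in> borel_measurable (borel \<Otimes>\<^sub>M borel)"
    and g_per: "g t (z + 2) = g t z"
    and g_bound: "\<exists>K\<ge>0. \<forall>t\<in>{0..T}. \<forall>z. \<bar>g t z\<bar> \<le> K * (\<bar>g 0 z\<bar> + 1)"
    and g_int: "0 \<le> t \<Longrightarrow> set_integrable lborel {0..t} (\<lambda>s. b s z * (g s z + g s (2 * s - z)))"
    and g_eq: "0 \<le> t \<Longrightarrow> g t z = g 0 z - 1 / 2 * (LINT s:{0..t}|lborel. b s z * (g s z + g s (2 * s - z)))"

text \<open>
  By the supersolution bound the two limits are finite at every point. Their equations can therefore be read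
  in the real numbers, where they may be subtracted.
\<close>

lemma (in damping) ex_circle_flow:
  assumes f[measurable]: "f \<in> borel_measurable borel" and per: "\<And>z. f (z + 2) = f z"
    and fin: "(\<integral>\<^sup>+z\<in>{0..<2}. ennreal \<bar>f z\<bar> \<partial>lborel) < \<infinity>"
  shows "\<exists>g. circle_flow b M g \<and> g 0 = f"
proof -
  define u where "u \<sigma> t z = (SUP n. picard f n \<sigma> t z)" for \<sigma> t z
  have inc: "incseq (\<lambda>n. picard f n \<sigma> t z)" for \<sigma> t z
    by (intro incseq_SucI picard_mono)
  have lim: "(\<lambda>n. picard f n \<sigma> t z) \<longlonglongrightarrow> u \<sigma> t z" for \<sigma> t z
    unfolding u_def by (intro LIMSEQ_SUP inc)
  note [measurable (raw)] = measurable_binary[OF picard_measurable[OF f]]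
  have um: "case_prod (u \<sigma>) \<in> borel_measurable (borel \<Otimes>\<^sub>M borel)" for \<sigma>
    unfolding u_def[abs_def] split_beta' by measurable
  note [measurable (raw)] = measurable_binary[OF um]
  have ueq: "u \<sigma> t z = ennreal (if \<sigma> then f z else - f z) +
     (\<integral>\<^sup>+s. ennreal (b s z / 2) * (u (\<not> \<sigma>) s z + u (\<not> \<sigma>) s (2 * s - z)) * indicator {0..t} s \<partial>lborel)" for \<sigma> t z
  proof (rule LIMSEQ_unique)
    show "(\<lambda>n. picard f (Suc n) \<sigma> t z) \<longlonglongrightarrow> u \<sigma> t z" by (rule LIMSEQ_Suc[OF lim])
    show "(\<lambda>n. picard f (Suc n) \<sigma> t z) \<longlonglongrightarrow> ennreal (if \<sigma> then f z else - f z) +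
     (\<integral>\<^sup>+s. ennreal (b s z / 2) * (u (\<not> \<sigma>) s z + u (\<not> \<sigma>) s (2 * s - z)) * indicator {0..t} s \<partial>lborel)"
      unfolding picard.simps
    proof (intro tendsto_add tendsto_const nn_integral_LIMSEQ)
      show "incseq (\<lambda>n s. ennreal (b s z / 2) * (picard f n (\<not> \<sigma>) s z + picard f n (\<not> \<sigma>) s (2 * s - z)) * indicator {0..t} s)"
        by (intro incseq_SucI le_funI mult_right_mono mult_left_mono add_mono picard_mono) auto
      show "(\<lambda>n. ennreal (b s z / 2) * (picard f n (\<not> \<sigma>) s z + picard f n (\<not> \<sigma>) s (2 * s - z)) * indicator {0..t} s)
        \<longlonglongrightarrow> ennreal (b s z / 2) * (u (\<not> \<sigma>) s z + u (\<not> \<sigma>) s (2 * s - z)) * indicator {0..t} s" for s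
        by (cases "s \<in> {0..t}") (auto intro!: ennreal_tendsto_cmult tendsto_add lim)
    qed measurable
  qed
  have ubound: "\<exists>K\<ge>0. \<forall>\<sigma> z. \<forall>t\<in>{0..T}. u \<sigma> t z \<le> ennreal ((\<bar>f z\<bar> + K) * exp (2 * M * t))" for T
    using picard_bound[OF assms, of T] unfolding u_def by (auto intro!: SUP_least)
  define r where "r \<sigma> t z = enn2real (u \<sigma> t z)" for \<sigma> t z
  have ur: "u \<sigma> t z = ennreal (r \<sigma> t z)" if "0 \<le> t" for \<sigma> t z
  proof -
    from ubound[of t] obtain K
      where "\<forall>\<sigma> z. \<forall>s\<in>{0..t}. u \<sigma> s z \<le> ennreal ((\<bar>f z\<bar> + K) * exp (2 * M * s))" by blast
    then have "u \<sigma> t z \<le> ennreal ((\<bar>f z\<bar> + K) * exp (2 * M * t))" using that by simp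
    then have "u \<sigma> t z < \<infinity>" by (rule le_less_trans) simp
    then show ?thesis by (simp add: r_def)
  qed
  have rm: "case_prod (r \<sigma>) \<in> borel_measurable (borel \<Otimes>\<^sub>M borel)" for \<sigma>
    unfolding r_def[abs_def] split_beta' by measurable
  note [measurable (raw)] = measurable_binary[OF rm]
  have rnn: "0 \<le> r \<sigma> t z" for \<sigma> t z by (simp add: r_def)
  define k where "k \<sigma> z s = b s z / 2 * (r (\<not> \<sigma>) s z + r (\<not> \<sigma>) s (2 * s - z))" for \<sigma> z s
  have knn: "0 \<le> k \<sigma> z s" for \<sigma> z s using b_nonneg rnn by (simp add: k_def)
  have knni: "(\<integral>\<^sup>+s. ennreal (indicator {0..t} s *\<^sub>R k \<sigma> z s) \<partial>lborel) =
     (\<integral>\<^sup>+s. ennreal (b s z / 2) * (u (\<not> \<sigma>) s z + u (\<not> \<sigma>) s (2 * s - z)) * indicator {0..t} s \<partial>lborel)" for \<sigma> t z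
    by (intro nn_integral_cong)
      (auto simp: indicator_def k_def ur b_nonneg rnn ennreal_mult[symmetric] ennreal_plus[symmetric] simp del: ennreal_plus)
  have kint: "set_integrable lborel {0..t} (k \<sigma> z)"
    and req: "r \<sigma> t z = max 0 (if \<sigma> then f z else - f z) + (LINT s:{0..t}|lborel. k \<sigma> z s)" if t: "0 \<le> t" for \<sigma> t z
  proof -
    have "(\<integral>\<^sup>+s. ennreal (indicator {0..t} s *\<^sub>R k \<sigma> z s) \<partial>lborel) \<le> u \<sigma> t z"
      unfolding knni by (subst (2) ueq) simp
    also have "\<dots> < \<infinity>" using ur[OF t] by simp
    finally have fin: "(\<integral>\<^sup>+s. ennreal (indicator {0..t} s *\<^sub>R k \<sigma> z s) \<partial>lborel) < \<infinity>" .
    show "set_integrable lborel {0..t} (k \<sigma> z)"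
      unfolding set_integrable_def
    proof (rule integrableI_nonneg)
      show "(\<lambda>x. indicator {0..t} x *\<^sub>R k \<sigma> z x) \<in> borel_measurable lborel"
        unfolding k_def by measurable
    qed (use fin knn in auto)
    have "(LINT s:{0..t}|lborel. k \<sigma> z s) = enn2real (\<integral>\<^sup>+s. ennreal (indicator {0..t} s *\<^sub>R k \<sigma> z s) \<partial>lborel)"
      unfolding set_lebesgue_integral_def
    proof (rule integral_eq_nn_integral)
      show "(\<lambda>x. indicator {0..t} x *\<^sub>R k \<sigma> z x) \<in> borel_measurable lborel"
        unfolding k_def by measurable
    qed (use knn in auto)
    moreover have "r \<sigma> t z = enn2real (ennreal (if \<sigma> then f z else - f z)) + 
        enn2real (\<integral>\<^sup>+s. ennreal (indicator {0..t} s *\<^sub>R k \<sigma> z s) \<partial>lborel)"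
      unfolding knni r_def by (subst ueq, rule enn2real_plus) (use fin[unfolded knni] in auto)
    ultimately show "r \<sigma> t z = max 0 (if \<sigma> then f z else - f z) + (LINT s:{0..t}|lborel. k \<sigma> z s)"
      by (auto simp: max_def enn2real_ennreal ennreal_neg)
  qed
  define g where "g t z = r True t z - r False t z" for t z
  have kdiff: "k True z s - k False z s = - 1 / 2 * (b s z * (g s z + g s (2 * s - z)))" for z s
    by (simp add: k_def g_def field_simps)
  have geq0: "g t z = f z - 1 / 2 * (LINT s:{0..t}|lborel. b s z * (g s z + g s (2 * s - z)))" if t: "0 \<le> t" for t z
  proof -
    have "g t z = f z + ((LINT s:{0..t}|lborel. k True z s) - (LINT s:{0..t}|lborel. k False z s))"
      unfolding g_def req[OF t] by (auto simp: max_def)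
    also have "(LINT s:{0..t}|lborel. k True z s) - (LINT s:{0..t}|lborel. k False z s) =
        (LINT s:{0..t}|lborel. - 1 / 2 * (b s z * (g s z + g s (2 * s - z))))"
      unfolding kdiff[symmetric] by (rule set_integral_diff(2)[symmetric]) (rule kint[OF t])+
    also have "\<dots> = - 1 / 2 * (LINT s:{0..t}|lborel. b s z * (g s z + g s (2 * s - z)))"
      by (rule set_integral_mult_right)
    finally show ?thesis by simp
  qed
  have g0: "g 0 z = f z" for z
    proof -
    have "(LINT s:{0..0}|lborel. b s z * (g s z + g s (2 * s - z))) = 0"
      unfolding set_lebesgue_integral_def
      by (rule integral_eq_zero_AE) (use AE_lborel_singleton[of "0::real"] in \<open>eventually_elim, auto\<close>)
    then show ?thesis using geq0[of 0 z] by simp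
  qed
  have "circle_flow b M g"
  proof unfold_locales
    show "case_prod g \<in> borel_measurable (borel \<Otimes>\<^sub>M borel)"
      unfolding g_def[abs_def] split_beta' by measurable
    show "g t (z + 2) = g t z" for t z
      by (simp add: g_def r_def u_def picard_periodic[of f, OF per])
    show "\<exists>K\<ge>0. \<forall>t\<in>{0..T}. \<forall>z. \<bar>g t z\<bar> \<le> K * (\<bar>g 0 z\<bar> + 1)" for T
    proof -
      from ubound[of T] obtain K where K: "0 \<le> K"
        "\<And>\<sigma> z t. t \<in> {0..T} \<Longrightarrow> u \<sigma> t z \<le> ennreal ((\<bar>f z\<bar> + K) * exp (2 * M * t))" by blast
      have r: "r \<sigma> t z \<le> (K + 1) * exp (2 * M * T) * (\<bar>f z\<bar> + 1)" if t: "t \<in> {0..T}" for \<sigma> t z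
      proof -
        have "ennreal (r \<sigma> t z) \<le> ennreal ((\<bar>f z\<bar> + K) * exp (2 * M * t))"
          using K(2)[OF t] ur[of t] t by simp
        then have "r \<sigma> t z \<le> (\<bar>f z\<bar> + K) * exp (2 * M * t)"
          using K(1) by (subst (asm) ennreal_le_iff) auto
        also have "\<dots> \<le> (\<bar>f z\<bar> + K) * exp (2 * M * T)"
          using t M_pos K(1) by (intro mult_left_mono) auto
        also have "\<dots> \<le> ((K + 1) * (\<bar>f z\<bar> + 1)) * exp (2 * M * T)"
          using K(1) by (intro mult_right_mono) (auto simp: algebra_simps)
        finally show ?thesis by (simp add: algebra_simps)
      qed
      show ?thesis
      proof (intro exI[of _ "(K + 1) * exp (2 * M * T)"] conjI ballI allI)
        fix t z assume t: "t \<in> {0..T}"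
        show "\<bar>g t z\<bar> \<le> (K + 1) * exp (2 * M * T) * (\<bar>g 0 z\<bar> + 1)"
          unfolding g0 using r[OF t, of True z] r[OF t, of False z] rnn[of True t z] rnn[of False t z]
          by (simp add: g_def abs_le_iff)
      qed (use K in simp)
    qed
    show "set_integrable lborel {0..t} (\<lambda>s. b s z * (g s z + g s (2 * s - z)))" if t: "0 \<le> t" for t z
    proof -
      have "set_integrable lborel {0..t} (\<lambda>s. (- 2) * (k True z s - k False z s))"
        by (intro set_integrable_mult_right set_integral_diff(1) kint t)
      then show ?thesis unfolding kdiff by simp
    qed
    show "g t z = g 0 z - 1 / 2 * (LINT s:{0..t}|lborel. b s z * (g s z + g s (2 * s - z)))" if "0 \<le> t" for t z
      unfolding g0 by (rule geq0[OF that])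
  qed
  with g0 show ?thesis by blast
qed

section \<open>A Poincare-type inequality on the circle\<close>

lemma circle_integral_shift:
  fixes f :: "real \<Rightarrow> ennreal"
  assumes "f \<in> borel_measurable borel" "\<And>x. f (x + 2) = f x"
  shows "(\<integral>\<^sup>+z\<in>{0..<2}. f (z + c) \<partial>lborel) = (\<integral>\<^sup>+z\<in>{0..<2}. f z \<partial>lborel)"
  using set_nn_integral_periodic_affine[OF assms, where s = 1 and a = 0 and c = c] by (simp add: add.commute)

lemma nn_integral_powr_add_le:
  fixes u v :: "real \<Rightarrow> real"
  assumes p: "0 \<le> p" and [measurable]: "u \<in> borel_measurable borel" "v \<in> borel_measurable borel"
    "A \<in> sets borel"
  shows "(\<integral>\<^sup>+z\<in>A. ennreal (\<bar>u z + v z\<bar> powr p) \<partial>lborel) \<le>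
    ennreal (2 powr p) * ((\<integral>\<^sup>+z\<in>A. ennreal (\<bar>u z\<bar> powr p) \<partial>lborel) + (\<integral>\<^sup>+z\<in>A. ennreal (\<bar>v z\<bar> powr p) \<partial>lborel))"
proof -
  have "(\<integral>\<^sup>+z\<in>A. ennreal (\<bar>u z + v z\<bar> powr p) \<partial>lborel) \<le>
    (\<integral>\<^sup>+z. ennreal (2 powr p) * (ennreal (\<bar>u z\<bar> powr p) * indicator A z + ennreal (\<bar>v z\<bar> powr p) * indicator A z) \<partial>lborel)"
    by (intro nn_integral_mono)
       (auto simp: indicator_def ennreal_mult[symmetric] ennreal_plus[symmetric]
          simp del: ennreal_plus intro!: ennreal_leI abs_add_powr_le p)
  also have "\<dots> = ennreal (2 powr p) * ((\<integral>\<^sup>+z\<in>A. ennreal (\<bar>u z\<bar> powr p) \<partial>lborel) + (\<integral>\<^sup>+z\<in>A. ennreal (\<bar>v z\<bar> powr p) \<partial>lborel))"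
    by (simp add: nn_integral_cmult nn_integral_add)
  finally show ?thesis .
qed

lemma nn_integral_interval_const:
  "a \<le> b \<Longrightarrow> (\<integral>\<^sup>+y\<in>{a<..<b}. c \<partial>lborel) = ennreal (b - a) * c"
  by (simp add: nn_integral_cmult_indicator mult.commute)

text \<open>
  If \<open>G\<close> were exactly opposite to its translates by \<open>2 * y\<close> for all \<open>y\<close>
  in an interval, it would be invariant under all small translations, hence constant, hence equal to its own
  negative, hence zero. The proof makes this quantitative: \<open>N d\<close> measures the defect from
  \<open>G (z + d) = - G z\<close> and \<open>S d\<close> the defect from \<open>G (z + d) = G z\<close>.
  Differences of two good translations give small translations, \<open>n\<close> small translations in a row
  give any translation on the circle, and \<open>2 * G\<close> is the difference of the two defects.
\<close>

lemma periodic_poincare: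
  fixes G :: "real \<Rightarrow> real"
  assumes p: "1 \<le> p" and G[measurable]: "G \<in> borel_measurable borel" and per: "\<And>z. G (z + 2) = G z"
    and e: "0 < \<epsilon>" "0 \<le> x0 - \<epsilon>" "x0 + \<epsilon> \<le> 1" and n: "1 \<le> real n * \<epsilon>"
  shows "(\<integral>\<^sup>+z\<in>{0..<2}. ennreal (\<bar>G z\<bar> powr p) \<partial>lborel) \<le>
    ennreal ((1 + (2 * 2 powr p) ^ (n + 1)) / \<epsilon>) *
    (\<integral>\<^sup>+y\<in>{x0 - \<epsilon><..<x0 + \<epsilon>}. (\<integral>\<^sup>+z\<in>{0..<2}. ennreal (\<bar>G (z + 2 * y) + G z\<bar> powr p) \<partial>lborel) \<partial>lborel)"
proof -
  have p0: "0 \<le> p" using p by simp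
  define c where "c = (2::real) powr p"
  have c: "1 \<le> c" using p by (simp add: c_def ge_one_powr_ge_zero)
  define S where "S d = (\<integral>\<^sup>+z\<in>{0..<2}. ennreal (\<bar>G (z + d) - G z\<bar> powr p) \<partial>lborel)" for d
  define N where "N d = (\<integral>\<^sup>+z\<in>{0..<2}. ennreal (\<bar>G (z + d) + G z\<bar> powr p) \<partial>lborel)" for d
  define Z where "Z = (\<integral>\<^sup>+y\<in>{x0 - \<epsilon><..<x0 + \<epsilon>}. N (2 * y) \<partial>lborel)"
  have perG: "G (z + 2 + d) = G (z + d)" for z d using per[of "z + d"] by (simp add: algebra_simps)
  have [measurable]: "N \<in> borel_measurable borel" 
    unfolding N_def[abs_def] by measurable
  have Sadd: "S (d + d') \<le> ennreal c * (S d + S d')" for d d'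
  proof -
    have "S (d + d') = (\<integral>\<^sup>+z\<in>{0..<2}. ennreal (\<bar>(G ((z + d') + d) - G (z + d')) + (G (z + d') - G z)\<bar> powr p) \<partial>lborel)"
      unfolding S_def by (simp add: algebra_simps)
    also have "\<dots> \<le> ennreal c * ((\<integral>\<^sup>+z\<in>{0..<2}. ennreal (\<bar>G ((z + d') + d) - G (z + d')\<bar> powr p) \<partial>lborel) + S d')"
      unfolding S_def c_def by (rule nn_integral_powr_add_le[OF p0]) auto
    also have "(\<integral>\<^sup>+z\<in>{0..<2}. ennreal (\<bar>G ((z + d') + d) - G (z + d')\<bar> powr p) \<partial>lborel) = S d"
      unfolding S_def by (rule circle_integral_shift[of "\<lambda>z. ennreal (\<bar>G (z + d) - G z\<bar> powr p)"]) (auto simp: per perG)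
    finally show ?thesis .
  qed
  have SN: "S (d' - d) \<le> ennreal c * (N d' + N d)" for d d'
  proof -
    have "S (d' - d) = (\<integral>\<^sup>+z\<in>{0..<2}. ennreal (\<bar>G ((z + d) + (d' - d)) - G (z + d)\<bar> powr p) \<partial>lborel)"
      unfolding S_def by (rule circle_integral_shift[symmetric, of "\<lambda>z. ennreal (\<bar>G (z + (d' - d)) - G z\<bar> powr p)"]) (auto simp: per perG)
    also have "\<dots> = (\<integral>\<^sup>+z\<in>{0..<2}. ennreal (\<bar>(G (z + d') + G z) + - (G (z + d) + G z)\<bar> powr p) \<partial>lborel)"
      by (simp add: algebra_simps)
    also have "\<dots> \<le> ennreal c * (N d' + (\<integral>\<^sup>+z\<in>{0..<2}. ennreal (\<bar>- (G (z + d) + G z)\<bar> powr p) \<partial>lborel))"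
      unfolding N_def c_def by (rule nn_integral_powr_add_le[OF p0]) auto
    also have "(\<integral>\<^sup>+z\<in>{0..<2}. ennreal (\<bar>- (G (z + d) + G z)\<bar> powr p) \<partial>lborel) = N d"
      unfolding N_def by (simp only: abs_minus_cancel)
    finally show ?thesis .
  qed
  \<comment> \<open>Averaging over the strip turns the \<open>L\<^sup>1\<close> bound on \<open>N\<close> into a uniform bound on small shifts.\<close>
  have Ssmall: "ennreal \<epsilon> * S d \<le> ennreal (2 * c) * Z" if d: "0 \<le> d" "d \<le> 2 * \<epsilon>" for d
  proof -
    have "ennreal \<epsilon> * S d = (\<integral>\<^sup>+y\<in>{x0 - \<epsilon><..<x0}. S d \<partial>lborel)"
      using e by (simp add: nn_integral_interval_const)
    also have "\<dots> \<le> (\<integral>\<^sup>+y. ennreal c * (N (2 * (y + d / 2)) * indicator {x0 - \<epsilon><..<x0 + \<epsilon>} (y + d / 2) + N (2 * y) * indicator {x0 - \<epsilon><..<x0 + \<epsilon>} y) \<partial>lborel)"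
    proof (rule nn_integral_mono)
      fix y
      show "S d * indicator {x0 - \<epsilon><..<x0} y \<le> ennreal c * (N (2 * (y + d / 2)) * indicator {x0 - \<epsilon><..<x0 + \<epsilon>} (y + d / 2) + N (2 * y) * indicator {x0 - \<epsilon><..<x0 + \<epsilon>} y)"
        using SN[of "2 * (y + d / 2)" "2 * y"] d e by (auto simp: indicator_def)
    qed
    also have "\<dots> = ennreal c * ((\<integral>\<^sup>+y. N (2 * (y + d / 2)) * indicator {x0 - \<epsilon><..<x0 + \<epsilon>} (y + d / 2) \<partial>lborel) + Z)"
      unfolding Z_def by (simp add: nn_integral_cmult nn_integral_add)
    also have "(\<integral>\<^sup>+y. N (2 * (y + d / 2)) * indicator {x0 - \<epsilon><..<x0 + \<epsilon>} (y + d / 2) \<partial>lborel) = Z"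
      unfolding Z_def by (rule nn_integral_shift[of "\<lambda>y. N (2 * y) * indicator {x0 - \<epsilon><..<x0 + \<epsilon>} y"]) auto
    also have "ennreal c * (Z + Z) = ennreal (2 * c) * Z"
      using c by (simp add: mult_2[symmetric] ennreal_mult mult.left_commute mult.assoc)
    finally show ?thesis .
  qed
  have Smult: "S (real k * d) \<le> ennreal ((2 * c) ^ k) * S d" for k d
  proof (induction k)
    case (Suc k)
    have "S (real (Suc k) * d) \<le> ennreal c * (S (real k * d) + S d)"
      using Sadd[of "real k * d" d] by (simp add: algebra_simps)
    also have "\<dots> \<le> ennreal c * (ennreal ((2 * c) ^ k) * S d + ennreal ((2 * c) ^ k) * S d)"
    proof (intro mult_left_mono add_mono Suc)
      have "ennreal 1 \<le> ennreal ((2 * c) ^ k)" using c by (intro ennreal_leI one_le_power) auto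
      from mult_right_mono[OF this, of "S d"] show "S d \<le> ennreal ((2 * c) ^ k) * S d" by simp
    qed auto
    also have "\<dots> = ennreal ((2 * c) ^ Suc k) * S d"
      using c by (simp add: mult_2[symmetric] ennreal_mult mult_ac)
    finally show ?case .
  qed (simp add: S_def)
  have n0: "0 < real n" using n e by (cases "n = 0") auto
  have pt: "ennreal \<epsilon> * (\<integral>\<^sup>+z\<in>{0..<2}. ennreal (\<bar>G z\<bar> powr p) \<partial>lborel) \<le>
      ennreal \<epsilon> * N (2 * y) + ennreal ((2 * c) ^ (n + 1)) * Z" if y: "0 \<le> y" "y \<le> 1" for y
  proof -
    have c': "inverse c * c = 1" using c by simp
    have "(\<integral>\<^sup>+z\<in>{0..<2}. ennreal (\<bar>G z\<bar> powr p) \<partial>lborel) =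
        (\<integral>\<^sup>+z. ennreal (inverse c) * (ennreal (\<bar>(G (z + 2 * y) + G z) + - (G (z + 2 * y) - G z)\<bar> powr p) * indicator {0..<2} z) \<partial>lborel)"
    proof (rule nn_integral_cong)
      fix z
      have "\<bar>(G (z + 2 * y) + G z) + - (G (z + 2 * y) - G z)\<bar> powr p = c * \<bar>G z\<bar> powr p"
        by (simp add: c_def powr_mult abs_mult mult_2[symmetric])
      then show "ennreal (\<bar>G z\<bar> powr p) * indicator {0..<2} z =
        ennreal (inverse c) * (ennreal (\<bar>(G (z + 2 * y) + G z) + - (G (z + 2 * y) - G z)\<bar> powr p) * indicator {0..<2} z)"
        using c c' by (simp add: ennreal_mult[symmetric] mult.assoc[symmetric])
    qed
    also have "\<dots> = ennreal (inverse c) * (\<integral>\<^sup>+z\<in>{0..<2}. ennreal (\<bar>(G (z + 2 * y) + G z) + - (G (z + 2 * y) - G z)\<bar> powr p) \<partial>lborel)"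
      by (rule nn_integral_cmult) auto
    also have "\<dots> \<le> ennreal (inverse c) * (ennreal c * (N (2 * y) + (\<integral>\<^sup>+z\<in>{0..<2}. ennreal (\<bar>- (G (z + 2 * y) - G z)\<bar> powr p) \<partial>lborel)))"
      unfolding N_def c_def by (intro mult_left_mono nn_integral_powr_add_le[OF p0]) auto
    also have "(\<integral>\<^sup>+z\<in>{0..<2}. ennreal (\<bar>- (G (z + 2 * y) - G z)\<bar> powr p) \<partial>lborel) = S (2 * y)"
      unfolding S_def by (simp only: abs_minus_cancel)
    also have "ennreal (inverse c) * (ennreal c * (N (2 * y) + S (2 * y))) = N (2 * y) + S (2 * y)"
      using c c' by (simp add: mult.assoc[symmetric] ennreal_mult[symmetric])
    finally have "ennreal \<epsilon> * (\<integral>\<^sup>+z\<in>{0..<2}. ennreal (\<bar>G z\<bar> powr p) \<partial>lborel) \<le> ennreal \<epsilon> * N (2 * y) + ennreal \<epsilon> * S (2 * y)"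
      unfolding distrib_left[symmetric] by (rule mult_left_mono) simp
    also have "ennreal \<epsilon> * S (2 * y) \<le> ennreal ((2 * c) ^ n) * (ennreal \<epsilon> * S (2 * y / real n))"
      using mult_left_mono[OF Smult[of n "2 * y / real n"], of "ennreal \<epsilon>"] n0 by (simp add: mult_ac)
    also have "\<dots> \<le> ennreal ((2 * c) ^ n) * (ennreal (2 * c) * Z)"
    proof (intro mult_left_mono Ssmall)
      have "2 * y \<le> 2 * (real n * \<epsilon>)" using y n by simp
      then show "2 * y / real n \<le> 2 * \<epsilon>" using n0 by (simp add: field_simps)
    qed (use y in auto)
    also have "\<dots> = ennreal ((2 * c) ^ (n + 1)) * Z"
      using c by (simp add: ennreal_mult mult_ac)
    finally show ?thesis by (simp add: add_left_mono)
  qed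
  let ?I = "\<integral>\<^sup>+z\<in>{0..<2}. ennreal (\<bar>G z\<bar> powr p) \<partial>lborel"
  have "ennreal \<epsilon> * (ennreal \<epsilon> * ?I) = (\<integral>\<^sup>+y\<in>{x0 - \<epsilon><..<x0}. ennreal \<epsilon> * ?I \<partial>lborel)"
    using e by (simp add: nn_integral_interval_const)
  also have "\<dots> \<le> (\<integral>\<^sup>+y. ennreal \<epsilon> * (N (2 * y) * indicator {x0 - \<epsilon><..<x0 + \<epsilon>} y) + (ennreal ((2 * c) ^ (n + 1)) * Z) * indicator {x0 - \<epsilon><..<x0} y \<partial>lborel)"
    using e pt by (intro nn_integral_mono) (auto simp: indicator_def)
  also have "\<dots> = ennreal \<epsilon> * Z + ennreal \<epsilon> * (ennreal ((2 * c) ^ (n + 1)) * Z)"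
  proof -
    have "(\<integral>\<^sup>+y. ennreal \<epsilon> * (N (2 * y) * indicator {x0 - \<epsilon><..<x0 + \<epsilon>} y) + (ennreal ((2 * c) ^ (n + 1)) * Z) * indicator {x0 - \<epsilon><..<x0} y \<partial>lborel) =
        (\<integral>\<^sup>+y. ennreal \<epsilon> * (N (2 * y) * indicator {x0 - \<epsilon><..<x0 + \<epsilon>} y) \<partial>lborel) +
        (\<integral>\<^sup>+y\<in>{x0 - \<epsilon><..<x0}. ennreal ((2 * c) ^ (n + 1)) * Z \<partial>lborel)"
      by (rule nn_integral_add) auto
    also have "(\<integral>\<^sup>+y. ennreal \<epsilon> * (N (2 * y) * indicator {x0 - \<epsilon><..<x0 + \<epsilon>} y) \<partial>lborel) = ennreal \<epsilon> * Z"
      unfolding Z_def by (rule nn_integral_cmult) auto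
    also have "(\<integral>\<^sup>+y\<in>{x0 - \<epsilon><..<x0}. ennreal ((2 * c) ^ (n + 1)) * Z \<partial>lborel) = ennreal \<epsilon> * (ennreal ((2 * c) ^ (n + 1)) * Z)"
      using e by (subst nn_integral_interval_const) auto
    finally show ?thesis .
  qed
  also have "\<dots> = ennreal \<epsilon> * (ennreal \<epsilon> * (ennreal ((1 + (2 * c) ^ (n + 1)) / \<epsilon>) * Z))"
  proof -
    have "ennreal \<epsilon> * ennreal ((1 + (2 * c) ^ (n + 1)) / \<epsilon>) = ennreal (1 + (2 * c) ^ (n + 1))"
      using e c by (subst ennreal_mult[symmetric]) auto
    also have "\<dots> = 1 + ennreal ((2 * c) ^ (n + 1))"
      using c by (subst ennreal_plus) auto
    finally have eq: "ennreal \<epsilon> * ennreal ((1 + (2 * c) ^ (n + 1)) / \<epsilon>) = 1 + ennreal ((2 * c) ^ (n + 1))" .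
    show ?thesis
      unfolding mult.assoc[symmetric, of "ennreal \<epsilon>" "ennreal ((1 + (2 * c) ^ (n + 1)) / \<epsilon>)"] eq
      by (simp only: distrib_right distrib_left mult_1_left)
  qed
  finally have "ennreal \<epsilon> * (ennreal \<epsilon> * ?I) \<le> ennreal \<epsilon> * (ennreal \<epsilon> * (ennreal ((1 + (2 * c) ^ (n + 1)) / \<epsilon>) * Z))" .
  then have "?I \<le> ennreal ((1 + (2 * c) ^ (n + 1)) / \<epsilon>) * Z"
    using e by (simp add: ennreal_mult_le_mult_iff)
  then show ?thesis unfolding c_def Z_def N_def .
qed

section \<open>Powers and means of integrals\<close>

lemma LINT_combine:
  fixes h :: "real \<Rightarrow> real"
  assumes h: "set_integrable lborel {a..c} h" and "a \<le> b" "b \<le> c"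
  shows "(LINT x:{a..c}|lborel. h x) = (LINT x:{a..b}|lborel. h x) + (LINT x:{b..c}|lborel. h x)"
proof -
  have "set_integrable lborel {a..b} h" "set_integrable lborel {b..c} h"
    using assms by (auto intro: set_integrable_subset[OF h])
  then show ?thesis
    using Henstock_Kurzweil_Integration.integral_combine[OF assms(2,3) set_borel_integral_eq_integral(1)[OF h]] h
    by (simp add: set_borel_integral_eq_integral(2))
qed

text \<open>
  An inequality version of the chain rule for \<open>\<bar>f\<bar> powr p\<close>, where \<open>f\<close> is
  an indefinite Lebesgue integral and need not be differentiable everywhere. Convexity gives on a short
  interval
  \<open>\<bar>f r'\<bar> powr p - \<bar>f r\<bar> powr p \<le> p * signed_powr (p - 1) (f r') * (f r' - f r)\<close>,
  and by uniform continuity \<open>f r'\<close> may be replaced by \<open>f x\<close> inside the integral at a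
  cost of \<open>\<eta>\<close> times the integral of \<open>\<bar>k\<bar>\<close>. These errors add up to a
  multiple of \<open>\<eta>\<close> over any partition.
\<close>

lemma powr_growth:
  fixes f k :: "real \<Rightarrow> real"
  assumes p: "1 < p" and st: "s \<le> t" and k: "set_integrable lborel {s..t} k"
    and f: "\<And>r r'. s \<le> r \<Longrightarrow> r \<le> r' \<Longrightarrow> r' \<le> t \<Longrightarrow> f r' = f r + (LINT x:{r..r'}|lborel. k x)"
  shows "continuous_on {s..t} f" (is ?C)
    and "set_integrable lborel {s..t} (\<lambda>x. signed_powr (p - 1) (f x) * k x)" (is ?I)
    and "\<bar>f t\<bar> powr p \<le> \<bar>f s\<bar> powr p + p * (LINT x:{s..t}|lborel. signed_powr (p - 1) (f x) * k x)" (is ?L)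
proof -
  have sub: "set_integrable lborel {r..r'} h" if "set_integrable lborel {s..t} h" "s \<le> r" "r' \<le> t" for r r' and h :: "real \<Rightarrow> real"
    by (rule set_integrable_subset[OF that(1)]) (use that in auto)
  have "continuous_on {s..t} (\<lambda>r. f s + integral {s..r} k)"
    by (intro continuous_intros indefinite_integral_continuous_1 set_borel_integral_eq_integral(1) k)
  moreover have "f s + integral {s..r} k = f r" if "r \<in> {s..t}" for r
    using f[of s r] that by (simp add: set_borel_integral_eq_integral(2)[OF sub[OF k]])
  ultimately show C: ?C by (rule continuous_on_eq)
  define J where "J x = signed_powr (p - 1) (f x)" for x
  have cJ: "continuous_on {s..t} J"
    unfolding J_def using p C by (intro continuous_intros) auto
  then have "compact (J ` {s..t})" by (intro compact_continuous_image) auto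
  then obtain B where B: "\<And>x. x \<in> {s..t} \<Longrightarrow> \<bar>J x\<bar> \<le> B"
    by (force dest: compact_imp_bounded simp: bounded_iff)
  have Jm: "set_borel_measurable lborel {s..t} J"
    using borel_measurable_continuous_on_indicator[OF _ cJ] by (simp add: set_borel_measurable_def)
  have JkI: "set_integrable lborel {s..t} (\<lambda>x. J x * k x)"
    unfolding set_integrable_def
  proof (rule Bochner_Integration.integrable_bound)
    show "integrable lborel (\<lambda>x. B * (indicator {s..t} x *\<^sub>R k x))"
      using k unfolding set_integrable_def by (rule integrable_mult_right)
    have "(\<lambda>x. (indicator {s..t} x *\<^sub>R J x) * (indicator {s..t} x *\<^sub>R k x)) \<in> borel_measurable lborel"
      using Jm k unfolding set_borel_measurable_def set_integrable_def by measurable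
    also have "(\<lambda>x. (indicator {s..t} x *\<^sub>R J x) * (indicator {s..t} x *\<^sub>R k x)) = (\<lambda>x. indicator {s..t} x *\<^sub>R (J x * k x))"
      by (auto simp: indicator_def)
    finally show "(\<lambda>x. indicator {s..t} x *\<^sub>R (J x * k x)) \<in> borel_measurable lborel" .
    show "AE x in lborel. norm (indicator {s..t} x *\<^sub>R (J x * k x)) \<le> norm (B * (indicator {s..t} x *\<^sub>R k x))"
    proof (rule AE_I2)
      fix x show "norm (indicator {s..t} x *\<^sub>R (J x * k x)) \<le> norm (B * (indicator {s..t} x *\<^sub>R k x))"
        using B[of x] by (auto simp: indicator_def abs_mult intro!: mult_right_mono)
    qed
  qed
  then show ?I by (simp add: J_def)
  have absI: "set_integrable lborel {s..t} (\<lambda>x. \<bar>k x\<bar>)" using k by (rule set_integrable_abs)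
  define D where "D = (LINT x:{s..t}|lborel. \<bar>k x\<bar>)"
  have D0: "0 \<le> D" unfolding D_def set_lebesgue_integral_def by (intro Bochner_Integration.integral_nonneg) auto
  have key: "\<bar>f t\<bar> powr p \<le> \<bar>f s\<bar> powr p + p * (LINT x:{s..t}|lborel. J x * k x) + p * \<eta> * D" if \<eta>: "0 < \<eta>" for \<eta>
  proof -
    have "uniformly_continuous_on {s..t} J" by (intro compact_uniformly_continuous cJ) auto
    then obtain d where d: "0 < d" "\<And>x y. x \<in> {s..t} \<Longrightarrow> y \<in> {s..t} \<Longrightarrow> dist y x < d \<Longrightarrow> dist (J y) (J x) < \<eta>"
      using \<eta> unfolding uniformly_continuous_on_def by metis
    have step: "\<bar>f r'\<bar> powr p \<le> \<bar>f r\<bar> powr p + p * (LINT x:{r..r'}|lborel. J x * k x) + p * \<eta> * (LINT x:{r..r'}|lborel. \<bar>k x\<bar>)"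
      if r: "s \<le> r" "r \<le> r'" "r' \<le> t" "r' - r < d" for r r'
    proof -
      note ints = sub[OF k r(1,3)] sub[OF JkI r(1,3)] sub[OF absI r(1,3)]
      have "\<bar>f r'\<bar> powr p \<le> \<bar>f r\<bar> powr p + p * (J r' * (f r' - f r))"
        using powr_tangent[OF p, of "f r'" "f r"] by (simp add: J_def algebra_simps)
      also have "J r' * (f r' - f r) = (LINT x:{r..r'}|lborel. J r' * k x)"
        using f[of r r'] r by simp
      also have "\<dots> \<le> (LINT x:{r..r'}|lborel. J x * k x + \<eta> * \<bar>k x\<bar>)"
      proof (rule set_integral_mono)
        fix x assume x: "x \<in> {r..r'}"
        have "\<bar>J r' - J x\<bar> \<le> \<eta>"
          using d(2)[of x r'] x r by (auto simp: dist_real_def)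
        then have "(J r' - J x) * k x \<le> \<eta> * \<bar>k x\<bar>"
          by (metis abs_ge_self abs_ge_zero abs_mult mult_right_mono order_trans)
        then show "J r' * k x \<le> J x * k x + \<eta> * \<bar>k x\<bar>" by (simp add: algebra_simps)
      qed (intro set_integral_add(1) set_integrable_mult_right ints)+
      also have "\<dots> = (LINT x:{r..r'}|lborel. J x * k x) + \<eta> * (LINT x:{r..r'}|lborel. \<bar>k x\<bar>)"
        using ints by (subst set_integral_add(2)) auto
      finally show ?thesis using p by (simp add: algebra_simps)
    qed
    obtain n :: nat where n: "(t - s) / d < real n" using reals_Archimedean2 by blast
    have n0: "0 < real n" using n st d(1) by (smt (verit) divide_nonneg_pos)
    define x where "x i = s + real i * ((t - s) / real n)" for i
    have xs: "s \<le> x i" for i using st n0 by (simp add: x_def)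
    have xn: "x n = t" using n0 by (simp add: x_def)
    have xmono: "x i \<le> x j" if "i \<le> j" for i j
      using that st n0 by (auto simp: x_def intro!: mult_right_mono divide_right_mono)
    have tel: "i \<le> n \<Longrightarrow> \<bar>f (x i)\<bar> powr p \<le> \<bar>f s\<bar> powr p + p * (LINT y:{s..x i}|lborel. J y * k y) + p * \<eta> * (LINT y:{s..x i}|lborel. \<bar>k y\<bar>)" for i
    proof (induction i)
      case 0
      have "0 \<le> (LINT y:{s..s}|lborel. \<bar>k y\<bar>)" unfolding set_lebesgue_integral_def by (intro Bochner_Integration.integral_nonneg) auto
      moreover have "(LINT y:{s..s}|lborel. J y * k y) = 0"
        using LINT_combine[OF sub[OF JkI order_refl st], of s] by simp
      ultimately show ?case using p \<eta> by (simp add: x_def)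
    next
      case (Suc i)
      have le: "x i \<le> x (Suc i)" "x (Suc i) \<le> t"
        using xmono[of i "Suc i"] xmono[of "Suc i" n] Suc.prems xn by auto
      have "x (Suc i) - x i = (t - s) / real n" unfolding x_def of_nat_Suc distrib_right by simp
      also have "\<dots> < d" using n n0 d(1) by (simp add: field_simps)
      finally have "\<bar>f (x (Suc i))\<bar> powr p \<le> \<bar>f (x i)\<bar> powr p + p * (LINT y:{x i..x (Suc i)}|lborel. J y * k y) + p * \<eta> * (LINT y:{x i..x (Suc i)}|lborel. \<bar>k y\<bar>)"
        by (intro step xs le)
      moreover have "(LINT y:{s..x (Suc i)}|lborel. J y * k y) = (LINT y:{s..x i}|lborel. J y * k y) + (LINT y:{x i..x (Suc i)}|lborel. J y * k y)"
        "(LINT y:{s..x (Suc i)}|lborel. \<bar>k y\<bar>) = (LINT y:{s..x i}|lborel. \<bar>k y\<bar>) + (LINT y:{x i..x (Suc i)}|lborel. \<bar>k y\<bar>)"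
        by (intro LINT_combine sub[OF JkI] sub[OF absI] xs le order_refl)+
      ultimately show ?case using Suc by (simp add: algebra_simps)
    qed
    from tel[of n] show ?thesis by (simp add: xn D_def)
  qed
  have "\<bar>f t\<bar> powr p \<le> \<bar>f s\<bar> powr p + p * (LINT x:{s..t}|lborel. J x * k x)"
  proof (rule field_le_epsilon)
    fix e :: real assume e: "0 < e"
    have "p * (e / (p * (D + 1))) * D \<le> e"
    proof -
      have "p * (e / (p * (D + 1))) * D = e * (D / (D + 1))" using p by simp
      also have "\<dots> \<le> e * 1" using e D0 by (intro mult_left_mono) auto
      finally show ?thesis by simp
    qed
    moreover have "0 < e / (p * (D + 1))" using e p D0 by simp
    ultimately show "\<bar>f t\<bar> powr p \<le> \<bar>f s\<bar> powr p + p * (LINT x:{s..t}|lborel. J x * k x) + e"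
      using key[of "e / (p * (D + 1))"] by linarith
  qed
  then show ?L by (simp add: J_def)
qed

text \<open>
  Jensen's inequality, obtained by integrating the tangent of \<open>\<bar>x\<bar> powr p\<close> at the mean
  value.
\<close>

lemma jensen_powr:
  fixes h :: "real \<Rightarrow> real"
  assumes p: "1 < p" and st: "s < t" and h: "set_integrable lborel {s..t} h"
  shows "ennreal (\<bar>LINT x:{s..t}|lborel. h x\<bar> powr p) \<le>
    ennreal ((t - s) powr (p - 1)) * (\<integral>\<^sup>+x\<in>{s..t}. ennreal (\<bar>h x\<bar> powr p) \<partial>lborel)"
proof -
  define L where "L = t - s"
  have L: "0 < L" using st by (simp add: L_def)
  define m where "m = \<bar>LINT x:{s..t}|lborel. h x\<bar>"
  have hm[measurable]: "(\<lambda>x. indicator {s..t} x *\<^sub>R h x) \<in> borel_measurable lborel"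
    using h by (simp add: set_integrable_def)
  have ind: "indicator {s..t} x *\<^sub>R (\<bar>h x\<bar> powr p) = \<bar>indicator {s..t} x *\<^sub>R h x\<bar> powr p" for x
    using p by (auto simp: indicator_def)
  have nn: "(\<integral>\<^sup>+x\<in>{s..t}. ennreal (\<bar>h x\<bar> powr p) \<partial>lborel) = (\<integral>\<^sup>+x. ennreal (indicator {s..t} x *\<^sub>R (\<bar>h x\<bar> powr p)) \<partial>lborel)"
    by (intro nn_integral_cong) (auto simp: indicator_def)
  show ?thesis
  proof (cases "(\<integral>\<^sup>+x\<in>{s..t}. ennreal (\<bar>h x\<bar> powr p) \<partial>lborel) < \<infinity>")
    case False
    then have "(\<integral>\<^sup>+x\<in>{s..t}. ennreal (\<bar>h x\<bar> powr p) \<partial>lborel) = top"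
      by (metis infinity_ennreal_def top.not_eq_extremum)
    moreover have "ennreal ((t - s) powr (p - 1)) \<noteq> 0" using st by simp
    ultimately show ?thesis by (simp add: ennreal_mult_top)
  next
    case True
    have hp: "set_integrable lborel {s..t} (\<lambda>x. \<bar>h x\<bar> powr p)"
      unfolding set_integrable_def
    proof (rule integrableI_nonneg)
      show "(\<lambda>x. indicator {s..t} x *\<^sub>R (\<bar>h x\<bar> powr p)) \<in> borel_measurable lborel"
        unfolding ind by measurable
    qed (use True in \<open>auto simp: nn\<close>)
    define y where "y = m / L"
    have y0: "0 \<le> y" using L by (simp add: y_def m_def)
    have cI: "set_integrable lborel {s..t} (\<lambda>x. c)" for c :: real
    proof -
      have "integrable lborel (indicator {s..t} :: real \<Rightarrow> real)" by (rule integrable_real_indicator) (use st in auto)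
      then show ?thesis unfolding set_integrable_def by simp
    qed
    have cE: "(LINT x:{s..t}|lborel. c) = L * c" for c :: real
      using st by (simp add: set_integral_const L_def)
    have aI: "set_integrable lborel {s..t} (\<lambda>x. \<bar>h x\<bar>)" by (rule set_integrable_abs[OF h])
    have "L * (y powr p) = L * y powr p + p * signed_powr (p - 1) y * (m - L * y)"
      using L by (simp add: y_def)
    also have "\<dots> \<le> L * y powr p + p * signed_powr (p - 1) y * ((LINT x:{s..t}|lborel. \<bar>h x\<bar>) - L * y)"
    proof -
      have "m \<le> (LINT x:{s..t}|lborel. \<bar>h x\<bar>)"
        using set_integral_norm_bound[OF h] by (simp add: m_def)
      moreover have "0 \<le> signed_powr (p - 1) y" using y0 by (simp add: signed_powr_def)
      ultimately show ?thesis using p by (intro add_left_mono mult_left_mono) auto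
    qed
    also have "\<dots> = (LINT x:{s..t}|lborel. \<bar>y\<bar> powr p + p * signed_powr (p - 1) y * (\<bar>h x\<bar> - y))"
      using y0 aI cI by (subst set_integral_add(2)) (auto intro!: set_integral_diff(1) set_integrable_mult_right simp: cE set_integral_diff(2))
    also have "\<dots> \<le> (LINT x:{s..t}|lborel. \<bar>h x\<bar> powr p)"
    proof (rule set_integral_mono)
      show "\<bar>y\<bar> powr p + p * signed_powr (p - 1) y * (\<bar>h x\<bar> - y) \<le> \<bar>h x\<bar> powr p" for x
        using powr_tangent[OF p, of y "\<bar>h x\<bar>"] by simp
    qed (intro hp set_integral_add(1) set_integrable_mult_right set_integral_diff(1) aI cI)+
    finally have "L powr (p - 1) * (L * (y powr p)) \<le> L powr (p - 1) * (LINT x:{s..t}|lborel. \<bar>h x\<bar> powr p)"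
      by (intro mult_left_mono) auto
    also have "L powr (p - 1) * (L * (y powr p)) = m powr p"
    proof -
      have "L powr (p - 1) * (L * (y powr p)) = L powr p * y powr p" using L by (simp add: powr_diff)
      also have "\<dots> = (L * y) powr p" by (simp add: powr_mult)
      finally show ?thesis using L by (simp add: y_def)
    qed
    finally have "ennreal (m powr p) \<le> ennreal (L powr (p - 1)) * ennreal (LINT x:{s..t}|lborel. \<bar>h x\<bar> powr p)"
      by (subst ennreal_mult'[symmetric]) (auto intro: ennreal_leI)
    also have "ennreal (LINT x:{s..t}|lborel. \<bar>h x\<bar> powr p) = (\<integral>\<^sup>+x\<in>{s..t}. ennreal (\<bar>h x\<bar> powr p) \<partial>lborel)"
      unfolding nn set_lebesgue_integral_def
      by (rule nn_integral_eq_integral[symmetric]) (use hp in \<open>auto simp: set_integrable_def\<close>)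
    finally show ?thesis by (simp add: m_def L_def)
  qed
qed

section \<open>Dissipation of energy\<close>

lemma tonelli_rectangle:
  fixes f :: "real \<Rightarrow> real \<Rightarrow> ennreal"
  assumes f: "case_prod f \<in> borel_measurable (borel \<Otimes>\<^sub>M borel)"
    and [measurable]: "A \<in> sets borel" "B \<in> sets borel"
  shows "(\<integral>\<^sup>+x\<in>A. (\<integral>\<^sup>+y\<in>B. f x y \<partial>lborel) \<partial>lborel) = (\<integral>\<^sup>+y\<in>B. (\<integral>\<^sup>+x\<in>A. f x y \<partial>lborel) \<partial>lborel)"
proof -
  note [measurable (raw)] = measurable_binary[OF f]
  have "(\<integral>\<^sup>+x\<in>A. (\<integral>\<^sup>+y\<in>B. f x y \<partial>lborel) \<partial>lborel) = (\<integral>\<^sup>+x. (\<integral>\<^sup>+y. f x y * indicator A x * indicator B y \<partial>lborel) \<partial>lborel)"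
    by (intro nn_integral_cong) (subst nn_integral_multc[symmetric], auto intro!: nn_integral_cong simp: mult_ac)
  also have "\<dots> = (\<integral>\<^sup>+y. (\<integral>\<^sup>+x. f x y * indicator A x * indicator B y \<partial>lborel) \<partial>lborel)"
    by (rule lborel_pair.Fubini'[symmetric]) measurable
  also have "\<dots> = (\<integral>\<^sup>+y\<in>B. (\<integral>\<^sup>+x\<in>A. f x y \<partial>lborel) \<partial>lborel)"
    by (intro nn_integral_cong) (subst nn_integral_multc[symmetric], auto intro!: nn_integral_cong simp: mult_ac)
  finally show ?thesis .
qed

definition circle_energy :: "real \<Rightarrow> (real \<Rightarrow> real) \<Rightarrow> ennreal" where
  "circle_energy p f = (\<integral>\<^sup>+z\<in>{0..<2}. ennreal (\<bar>f z\<bar> powr p) \<partial>lborel)"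

context circle_flow
begin

lemmas g_measurable [measurable (raw)] = measurable_binary[OF g_meas]

definition refl_sum :: "real \<Rightarrow> real \<Rightarrow> real" where
  "refl_sum x z = g x z + g x (2 * x - z)"

lemma refl_sum_measurable [measurable (raw)]:
  assumes [measurable]: "u \<in> borel_measurable N" "v \<in> borel_measurable N"
  shows "(\<lambda>x. refl_sum (u x) (v x)) \<in> borel_measurable N"
  unfolding refl_sum_def by measurable

lemma refl_sum_refl: "refl_sum x (2 * x - z) = refl_sum x z"
  by (simp add: refl_sum_def)

lemma g_per_refl: "g x (2 * x - (z + 2)) = g x (2 * x - z)"
  using g_per[of x "2 * x - (z + 2)"] by (simp add: algebra_simps)

lemma refl_sum_per: "refl_sum x (z + 2) = refl_sum x z"
  by (simp add: refl_sum_def g_per g_per_refl)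

lemma rate_integrable:
  assumes "0 \<le> r"
  shows "set_integrable lborel {r..t} (\<lambda>x. - 1 / 2 * (b x z * refl_sum x z))"
proof (cases "r \<le> t")
  case True
  have "set_integrable lborel {0..t} (\<lambda>x. - 1 / 2 * (b x z * refl_sum x z))"
    unfolding refl_sum_def using g_int[of t z] assms True by (intro set_integrable_mult_right) auto
  then show ?thesis by (rule set_integrable_subset) (use assms in auto)
qed (simp add: set_integrable_def)

lemma g_increment:
  assumes "0 \<le> r" "r \<le> t"
  shows "g t z = g r z + (LINT x:{r..t}|lborel. - 1 / 2 * (b x z * refl_sum x z))"
proof -
  have eq: "g t z = g 0 z + (LINT x:{0..t}|lborel. - 1 / 2 * (b x z * refl_sum x z))" if "0 \<le> t" for t
    using g_eq[OF that, of z] set_integral_mult_right[of lborel "{0..t}" "- 1 / 2" "\<lambda>x. b x z * refl_sum x z"]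
    by (simp add: refl_sum_def)
  have "(LINT x:{0..t}|lborel. - 1 / 2 * (b x z * refl_sum x z)) =
      (LINT x:{0..r}|lborel. - 1 / 2 * (b x z * refl_sum x z)) + (LINT x:{r..t}|lborel. - 1 / 2 * (b x z * refl_sum x z))"
    by (rule LINT_combine) (use assms rate_integrable in auto)
  then show ?thesis using eq[of r] eq[of t] assms by simp
qed

end

locale circle_flow_Lp = circle_flow +
  fixes p :: real
  assumes p_gt1: "1 < p" and Lp0: "circle_energy p (g 0) < \<infinity>"
begin

lemma energy_reflected:
  "(\<integral>\<^sup>+z\<in>{0..<2}. ennreal (\<bar>g x (2 * x - z)\<bar> powr p) \<partial>lborel) = circle_energy p (g x)"
  unfolding circle_energy_def
  using set_nn_integral_periodic_affine[of "\<lambda>z. ennreal (\<bar>g x z\<bar> powr p)", where s = "-1" and c = "2 * x" and a = 0]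
  by (simp add: g_per)

text \<open>
  On bounded time intervals the solution is dominated by a function of \<open>z\<close> alone that is locally
  in \<open>L\<^sup>p\<close>. It serves as the dominating function when the continuity of the traces is
  proved.
\<close>

lemma envelope:
  "\<exists>E. E \<in> borel_measurable borel \<and> (\<forall>t\<in>{0..T}. \<forall>z. \<bar>g t z\<bar> \<le> E z) \<and>
    (\<forall>R. (\<integral>\<^sup>+z\<in>{- R..R}. ennreal (E z powr p) \<partial>lborel) < \<infinity>)"
proof -
  obtain K where K: "0 \<le> K" "\<And>x z. x \<in> {0..T} \<Longrightarrow> \<bar>g x z\<bar> \<le> K * (\<bar>g 0 z\<bar> + 1)" using g_bound[of T] by blast
  define E where "E z = K * (\<bar>g 0 z\<bar> + 1)" for z
  have Em: "E \<in> borel_measurable borel" unfolding E_def[abs_def] by measurable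
  note [measurable] = Em
  have Eper: "E (z + 2) = E z" for z by (simp add: E_def g_per)
  have fin2: "(\<integral>\<^sup>+z\<in>{0..<2}. ennreal (E z powr p) \<partial>lborel) < \<infinity>"
  proof -
    have "(\<integral>\<^sup>+z\<in>{0..<2}. ennreal (E z powr p) \<partial>lborel) \<le> (\<integral>\<^sup>+z. ennreal (K powr p * 2 powr p) * (ennreal (\<bar>g 0 z\<bar> powr p) * indicator {0..<2} z + indicator {0..<2} z) \<partial>lborel)"
    proof (rule nn_integral_mono)
      fix z
      have "E z powr p = K powr p * \<bar>\<bar>g 0 z\<bar> + 1\<bar> powr p" using K by (simp add: E_def powr_mult)
      also have "\<dots> \<le> K powr p * (2 powr p * (\<bar>g 0 z\<bar> powr p + 1))"
        using abs_add_powr_le[of p "\<bar>g 0 z\<bar>" 1] p_gt1 by (intro mult_left_mono) auto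
      finally show "ennreal (E z powr p) * indicator {0..<2} z \<le>
          ennreal (K powr p * 2 powr p) * (ennreal (\<bar>g 0 z\<bar> powr p) * indicator {0..<2} z + indicator {0..<2} z)"
        by (auto simp: indicator_def ennreal_mult[symmetric] ennreal_plus[symmetric] mult.assoc
            simp del: ennreal_plus simp flip: ennreal_1 intro!: ennreal_leI)
    qed
    also have "\<dots> = ennreal (K powr p * 2 powr p) * (circle_energy p (g 0) + 2)"
      unfolding circle_energy_def by (simp add: nn_integral_cmult nn_integral_add)
    also have "\<dots> < \<infinity>" using Lp0 by (simp add: ennreal_mult_less_top)
    finally show ?thesis .
  qed
  have "(\<integral>\<^sup>+z\<in>{- R..R}. ennreal (E z powr p) \<partial>lborel) < \<infinity>" for R
  proof -
    obtain N :: nat where N: "R < real N" using reals_Archimedean2 by blast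
    have "(\<integral>\<^sup>+z\<in>{- R..R}. ennreal (E z powr p) \<partial>lborel) \<le> (\<integral>\<^sup>+z\<in>{- R..<- R + 2 * real N}. ennreal (E z powr p) \<partial>lborel)"
      using N by (intro nn_integral_mono) (auto simp: indicator_def)
    also have "\<dots> = of_nat N * (\<integral>\<^sup>+z\<in>{0..<2}. ennreal (E z powr p) \<partial>lborel)"
      by (rule set_nn_integral_periodic_multiple) (auto simp: Eper)
    also have "\<dots> < \<infinity>" using fin2 by (simp add: ennreal_mult_less_top of_nat_less_top)
    finally show ?thesis .
  qed
  with K(2) Em show ?thesis by (intro exI[of _ E]) (auto simp: E_def)
qed

lemma energy_bounded: "\<exists>C < \<infinity>. \<forall>x\<in>{0..T}. circle_energy p (g x) \<le> C"
proof -
  obtain E where E: "\<And>t z. t \<in> {0..T} \<Longrightarrow> \<bar>g t z\<bar> \<le> E z"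
    "(\<integral>\<^sup>+z\<in>{- 2..2}. ennreal (E z powr p) \<partial>lborel) < \<infinity>"
    using envelope[of T] by blast
  have "circle_energy p (g x) \<le> (\<integral>\<^sup>+z\<in>{- 2..2}. ennreal (E z powr p) \<partial>lborel)" if "x \<in> {0..T}" for x
    unfolding circle_energy_def
    using E(1)[OF that] p_gt1 by (intro nn_integral_mono) (auto simp: indicator_def intro!: ennreal_leI powr_mono2)
  with E(2) show ?thesis by blast
qed

text \<open>
  Since reflection exchanges \<open>g x z\<close> and \<open>g x (2 * x - z)\<close>, the rate of change of
  the energy may be symmetrized; this is, up to the factor \<open>- p / 4\<close>, the symmetrized density of
  that rate.
\<close>

definition dissipation :: "real \<Rightarrow> real \<Rightarrow> real" where
  "dissipation x z = b x z * ((signed_powr (p - 1) (g x z) + signed_powr (p - 1) (g x (2 * x - z))) * refl_sum x z)"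

lemma dissipation_measurable [measurable (raw)]:
  assumes [measurable]: "u \<in> borel_measurable N" "v \<in> borel_measurable N"
  shows "(\<lambda>x. dissipation (u x) (v x)) \<in> borel_measurable N"
  unfolding dissipation_def by measurable

lemma dissipation_nonneg: "0 \<le> dissipation x z"
proof -
  have "0 \<le> (signed_powr (p - 1) u + signed_powr (p - 1) v) * (u + v)" for u v
  proof (cases "0 \<le> u + v")
    case True
    then have "signed_powr (p - 1) (- v) \<le> signed_powr (p - 1) u" using p_gt1 by (intro signed_powr_mono) auto
    then show ?thesis using True by simp
  next
    case False
    then have "signed_powr (p - 1) u \<le> signed_powr (p - 1) (- v)" using p_gt1 by (intro signed_powr_mono) auto
    then show ?thesis using False by (intro mult_nonpos_nonpos) auto
  qed
  then show ?thesis unfolding dissipation_def refl_sum_def using b_nonneg by simp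
qed

lemma dissipation_density_bound:
  "\<bar>signed_powr (p - 1) (g x z) * (b x z * refl_sum x z)\<bar> \<le> 2 * M * (\<bar>g x z\<bar> powr p + \<bar>g x (2 * x - z)\<bar> powr p)"
proof -
  define u v where "u = \<bar>g x z\<bar>" and "v = \<bar>g x (2 * x - z)\<bar>"
  define m where "m = max u v"
  have uv: "0 \<le> u" "0 \<le> v" by (auto simp: u_def v_def)
  have m: "0 \<le> m" "u \<le> m" "v \<le> m" using uv by (auto simp: m_def)
  have "\<bar>signed_powr (p - 1) (g x z) * (b x z * refl_sum x z)\<bar> = u powr (p - 1) * (b x z * \<bar>refl_sum x z\<bar>)"
    using b_nonneg by (simp add: abs_mult abs_signed_powr u_def)
  also have "\<dots> \<le> m powr (p - 1) * (M * (m + m))"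
  proof (intro mult_mono)
    show "\<bar>refl_sum x z\<bar> \<le> m + m" using m by (auto simp: refl_sum_def u_def v_def)
  qed (use b_le b_nonneg M_pos m uv p_gt1 in \<open>auto intro!: powr_mono2\<close>)
  also have "\<dots> = 2 * M * m powr p"
    using m by (cases "m = 0") (auto simp: powr_diff)
  also have "\<dots> \<le> 2 * M * (u powr p + v powr p)"
    using M_pos by (intro mult_left_mono) (auto simp: m_def max_def)
  finally show ?thesis by (simp add: u_def v_def)
qed

text \<open>
  The growth inequality for \<open>\<bar>g t z\<bar> powr p\<close> is integrated over the circle and
  symmetrized. The density \<open>H\<close> that occurs before symmetrization has no sign. Adding
  \<open>\<bar>H\<bar>\<close> to it, whose integral is finite, makes all integrands nonnegative, so that
  Tonelli's theorem suffices for the exchange of integrals.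
\<close>

lemma energy_dissipation:
  assumes s: "0 \<le> s" "s \<le> t"
  shows "circle_energy p (g t) +
      ennreal (p / 4) * (\<integral>\<^sup>+x\<in>{s..t}. (\<integral>\<^sup>+z\<in>{0..<2}. ennreal (dissipation x z) \<partial>lborel) \<partial>lborel)
    \<le> circle_energy p (g s)"
proof -
  define H where "H x z = signed_powr (p - 1) (g x z) * (b x z * refl_sum x z)" for x z
  have [measurable (raw)]: "(\<lambda>x. H (u x) (v x)) \<in> borel_measurable N"
    if [measurable]: "u \<in> borel_measurable N" "v \<in> borel_measurable N" for u v and N :: "'n measure"
    unfolding H_def by measurable
  have H_per: "H x (z + 2) = H x z" for x z by (simp add: H_def g_per refl_sum_per b_per)
  have H_sum: "H x z + H x (2 * x - z) = dissipation x z" for x z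
    unfolding H_def dissipation_def refl_sum_refl b_refl by (simp only: distrib_left distrib_right mult_ac)
  define A where "A = (\<integral>\<^sup>+x\<in>{s..t}. (\<integral>\<^sup>+z\<in>{0..<2}. ennreal \<bar>H x z\<bar> \<partial>lborel) \<partial>lborel)"
  define D where "D = (\<integral>\<^sup>+x\<in>{s..t}. (\<integral>\<^sup>+z\<in>{0..<2}. ennreal (dissipation x z) \<partial>lborel) \<partial>lborel)"
  have A_fin: "A < \<infinity>"
  proof -
    obtain C where C: "C < \<infinity>" "\<And>x. x \<in> {0..t} \<Longrightarrow> circle_energy p (g x) \<le> C" using energy_bounded[of t] by blast
    have "(\<integral>\<^sup>+z\<in>{0..<2}. ennreal \<bar>H x z\<bar> \<partial>lborel) \<le> ennreal (2 * M) * (C + C)" if x: "x \<in> {0..t}" for x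
    proof -
      have "(\<integral>\<^sup>+z\<in>{0..<2}. ennreal \<bar>H x z\<bar> \<partial>lborel) \<le> (\<integral>\<^sup>+z. ennreal (2 * M) *
          (ennreal (\<bar>g x z\<bar> powr p) * indicator {0..<2} z + ennreal (\<bar>g x (2 * x - z)\<bar> powr p) * indicator {0..<2} z) \<partial>lborel)"
        using dissipation_density_bound M_pos
        by (intro nn_integral_mono) (auto simp: H_def indicator_def ennreal_mult[symmetric] ennreal_plus[symmetric]
            simp del: ennreal_plus intro!: ennreal_leI)
      also have "\<dots> = ennreal (2 * M) * (circle_energy p (g x) + circle_energy p (g x))"
        by (subst nn_integral_cmult, simp, subst nn_integral_add) (simp_all add: energy_reflected, simp add: circle_energy_def)
      also have "\<dots> \<le> ennreal (2 * M) * (C + C)"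
        by (intro mult_left_mono add_mono C x) auto
      finally show ?thesis .
    qed
    then have "A \<le> (\<integral>\<^sup>+x. ennreal (2 * M) * (C + C) * indicator {s..t} x \<partial>lborel)"
      unfolding A_def using s by (intro nn_integral_mono) (auto simp: indicator_def)
    also have "\<dots> < \<infinity>" using C s by (simp add: nn_integral_cmult_indicator ennreal_mult_less_top)
    finally show ?thesis .
  qed
  have pt: "ennreal (\<bar>g t z\<bar> powr p) + ennreal (p / 2) * (\<integral>\<^sup>+x\<in>{s..t}. ennreal (H x z + \<bar>H x z\<bar>) \<partial>lborel) \<le>
      ennreal (\<bar>g s z\<bar> powr p) + ennreal (p / 2) * (\<integral>\<^sup>+x\<in>{s..t}. ennreal \<bar>H x z\<bar> \<partial>lborel)" for z
  proof -
    have f: "g r' z = g r z + (LINT x:{r..r'}|lborel. - 1 / 2 * (b x z * refl_sum x z))" if "s \<le> r" "r \<le> r'" for r r'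
      using g_increment[of r r' z] that s by simp
    have HI: "set_integrable lborel {s..t} (\<lambda>x. H x z)"
    proof -
      have "set_integrable lborel {s..t} (\<lambda>x. - 2 * (signed_powr (p - 1) (g x z) * (- 1 / 2 * (b x z * refl_sum x z))))"
        by (intro set_integrable_mult_right powr_growth(2)[OF p_gt1 s(2) rate_integrable[OF s(1)]] f)
      then show ?thesis by (simp add: H_def)
    qed
    have aI: "set_integrable lborel {s..t} (\<lambda>x. \<bar>H x z\<bar>)" by (rule set_integrable_abs[OF HI])
    have nn: "(\<integral>\<^sup>+x\<in>{s..t}. ennreal (q x) \<partial>lborel) = ennreal (LINT x:{s..t}|lborel. q x)"
      "0 \<le> (LINT x:{s..t}|lborel. q x)"
      if q: "set_integrable lborel {s..t} q" "\<And>x. 0 \<le> q x" for q :: "real \<Rightarrow> real"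
    proof -
      have "(\<integral>\<^sup>+x\<in>{s..t}. ennreal (q x) \<partial>lborel) = (\<integral>\<^sup>+x. ennreal (indicator {s..t} x *\<^sub>R q x) \<partial>lborel)"
        by (intro nn_integral_cong) (auto simp: indicator_def)
      then show "(\<integral>\<^sup>+x\<in>{s..t}. ennreal (q x) \<partial>lborel) = ennreal (LINT x:{s..t}|lborel. q x)"
        using q unfolding set_lebesgue_integral_def set_integrable_def by (simp add: nn_integral_eq_integral)
      show "0 \<le> (LINT x:{s..t}|lborel. q x)" 
        unfolding set_lebesgue_integral_def using q by (intro Bochner_Integration.integral_nonneg) auto
    qed
    have "\<bar>g t z\<bar> powr p \<le> \<bar>g s z\<bar> powr p + p * (LINT x:{s..t}|lborel. signed_powr (p - 1) (g x z) * (- 1 / 2 * (b x z * refl_sum x z)))"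
      by (rule powr_growth(3)[OF p_gt1 s(2) rate_integrable[OF s(1)] f])
    also have "(LINT x:{s..t}|lborel. signed_powr (p - 1) (g x z) * (- 1 / 2 * (b x z * refl_sum x z))) = (LINT x:{s..t}|lborel. - 1 / 2 * H x z)"
      by (simp add: H_def)
    also have "\<dots> = - 1 / 2 * (LINT x:{s..t}|lborel. H x z)"
      by (rule set_integral_mult_right)
    finally have "\<bar>g t z\<bar> powr p + p / 2 * (LINT x:{s..t}|lborel. H x z + \<bar>H x z\<bar>) \<le> \<bar>g s z\<bar> powr p + p / 2 * (LINT x:{s..t}|lborel. \<bar>H x z\<bar>)"
      using HI aI by (subst set_integral_add(2)) (auto simp: algebra_simps)
    then have "ennreal (\<bar>g t z\<bar> powr p + p / 2 * (LINT x:{s..t}|lborel. H x z + \<bar>H x z\<bar>)) \<le> ennreal (\<bar>g s z\<bar> powr p + p / 2 * (LINT x:{s..t}|lborel. \<bar>H x z\<bar>))"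
      by (rule ennreal_leI)
    moreover have nn1: "0 \<le> H x z + \<bar>H x z\<bar>" for x by linarith
    ultimately show ?thesis
      using nn[OF set_integral_add(1)[OF HI aI] nn1] nn[OF aI] p_gt1 by (simp add: ennreal_mult[symmetric])
  qed
  have "circle_energy p (g t) + ennreal (p / 2) * (\<integral>\<^sup>+z\<in>{0..<2}. (\<integral>\<^sup>+x\<in>{s..t}. ennreal (H x z + \<bar>H x z\<bar>) \<partial>lborel) \<partial>lborel) =
     (\<integral>\<^sup>+z. (ennreal (\<bar>g t z\<bar> powr p) + ennreal (p / 2) * (\<integral>\<^sup>+x\<in>{s..t}. ennreal (H x z + \<bar>H x z\<bar>) \<partial>lborel)) * indicator {0..<2} z \<partial>lborel)"
    by (simp add: circle_energy_def distrib_right nn_integral_add nn_integral_cmult mult.assoc)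
  also have "\<dots> \<le> (\<integral>\<^sup>+z. (ennreal (\<bar>g s z\<bar> powr p) + ennreal (p / 2) * (\<integral>\<^sup>+x\<in>{s..t}. ennreal \<bar>H x z\<bar> \<partial>lborel)) * indicator {0..<2} z \<partial>lborel)"
    by (intro nn_integral_mono mult_right_mono pt) auto
  also have "\<dots> = circle_energy p (g s) + ennreal (p / 2) * (\<integral>\<^sup>+z\<in>{0..<2}. (\<integral>\<^sup>+x\<in>{s..t}. ennreal \<bar>H x z\<bar> \<partial>lborel) \<partial>lborel)"
    by (simp add: circle_energy_def distrib_right nn_integral_add nn_integral_cmult mult.assoc)
  also have "(\<integral>\<^sup>+z\<in>{0..<2}. (\<integral>\<^sup>+x\<in>{s..t}. ennreal \<bar>H x z\<bar> \<partial>lborel) \<partial>lborel) = A"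
    unfolding A_def by (rule tonelli_rectangle[symmetric]) (auto simp: split_beta')
  also have "(\<integral>\<^sup>+z\<in>{0..<2}. (\<integral>\<^sup>+x\<in>{s..t}. ennreal (H x z + \<bar>H x z\<bar>) \<partial>lborel) \<partial>lborel) =
      (\<integral>\<^sup>+x\<in>{s..t}. (\<integral>\<^sup>+z\<in>{0..<2}. ennreal (H x z + \<bar>H x z\<bar>) \<partial>lborel) \<partial>lborel)"
    by (rule tonelli_rectangle[symmetric]) (auto simp: split_beta')
  finally have main: "circle_energy p (g t) + ennreal (p / 2) * (\<integral>\<^sup>+x\<in>{s..t}. (\<integral>\<^sup>+z\<in>{0..<2}. ennreal (H x z + \<bar>H x z\<bar>) \<partial>lborel) \<partial>lborel) \<le>
     circle_energy p (g s) + ennreal (p / 2) * A" .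
  have half: "ennreal (1 / 2) * (X + X) = X" for X :: ennreal
  proof -
    have "ennreal (1 / 2) * ennreal 2 = 1" by (subst ennreal_mult[symmetric]) auto
    moreover have "X + X = ennreal 2 * X" by (simp add: mult_2)
    ultimately show ?thesis by (metis mult.assoc mult_1)
  qed
  have sym: "(\<integral>\<^sup>+z\<in>{0..<2}. ennreal (H x z + \<bar>H x z\<bar>) \<partial>lborel) =
      ennreal (1 / 2) * (\<integral>\<^sup>+z\<in>{0..<2}. ennreal (dissipation x z) \<partial>lborel) + (\<integral>\<^sup>+z\<in>{0..<2}. ennreal \<bar>H x z\<bar> \<partial>lborel)"
    (is "?X = _ * ?D + ?A") for x
  proof -
    have refl: "(\<integral>\<^sup>+z\<in>{0..<2}. q (H x (2 * x - z)) \<partial>lborel) = (\<integral>\<^sup>+z\<in>{0..<2}. q (H x z) \<partial>lborel)"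
      if [measurable]: "q \<in> borel_measurable borel" for q :: "real \<Rightarrow> ennreal"
      using set_nn_integral_periodic_affine[of "\<lambda>z. q (H x z)", where s = "-1" and c = "2 * x" and a = 0]
      by (simp add: H_per)
    have "(\<integral>\<^sup>+z\<in>{0..<2}. ennreal (H x z + \<bar>H x z\<bar>) \<partial>lborel) + (\<integral>\<^sup>+z\<in>{0..<2}. ennreal (H x z + \<bar>H x z\<bar>) \<partial>lborel)
       = (\<integral>\<^sup>+z\<in>{0..<2}. ennreal (H x z + \<bar>H x z\<bar>) \<partial>lborel) + (\<integral>\<^sup>+z\<in>{0..<2}. ennreal (H x (2 * x - z) + \<bar>H x (2 * x - z)\<bar>) \<partial>lborel)"
      by (subst refl[of "\<lambda>h. ennreal (h + \<bar>h\<bar>)"]) auto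
    also have "\<dots> = (\<integral>\<^sup>+z. ennreal (H x z + \<bar>H x z\<bar>) * indicator {0..<2} z + ennreal (H x (2 * x - z) + \<bar>H x (2 * x - z)\<bar>) * indicator {0..<2} z \<partial>lborel)"
      by (rule nn_integral_add[symmetric]) auto
    also have "\<dots> = (\<integral>\<^sup>+z. ennreal (dissipation x z) * indicator {0..<2} z + (ennreal \<bar>H x z\<bar> * indicator {0..<2} z + ennreal \<bar>H x (2 * x - z)\<bar> * indicator {0..<2} z) \<partial>lborel)"
    proof (rule nn_integral_cong)
      fix z
      have nn: "0 \<le> h + \<bar>h\<bar>" for h :: real by linarith
      have "ennreal (H x z + \<bar>H x z\<bar>) + ennreal (H x (2 * x - z) + \<bar>H x (2 * x - z)\<bar>) = ennreal (dissipation x z) + (ennreal \<bar>H x z\<bar> + ennreal \<bar>H x (2 * x - z)\<bar>)"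
        using H_sum[of x z] dissipation_nonneg[of x z] nn[of "H x z"] nn[of "H x (2 * x - z)"]
        by (simp add: ennreal_plus[symmetric] del: ennreal_plus)
      then show "ennreal (H x z + \<bar>H x z\<bar>) * indicator {0..<2} z + ennreal (H x (2 * x - z) + \<bar>H x (2 * x - z)\<bar>) * indicator {0..<2} z
         = ennreal (dissipation x z) * indicator {0..<2} z + (ennreal \<bar>H x z\<bar> * indicator {0..<2} z + ennreal \<bar>H x (2 * x - z)\<bar> * indicator {0..<2} z)"
        by (simp add: indicator_def)
    qed
    also have "\<dots> = (\<integral>\<^sup>+z\<in>{0..<2}. ennreal (dissipation x z) \<partial>lborel) + ((\<integral>\<^sup>+z\<in>{0..<2}. ennreal \<bar>H x z\<bar> \<partial>lborel) + (\<integral>\<^sup>+z\<in>{0..<2}. ennreal \<bar>H x (2 * x - z)\<bar> \<partial>lborel))"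
      by (simp add: nn_integral_add)
    also have "(\<integral>\<^sup>+z\<in>{0..<2}. ennreal \<bar>H x (2 * x - z)\<bar> \<partial>lborel) = (\<integral>\<^sup>+z\<in>{0..<2}. ennreal \<bar>H x z\<bar> \<partial>lborel)"
      by (rule refl[of "\<lambda>h. ennreal \<bar>h\<bar>"]) auto
    finally have double: "?X + ?X = ?D + (?A + ?A)" .
    have "?X = ennreal (1 / 2) * (?X + ?X)" by (rule half[symmetric])
    also have "\<dots> = ennreal (1 / 2) * ?D + ennreal (1 / 2) * (?A + ?A)"
      unfolding double by (rule distrib_left)
    finally show ?thesis unfolding half .
  qed
  have "(\<integral>\<^sup>+x\<in>{s..t}. (\<integral>\<^sup>+z\<in>{0..<2}. ennreal (H x z + \<bar>H x z\<bar>) \<partial>lborel) \<partial>lborel) = ennreal (1 / 2) * D + A"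
    unfolding sym D_def A_def by (simp add: distrib_right nn_integral_add nn_integral_cmult mult.assoc)
  with main have "circle_energy p (g t) + ennreal (p / 2) * (ennreal (1 / 2) * D + A) \<le> circle_energy p (g s) + ennreal (p / 2) * A"
    by simp
  also have "ennreal (p / 2) * (ennreal (1 / 2) * D + A) = ennreal (p / 4) * D + ennreal (p / 2) * A"
  proof -
    have "ennreal (p / 4) = ennreal (p / 2) * ennreal (1 / 2)"
      using p_gt1 by (subst ennreal_mult[symmetric]) auto
    then show ?thesis by (simp only: distrib_left mult.assoc)
  qed
  finally have "ennreal (p / 2) * A + (circle_energy p (g t) + ennreal (p / 4) * D) \<le> ennreal (p / 2) * A + circle_energy p (g s)"
    by (simp add: add_ac)
  moreover have "ennreal (p / 2) * A \<noteq> top" using A_fin by (simp add: ennreal_mult_eq_top_iff)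
  ultimately show ?thesis by (simp add: D_def ennreal_add_left_cancel_le)
qed

end

section \<open>Observability and exponential decay\<close>

context circle_flow_Lp
begin

definition residual :: "real \<Rightarrow> ennreal" where
  "residual s = (\<integral>\<^sup>+x\<in>{s..s + 2}. (\<integral>\<^sup>+z\<in>{0..<2}. ennreal (b x z * \<bar>refl_sum x z\<bar> powr p) \<partial>lborel) \<partial>lborel)"

text \<open>
  Along a characteristic the solution changes only through \<open>b * refl_sum\<close>. Jensen's inequality
  and \<open>b powr p \<le> M powr (p - 1) * b\<close> bound the total change by the residual.
\<close>

lemma displacement_bound:
  assumes s: "0 \<le> s" "s \<le> t" "t \<le> s + 2"
  shows "(\<integral>\<^sup>+z\<in>{0..<2}. ennreal (\<bar>g t z - g s z\<bar> powr p) \<partial>lborel) \<le> ennreal (M powr (p - 1)) * residual s"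
proof (cases "s = t")
  case True
  then show ?thesis using p_gt1 by simp
next
  case False
  then have st: "s < t" using s by simp
  have pt: "ennreal (\<bar>g t z - g s z\<bar> powr p) \<le> ennreal (M powr (p - 1)) * (\<integral>\<^sup>+x\<in>{s..s + 2}. ennreal (b x z * \<bar>refl_sum x z\<bar> powr p) \<partial>lborel)" for z
  proof -
    have "ennreal (\<bar>g t z - g s z\<bar> powr p) = ennreal (\<bar>LINT x:{s..t}|lborel. - 1 / 2 * (b x z * refl_sum x z)\<bar> powr p)"
      using g_increment[OF s(1,2), of z] by simp
    also have "\<dots> \<le> ennreal ((t - s) powr (p - 1)) * (\<integral>\<^sup>+x\<in>{s..t}. ennreal (\<bar>- 1 / 2 * (b x z * refl_sum x z)\<bar> powr p) \<partial>lborel)"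
      by (rule jensen_powr[OF p_gt1 st rate_integrable[OF s(1)]])
    also have "\<dots> = (\<integral>\<^sup>+x. ennreal ((t - s) powr (p - 1)) * (ennreal (\<bar>- 1 / 2 * (b x z * refl_sum x z)\<bar> powr p) * indicator {s..t} x) \<partial>lborel)"
      by (rule nn_integral_cmult[symmetric]) measurable
    also have "\<dots> \<le> (\<integral>\<^sup>+x. ennreal (M powr (p - 1)) * (ennreal (b x z * \<bar>refl_sum x z\<bar> powr p) * indicator {s..s + 2} x) \<partial>lborel)"
    proof (rule nn_integral_mono)
      fix x
      have b: "0 \<le> b x z" "b x z \<le> M" using b_nonneg b_le by auto
      have "(t - s) powr (p - 1) * \<bar>- 1 / 2 * (b x z * refl_sum x z)\<bar> powr p \<le> 2 powr (p - 1) * \<bar>- 1 / 2 * (b x z * refl_sum x z)\<bar> powr p"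
        using s st p_gt1 by (intro mult_right_mono powr_mono2) auto
      also have "\<dots> = (2 powr (p - 1) * (1 / 2) powr p) * (b x z powr p * \<bar>refl_sum x z\<bar> powr p)"
      proof -
        have "\<bar>- 1 / 2 * (b x z * refl_sum x z)\<bar> = 1 / 2 * (b x z * \<bar>refl_sum x z\<bar>)" using b by (simp add: abs_mult)
        then show ?thesis by (simp only: powr_mult mult.assoc)
      qed
      also have "\<dots> = 1 / 2 * (b x z powr p * \<bar>refl_sum x z\<bar> powr p)"
        by (simp add: powr_diff powr_divide)
      also have "\<dots> \<le> 1 * (b x z powr p * \<bar>refl_sum x z\<bar> powr p)"
        by (intro mult_right_mono) auto
      also have "b x z powr p = b x z powr (p - 1) * b x z"
        using b by (cases "b x z = 0") (auto simp: powr_diff)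
      also have "1 * (b x z powr (p - 1) * b x z * \<bar>refl_sum x z\<bar> powr p) \<le> 1 * (M powr (p - 1) * b x z * \<bar>refl_sum x z\<bar> powr p)"
        using b p_gt1 by (intro mult_left_mono mult_right_mono powr_mono2) auto
      finally show "ennreal ((t - s) powr (p - 1)) * (ennreal (\<bar>- 1 / 2 * (b x z * refl_sum x z)\<bar> powr p) * indicator {s..t} x) \<le>
         ennreal (M powr (p - 1)) * (ennreal (b x z * \<bar>refl_sum x z\<bar> powr p) * indicator {s..s + 2} x)"
        using s b by (auto simp: indicator_def ennreal_mult[symmetric] mult.assoc intro!: ennreal_leI)
    qed
    also have "\<dots> = ennreal (M powr (p - 1)) * (\<integral>\<^sup>+x\<in>{s..s + 2}. ennreal (b x z * \<bar>refl_sum x z\<bar> powr p) \<partial>lborel)"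
      by (rule nn_integral_cmult) measurable
    finally show ?thesis .
  qed
  have "(\<integral>\<^sup>+z\<in>{0..<2}. ennreal (\<bar>g t z - g s z\<bar> powr p) \<partial>lborel) \<le>
      (\<integral>\<^sup>+z. ennreal (M powr (p - 1)) * ((\<integral>\<^sup>+x\<in>{s..s + 2}. ennreal (b x z * \<bar>refl_sum x z\<bar> powr p) \<partial>lborel) * indicator {0..<2} z) \<partial>lborel)"
    using pt by (intro nn_integral_mono) (auto simp: indicator_def)
  also have "\<dots> = ennreal (M powr (p - 1)) * (\<integral>\<^sup>+z\<in>{0..<2}. (\<integral>\<^sup>+x\<in>{s..s + 2}. ennreal (b x z * \<bar>refl_sum x z\<bar> powr p) \<partial>lborel) \<partial>lborel)"
    by (rule nn_integral_cmult) measurable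
  also have "(\<integral>\<^sup>+z\<in>{0..<2}. (\<integral>\<^sup>+x\<in>{s..s + 2}. ennreal (b x z * \<bar>refl_sum x z\<bar> powr p) \<partial>lborel) \<partial>lborel) = residual s"
    unfolding residual_def by (rule tonelli_rectangle[symmetric]) (auto simp: split_beta')
  finally show ?thesis .
qed

text \<open>
  During a time interval of length two every characteristic meets the strip where the damping is bounded
  below, and there a small residual forces \<open>g x (x + y) + g x (x - y)\<close> to be small. As the
  solution has moved little along the characteristics, the same holds with \<open>g s\<close> in place of
  \<open>g x\<close>: the profile \<open>g s\<close> is nearly opposite to its translates by
  \<open>2 * y\<close>, for all \<open>y\<close> in the strip. The Poincare-type inequality then bounds its
  energy.
\<close>

lemma observability:
  assumes s: "0 \<le> s" and lam: "0 < lam"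
    and e: "0 < \<epsilon>" "0 \<le> x0 - \<epsilon>" "x0 + \<epsilon> \<le> 1" and n: "1 \<le> real n * \<epsilon>"
    and strip: "\<And>x y. 0 \<le> x \<Longrightarrow> y \<in> {x0 - \<epsilon><..<x0 + \<epsilon>} \<Longrightarrow> lam \<le> b x (x + y)"
  shows "circle_energy p (g s) \<le>
    ennreal ((1 + (2 * 2 powr p) ^ (n + 1)) / \<epsilon> * (4 powr p * (1 / lam + 4 * M powr (p - 1)))) * residual s"
proof -
  define G where "G = g s"
  have [measurable]: "G \<in> borel_measurable borel" unfolding G_def by measurable
  have Gper: "G (z + 2) = G z" for z by (simp add: G_def g_per)
  let ?S = "{x0 - \<epsilon><..<x0 + \<epsilon>}"
  define \<Delta> where "\<Delta> x z = g x z - g s z" for x z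
  have [measurable (raw)]: "(\<lambda>x. \<Delta> (u x) (v x)) \<in> borel_measurable N"
    if [measurable]: "u \<in> borel_measurable N" "v \<in> borel_measurable N" for u v and N :: "'n measure"
    unfolding \<Delta>_def by measurable
  have window: "(\<integral>\<^sup>+y\<in>?S. q (x + \<sigma> * y) \<partial>lborel) \<le> (\<integral>\<^sup>+z\<in>{0..<2}. q z \<partial>lborel)"
    if [measurable]: "q \<in> borel_measurable borel" and "\<And>z. q (z + 2) = q z" "\<sigma> = 1 \<or> \<sigma> = -1"
    for q :: "real \<Rightarrow> ennreal" and x \<sigma>
  proof -
    have "(\<integral>\<^sup>+y\<in>?S. q (x + \<sigma> * y) \<partial>lborel) \<le> (\<integral>\<^sup>+y\<in>{0..<0 + 2}. q (x + \<sigma> * y) \<partial>lborel)"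
      using e by (intro nn_integral_mono) (auto simp: indicator_def)
    also have "\<dots> = (\<integral>\<^sup>+z\<in>{0..<2}. q z \<partial>lborel)"
      by (rule set_nn_integral_periodic_affine) (use that in auto)
    finally show ?thesis .
  qed
  \<comment> \<open>On the strip the damping is at least \<open>lam\<close>, so the residual controls the sum itself.\<close>
  have W: "(\<integral>\<^sup>+x\<in>{s..<s + 2}. (\<integral>\<^sup>+y\<in>?S. ennreal (\<bar>refl_sum x (x + y)\<bar> powr p) \<partial>lborel) \<partial>lborel) \<le> ennreal (1 / lam) * residual s"
  proof -
    have "(\<integral>\<^sup>+y\<in>?S. ennreal (\<bar>refl_sum x (x + y)\<bar> powr p) \<partial>lborel) \<le> ennreal (1 / lam) * (\<integral>\<^sup>+z\<in>{0..<2}. ennreal (b x z * \<bar>refl_sum x z\<bar> powr p) \<partial>lborel)"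
      if x: "s \<le> x" for x
    proof -
      have "(\<integral>\<^sup>+y\<in>?S. ennreal (\<bar>refl_sum x (x + y)\<bar> powr p) \<partial>lborel) \<le>
          (\<integral>\<^sup>+y. ennreal (1 / lam) * (ennreal (b x (x + 1 * y) * \<bar>refl_sum x (x + 1 * y)\<bar> powr p) * indicator ?S y) \<partial>lborel)"
      proof (rule nn_integral_mono)
        fix y
        have "\<bar>refl_sum x (x + y)\<bar> powr p \<le> 1 / lam * (b x (x + y) * \<bar>refl_sum x (x + y)\<bar> powr p)" if "y \<in> ?S"
        proof -
          have "lam * \<bar>refl_sum x (x + y)\<bar> powr p \<le> b x (x + y) * \<bar>refl_sum x (x + y)\<bar> powr p"
            using strip[OF _ that, of x] x s by (intro mult_right_mono) auto
          then show ?thesis using lam by (simp add: field_simps)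
        qed
        then show "ennreal (\<bar>refl_sum x (x + y)\<bar> powr p) * indicator ?S y \<le> ennreal (1 / lam) * (ennreal (b x (x + 1 * y) * \<bar>refl_sum x (x + 1 * y)\<bar> powr p) * indicator ?S y)"
          using lam b_nonneg by (auto simp: indicator_def ennreal_mult[symmetric] simp del: mult_1 intro!: ennreal_leI)
      qed
      also have "\<dots> = ennreal (1 / lam) * (\<integral>\<^sup>+y\<in>?S. ennreal (b x (x + 1 * y) * \<bar>refl_sum x (x + 1 * y)\<bar> powr p) \<partial>lborel)"
        by (rule nn_integral_cmult) measurable
      also have "\<dots> \<le> ennreal (1 / lam) * (\<integral>\<^sup>+z\<in>{0..<2}. ennreal (b x z * \<bar>refl_sum x z\<bar> powr p) \<partial>lborel)"
        by (intro mult_left_mono window[of "\<lambda>z. ennreal (b x z * \<bar>refl_sum x z\<bar> powr p)"]) (auto simp: b_per refl_sum_per)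
      finally show ?thesis .
    qed
    then have "(\<integral>\<^sup>+x\<in>{s..<s + 2}. (\<integral>\<^sup>+y\<in>?S. ennreal (\<bar>refl_sum x (x + y)\<bar> powr p) \<partial>lborel) \<partial>lborel) \<le>
       (\<integral>\<^sup>+x. ennreal (1 / lam) * ((\<integral>\<^sup>+z\<in>{0..<2}. ennreal (b x z * \<bar>refl_sum x z\<bar> powr p) \<partial>lborel) * indicator {s..s + 2} x) \<partial>lborel)"
      by (intro nn_integral_mono) (auto simp: indicator_def)
    also have "\<dots> = ennreal (1 / lam) * residual s"
      unfolding residual_def by (rule nn_integral_cmult) measurable
    finally show ?thesis .
  qed
  have D: "(\<integral>\<^sup>+x\<in>{s..<s + 2}. (\<integral>\<^sup>+y\<in>?S. ennreal (\<bar>\<Delta> x (x + \<sigma> * y)\<bar> powr p) \<partial>lborel) \<partial>lborel) \<le> ennreal (2 * M powr (p - 1)) * residual s"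
    if \<sigma>: "\<sigma> = 1 \<or> \<sigma> = -1" for \<sigma>
  proof -
    have "(\<integral>\<^sup>+y\<in>?S. ennreal (\<bar>\<Delta> x (x + \<sigma> * y)\<bar> powr p) \<partial>lborel) \<le> ennreal (M powr (p - 1)) * residual s" if x: "s \<le> x" "x < s + 2" for x
    proof -
      have "(\<integral>\<^sup>+y\<in>?S. ennreal (\<bar>\<Delta> x (x + \<sigma> * y)\<bar> powr p) \<partial>lborel) \<le> (\<integral>\<^sup>+z\<in>{0..<2}. ennreal (\<bar>\<Delta> x z\<bar> powr p) \<partial>lborel)"
        by (rule window[of "\<lambda>z. ennreal (\<bar>\<Delta> x z\<bar> powr p)"]) (use \<sigma> in \<open>auto simp: \<Delta>_def g_per\<close>)
      also have "\<dots> \<le> ennreal (M powr (p - 1)) * residual s"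
        unfolding \<Delta>_def using x s by (intro displacement_bound) auto
      finally show ?thesis .
    qed
    then have "(\<integral>\<^sup>+x\<in>{s..<s + 2}. (\<integral>\<^sup>+y\<in>?S. ennreal (\<bar>\<Delta> x (x + \<sigma> * y)\<bar> powr p) \<partial>lborel) \<partial>lborel) \<le>
      (\<integral>\<^sup>+x. ennreal (M powr (p - 1)) * residual s * indicator {s..<s + 2} x \<partial>lborel)"
      by (intro nn_integral_mono) (auto simp: indicator_def)
    also have "\<dots> = ennreal (2 * M powr (p - 1)) * residual s"
      by (subst nn_integral_cmult_indicator) (auto simp: ennreal_mult mult_ac)
    finally show ?thesis .
  qed
  have "(\<integral>\<^sup>+x\<in>{s..<s + 2}. (\<integral>\<^sup>+y\<in>?S. ennreal (\<bar>G (x + y) + G (x - y)\<bar> powr p) \<partial>lborel) \<partial>lborel) \<le>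
    (\<integral>\<^sup>+x. ennreal (4 powr p) * ((\<integral>\<^sup>+y\<in>?S. ennreal (\<bar>refl_sum x (x + y)\<bar> powr p) \<partial>lborel) * indicator {s..<s + 2} x +
       ((\<integral>\<^sup>+y\<in>?S. ennreal (\<bar>\<Delta> x (x + 1 * y)\<bar> powr p) \<partial>lborel) * indicator {s..<s + 2} x +
        (\<integral>\<^sup>+y\<in>?S. ennreal (\<bar>\<Delta> x (x + - 1 * y)\<bar> powr p) \<partial>lborel) * indicator {s..<s + 2} x)) \<partial>lborel)"
  proof (rule nn_integral_mono)
    fix x
    have "(\<integral>\<^sup>+y\<in>?S. ennreal (\<bar>G (x + y) + G (x - y)\<bar> powr p) \<partial>lborel) \<le>
      (\<integral>\<^sup>+y. ennreal (4 powr p) * (ennreal (\<bar>refl_sum x (x + y)\<bar> powr p) * indicator ?S y +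
       (ennreal (\<bar>\<Delta> x (x + 1 * y)\<bar> powr p) * indicator ?S y + ennreal (\<bar>\<Delta> x (x + - 1 * y)\<bar> powr p) * indicator ?S y)) \<partial>lborel)"
    proof (rule nn_integral_mono)
      fix y
      have c1: "1 \<le> (2::real) powr p" using p_gt1 by (simp add: ge_one_powr_ge_zero)
      have four: "(4::real) powr p = 2 powr p * 2 powr p" by (simp add: powr_mult[symmetric])
      let ?a = "refl_sum x (x + y)" and ?b = "\<Delta> x (x + 1 * y)" and ?c = "\<Delta> x (x + - 1 * y)"
      have "G (x + y) + G (x - y) = ?a - (?b + ?c)"
        by (simp add: G_def refl_sum_def \<Delta>_def)
      then have "\<bar>G (x + y) + G (x - y)\<bar> powr p \<le> 2 powr p * (\<bar>?a\<bar> powr p + \<bar>?b + ?c\<bar> powr p)"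
        using abs_diff_powr_le[of p ?a "?b + ?c"] p_gt1 by simp
      also have "\<dots> \<le> 2 powr p * (2 powr p * \<bar>?a\<bar> powr p + 2 powr p * (\<bar>?b\<bar> powr p + \<bar>?c\<bar> powr p))"
      proof (intro mult_left_mono add_mono abs_add_powr_le)
        show "\<bar>?a\<bar> powr p \<le> 2 powr p * \<bar>?a\<bar> powr p"
          using mult_right_mono[OF c1, of "\<bar>?a\<bar> powr p"] by simp
      qed (use p_gt1 in auto)
      also have "\<dots> = 4 powr p * (\<bar>?a\<bar> powr p + (\<bar>?b\<bar> powr p + \<bar>?c\<bar> powr p))"
        unfolding four by (simp add: distrib_left mult.assoc)
      finally show "ennreal (\<bar>G (x + y) + G (x - y)\<bar> powr p) * indicator ?S y \<le>
        ennreal (4 powr p) * (ennreal (\<bar>refl_sum x (x + y)\<bar> powr p) * indicator ?S y +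
       (ennreal (\<bar>\<Delta> x (x + 1 * y)\<bar> powr p) * indicator ?S y + ennreal (\<bar>\<Delta> x (x + - 1 * y)\<bar> powr p) * indicator ?S y))"
        by (cases "y \<in> ?S") (simp_all add: ennreal_mult[symmetric] ennreal_plus[symmetric] ennreal_leI del: ennreal_plus mult_1)
    qed
    also have "\<dots> = ennreal (4 powr p) * ((\<integral>\<^sup>+y\<in>?S. ennreal (\<bar>refl_sum x (x + y)\<bar> powr p) \<partial>lborel) +
       ((\<integral>\<^sup>+y\<in>?S. ennreal (\<bar>\<Delta> x (x + 1 * y)\<bar> powr p) \<partial>lborel) + (\<integral>\<^sup>+y\<in>?S. ennreal (\<bar>\<Delta> x (x + - 1 * y)\<bar> powr p) \<partial>lborel)))"
      by (simp add: nn_integral_cmult nn_integral_add)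
    finally show "(\<integral>\<^sup>+y\<in>?S. ennreal (\<bar>G (x + y) + G (x - y)\<bar> powr p) \<partial>lborel) * indicator {s..<s + 2} x \<le>
       ennreal (4 powr p) * ((\<integral>\<^sup>+y\<in>?S. ennreal (\<bar>refl_sum x (x + y)\<bar> powr p) \<partial>lborel) * indicator {s..<s + 2} x +
       ((\<integral>\<^sup>+y\<in>?S. ennreal (\<bar>\<Delta> x (x + 1 * y)\<bar> powr p) \<partial>lborel) * indicator {s..<s + 2} x +
        (\<integral>\<^sup>+y\<in>?S. ennreal (\<bar>\<Delta> x (x + - 1 * y)\<bar> powr p) \<partial>lborel) * indicator {s..<s + 2} x))"
      by (cases "x \<in> {s..<s + 2}") auto
  qed
  also have "\<dots> = ennreal (4 powr p) * ((\<integral>\<^sup>+x\<in>{s..<s + 2}. (\<integral>\<^sup>+y\<in>?S. ennreal (\<bar>refl_sum x (x + y)\<bar> powr p) \<partial>lborel) \<partial>lborel) +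
       ((\<integral>\<^sup>+x\<in>{s..<s + 2}. (\<integral>\<^sup>+y\<in>?S. ennreal (\<bar>\<Delta> x (x + 1 * y)\<bar> powr p) \<partial>lborel) \<partial>lborel) +
        (\<integral>\<^sup>+x\<in>{s..<s + 2}. (\<integral>\<^sup>+y\<in>?S. ennreal (\<bar>\<Delta> x (x + - 1 * y)\<bar> powr p) \<partial>lborel) \<partial>lborel)))"
    by (simp add: nn_integral_cmult nn_integral_add)
  also have "\<dots> \<le> ennreal (4 powr p) * (ennreal (1 / lam) * residual s + (ennreal (2 * M powr (p - 1)) * residual s + ennreal (2 * M powr (p - 1)) * residual s))"
    by (intro mult_left_mono add_mono W D) auto
  also have "\<dots> = ennreal (4 powr p * (1 / lam + 4 * M powr (p - 1))) * residual s"
  proof -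
    have "ennreal (1 / lam + 4 * M powr (p - 1)) = ennreal (1 / lam) + (ennreal (2 * M powr (p - 1)) + ennreal (2 * M powr (p - 1)))"
      using lam by (simp add: ennreal_plus[symmetric] del: ennreal_plus)
    then show ?thesis using lam by (simp only: ennreal_mult' powr_ge_zero distrib_right mult.assoc)
  qed
  finally have Z: "(\<integral>\<^sup>+x\<in>{s..<s + 2}. (\<integral>\<^sup>+y\<in>?S. ennreal (\<bar>G (x + y) + G (x - y)\<bar> powr p) \<partial>lborel) \<partial>lborel) \<le> ennreal (4 powr p * (1 / lam + 4 * M powr (p - 1))) * residual s" .
  have swap: "(\<integral>\<^sup>+x\<in>{s..<s + 2}. (\<integral>\<^sup>+y\<in>?S. ennreal (\<bar>G (x + y) + G (x - y)\<bar> powr p) \<partial>lborel) \<partial>lborel) =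
     (\<integral>\<^sup>+y\<in>?S. (\<integral>\<^sup>+x\<in>{s..<s + 2}. ennreal (\<bar>G (x + y) + G (x - y)\<bar> powr p) \<partial>lborel) \<partial>lborel)"
    by (rule tonelli_rectangle) (auto simp: split_beta')
  have slice: "(\<integral>\<^sup>+x\<in>{s..<s + 2}. ennreal (\<bar>G (x + y) + G (x - y)\<bar> powr p) \<partial>lborel) = (\<integral>\<^sup>+z\<in>{0..<2}. ennreal (\<bar>G (z + 2 * y) + G z\<bar> powr p) \<partial>lborel)" for y
    using set_nn_integral_periodic_affine[of "\<lambda>z. ennreal (\<bar>G (z + 2 * y) + G z\<bar> powr p)", where s = 1 and c = "- y" and a = s]
      Gper Gper[of "_ + 2 * y"] by (simp add: algebra_simps)
  have "circle_energy p G \<le> ennreal ((1 + (2 * 2 powr p) ^ (n + 1)) / \<epsilon>) *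
     (\<integral>\<^sup>+y\<in>?S. (\<integral>\<^sup>+z\<in>{0..<2}. ennreal (\<bar>G (z + 2 * y) + G z\<bar> powr p) \<partial>lborel) \<partial>lborel)"
    unfolding circle_energy_def using p_gt1 by (intro periodic_poincare e n Gper) auto
  also have "\<dots> \<le> ennreal ((1 + (2 * 2 powr p) ^ (n + 1)) / \<epsilon>) * (ennreal (4 powr p * (1 / lam + 4 * M powr (p - 1))) * residual s)"
    by (rule mult_left_mono[OF Z[unfolded swap slice]]) simp
  also have "\<dots> = ennreal ((1 + (2 * 2 powr p) ^ (n + 1)) / \<epsilon> * (4 powr p * (1 / lam + 4 * M powr (p - 1)))) * residual s"
    using e lam by (subst ennreal_mult) (auto simp: mult.assoc)
  finally show ?thesis by (simp add: G_def)
qed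

lemma energy_decreasing:
  assumes "0 \<le> s" "s \<le> t" shows "circle_energy p (g t) \<le> circle_energy p (g s)"
  by (rule order_trans[OF _ energy_dissipation[OF assms]]) simp

lemma energy_finite: "0 \<le> t \<Longrightarrow> circle_energy p (g t) < \<infinity>"
  using energy_decreasing[of 0 t] Lp0 by (auto intro: le_less_trans)

text \<open>
  The coercivity estimate bounds the residual by the energy that is lost, up to an arbitrarily small multiple
  of the energy itself.
\<close>

lemma residual_le_dissipation:
  assumes s: "0 \<le> s" and d: "0 < \<delta>" and C: "0 < C"
    and coercive: "\<And>u v. \<bar>u + v\<bar> powr p \<le>
      \<delta> * (\<bar>u\<bar> powr p + \<bar>v\<bar> powr p) + C * ((signed_powr (p - 1) u + signed_powr (p - 1) v) * (u + v))"
  shows "residual s \<le> ennreal (4 * \<delta> * M) * circle_energy p (g s) +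
    ennreal C * (\<integral>\<^sup>+x\<in>{s..s + 2}. (\<integral>\<^sup>+z\<in>{0..<2}. ennreal (dissipation x z) \<partial>lborel) \<partial>lborel)"
proof -
  have "(\<integral>\<^sup>+z\<in>{0..<2}. ennreal (b x z * \<bar>refl_sum x z\<bar> powr p) \<partial>lborel) \<le>
     ennreal (2 * \<delta> * M) * circle_energy p (g s) + ennreal C * (\<integral>\<^sup>+z\<in>{0..<2}. ennreal (dissipation x z) \<partial>lborel)" if x: "s \<le> x" for x
  proof -
    have "(\<integral>\<^sup>+z\<in>{0..<2}. ennreal (b x z * \<bar>refl_sum x z\<bar> powr p) \<partial>lborel) \<le>
      (\<integral>\<^sup>+z. ennreal (\<delta> * M) * (ennreal (\<bar>g x z\<bar> powr p) * indicator {0..<2} z + ennreal (\<bar>g x (2 * x - z)\<bar> powr p) * indicator {0..<2} z) +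
         ennreal C * (ennreal (dissipation x z) * indicator {0..<2} z) \<partial>lborel)"
    proof (rule nn_integral_mono)
      fix z
      let ?u = "g x z" and ?v = "g x (2 * x - z)"
      have "b x z * \<bar>refl_sum x z\<bar> powr p \<le> b x z * (\<delta> * (\<bar>?u\<bar> powr p + \<bar>?v\<bar> powr p) + C * ((signed_powr (p - 1) ?u + signed_powr (p - 1) ?v) * (?u + ?v)))"
        unfolding refl_sum_def by (intro mult_left_mono coercive b_nonneg)
      also have "\<dots> = b x z * (\<delta> * (\<bar>?u\<bar> powr p + \<bar>?v\<bar> powr p)) + C * dissipation x z"
        by (simp add: dissipation_def refl_sum_def algebra_simps)
      also have "\<dots> \<le> M * (\<delta> * (\<bar>?u\<bar> powr p + \<bar>?v\<bar> powr p)) + C * dissipation x z"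
        using d by (intro add_right_mono mult_right_mono b_le) auto
      finally show "ennreal (b x z * \<bar>refl_sum x z\<bar> powr p) * indicator {0..<2} z \<le>
         ennreal (\<delta> * M) * (ennreal (\<bar>g x z\<bar> powr p) * indicator {0..<2} z + ennreal (\<bar>g x (2 * x - z)\<bar> powr p) * indicator {0..<2} z) +
         ennreal C * (ennreal (dissipation x z) * indicator {0..<2} z)"
        using d C M_pos dissipation_nonneg[of x z]
        by (cases "z \<in> {0..<2}") (simp_all add: ennreal_mult[symmetric] ennreal_plus[symmetric] ennreal_leI mult_ac del: ennreal_plus)
    qed
    also have "\<dots> = ennreal (\<delta> * M) * (circle_energy p (g x) + circle_energy p (g x)) + ennreal C * (\<integral>\<^sup>+z\<in>{0..<2}. ennreal (dissipation x z) \<partial>lborel)"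
      by (simp add: nn_integral_add nn_integral_cmult energy_reflected) (simp add: circle_energy_def)
    also have "\<dots> \<le> ennreal (\<delta> * M) * (circle_energy p (g s) + circle_energy p (g s)) + ennreal C * (\<integral>\<^sup>+z\<in>{0..<2}. ennreal (dissipation x z) \<partial>lborel)"
      using x s by (intro add_right_mono mult_left_mono add_mono energy_decreasing) auto
    also have "ennreal (\<delta> * M) * (circle_energy p (g s) + circle_energy p (g s)) = ennreal (2 * \<delta> * M) * circle_energy p (g s)"
      using d M_pos by (simp add: mult_2[symmetric] ennreal_mult mult_ac)
    finally show ?thesis .
  qed
  then have "residual s \<le> (\<integral>\<^sup>+x. ennreal (2 * \<delta> * M) * circle_energy p (g s) * indicator {s..s + 2} x + ennreal C * ((\<integral>\<^sup>+z\<in>{0..<2}. ennreal (dissipation x z) \<partial>lborel) * indicator {s..s + 2} x) \<partial>lborel)"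
    unfolding residual_def by (intro nn_integral_mono) (auto simp: indicator_def)
  also have "\<dots> = ennreal (2 * \<delta> * M) * circle_energy p (g s) * 2 + ennreal C * (\<integral>\<^sup>+x\<in>{s..s + 2}. (\<integral>\<^sup>+z\<in>{0..<2}. ennreal (dissipation x z) \<partial>lborel) \<partial>lborel)"
    by (subst nn_integral_add, simp, measurable) (simp add: nn_integral_cmult nn_integral_cmult_indicator)
  also have "ennreal (2 * \<delta> * M) * circle_energy p (g s) * 2 = ennreal (4 * \<delta> * M) * circle_energy p (g s)"
  proof -
    have "ennreal (4 * \<delta> * M) = ennreal (2 * (2 * \<delta> * M))" by (rule arg_cong[where f = ennreal]) simp
    also have "\<dots> = 2 * ennreal (2 * \<delta> * M)" using d M_pos by (subst ennreal_mult) auto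
    finally show ?thesis by (simp only: mult_ac)
  qed
  finally show ?thesis .
qed

end

text \<open>
  With \<open>\<delta>\<close> so small that the error term takes at most half of the energy, observability
  and the residual bound give \<open>energy \<le> A * loss\<close>, and therefore the energy after two units
  of time is at most \<open>1 - 1 / A\<close> times the energy before. The constant is chosen before the
  coefficient and the solution.
\<close>

lemma uniform_contraction:
  fixes p M lam \<epsilon> :: real
  assumes p: "1 < p" and M: "0 < M" and lam: "0 < lam" and e: "0 < \<epsilon>"
  shows "\<exists>\<kappa>. 0 < \<kappa> \<and> \<kappa> < 1 \<and> (\<forall>b g x0 s. circle_flow_Lp b M g p \<longrightarrow> 0 \<le> x0 - \<epsilon> \<longrightarrow> x0 + \<epsilon> \<le> 1 \<longrightarrow>
    (\<forall>x y. 0 \<le> x \<longrightarrow> y \<in> {x0 - \<epsilon><..<x0 + \<epsilon>} \<longrightarrow> lam \<le> b x (x + y)) \<longrightarrow> 0 \<le> s \<longrightarrow>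
    circle_energy p (g (s + 2)) \<le> ennreal \<kappa> * circle_energy p (g s))"
proof -
  obtain n :: nat where "1 / \<epsilon> < real n" using reals_Archimedean2 by blast
  then have n: "1 \<le> real n * \<epsilon>" using e by (simp add: field_simps)
  define C3 where "C3 = (1 + (2 * 2 powr p) ^ (n + 1)) / \<epsilon> * (4 powr p * (1 / lam + 4 * M powr (p - 1)))"
  have C3: "0 < C3" unfolding C3_def using e lam by (intro mult_pos_pos divide_pos_pos add_pos_nonneg) auto
  \<comment> \<open>Then \<open>C3 * (4 * \<delta> * M) = 1 / 2\<close>, which leaves half of the energy.\<close>
  define \<delta> where "\<delta> = 1 / (8 * M * C3)"
  have d: "0 < \<delta>" using M C3 by (simp add: \<delta>_def)
  obtain C where C: "0 < C" "\<And>u v. \<bar>u + v\<bar> powr p \<le>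
      \<delta> * (\<bar>u\<bar> powr p + \<bar>v\<bar> powr p) + C * ((signed_powr (p - 1) u + signed_powr (p - 1) v) * (u + v))"
    using powr_coercive[OF p d] by blast
  \<comment> \<open>The maximum with \<open>2\<close> keeps the contraction factor positive.\<close>
  define A where "A = max 2 (2 * C3 * C * (4 / p))"
  have A: "2 \<le> A" by (simp add: A_def)
  show ?thesis
  proof (intro exI[of _ "1 - 1 / A"] conjI allI impI)
    show "0 < 1 - 1 / A" "1 - 1 / A < 1" using A by auto
    fix b g x0 s
    assume flow: "circle_flow_Lp b M g p" and x0: "0 \<le> x0 - \<epsilon>" "x0 + \<epsilon> \<le> 1"
      and strip: "\<forall>x y. 0 \<le> x \<longrightarrow> y \<in> {x0 - \<epsilon><..<x0 + \<epsilon>} \<longrightarrow> lam \<le> b x (x + y)" and s: "0 \<le> (s::real)"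
    interpret circle_flow_Lp b M g p by (rule flow)
    define D where "D = (\<integral>\<^sup>+x\<in>{s..s + 2}. (\<integral>\<^sup>+z\<in>{0..<2}. ennreal (dissipation x z) \<partial>lborel) \<partial>lborel)"
    define e1 e2 where "e1 = enn2real (circle_energy p (g s))" and "e2 = enn2real (circle_energy p (g (s + 2)))"
    have E: "circle_energy p (g s) = ennreal e1" "circle_energy p (g (s + 2)) = ennreal e2"
      using energy_finite[of s] energy_finite[of "s + 2"] s by (auto simp: e1_def e2_def)
    have nn: "0 \<le> e1" "0 \<le> e2" by (auto simp: e1_def e2_def)
    have diss: "ennreal e2 + ennreal (p / 4) * D \<le> ennreal e1"
      using energy_dissipation[of s "s + 2"] s unfolding E D_def by simp
    then have "ennreal (p / 4) * D \<le> ennreal e1" by (rule order_trans[rotated]) simp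
    then have "D \<noteq> top" using p by (auto simp: ennreal_mult_top top_unique)
    then obtain D' where D': "D = ennreal D'" "0 \<le> D'" by (cases D) auto
    have 1: "e2 + p / 4 * D' \<le> e1"
      using diss p nn unfolding D' by (simp add: ennreal_mult[symmetric] ennreal_plus[symmetric] D' del: ennreal_plus)
    have "circle_energy p (g s) \<le> ennreal C3 * residual s"
      unfolding C3_def by (rule observability[OF s lam e x0 n]) (use strip in blast)
    also have "\<dots> \<le> ennreal C3 * (ennreal (4 * \<delta> * M) * circle_energy p (g s) + ennreal C * D)"
      unfolding D_def by (intro mult_left_mono residual_le_dissipation[OF s d C]) auto
    finally have "ennreal e1 \<le> ennreal C3 * (ennreal (4 * \<delta> * M) * ennreal e1 + ennreal C * ennreal D')"
      unfolding E D' .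
    also have "\<dots> = ennreal (C3 * (4 * \<delta> * M * e1 + C * D'))"
      using C3 d M C nn D' by (simp add: ennreal_mult[symmetric] ennreal_plus[symmetric] del: ennreal_plus)
    finally have "e1 \<le> C3 * (4 * \<delta> * M * e1 + C * D')"
      using C3 d M C nn D' by (subst (asm) ennreal_le_iff) auto
    also have "\<dots> = e1 / 2 + C3 * C * D'"
      using M C3 by (simp add: \<delta>_def field_simps)
    finally have "e1 \<le> (2 * C3 * C * (4 / p)) * (p / 4 * D')" using p by simp
    also have "\<dots> \<le> A * (p / 4 * D')" using p D' by (intro mult_right_mono) (auto simp: A_def)
    finally have "e1 / A \<le> p / 4 * D'" using A by (simp add: field_simps)
    moreover have "(1 - 1 / A) * e1 = e1 - e1 / A" by (simp add: left_diff_distrib)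
    ultimately have "e2 \<le> (1 - 1 / A) * e1" using 1 by linarith
    then show "circle_energy p (g (s + 2)) \<le> ennreal (1 - 1 / A) * circle_energy p (g s)"
      unfolding E using A nn by (subst ennreal_mult[symmetric]) (auto intro: ennreal_leI)
  qed
qed

lemma (in circle_flow_Lp) energy_exponential_decay:
  assumes k: "0 < \<kappa>" "\<kappa> < 1"
    and step: "\<And>s. 0 \<le> s \<Longrightarrow> circle_energy p (g (s + 2)) \<le> ennreal \<kappa> * circle_energy p (g s)"
    and t: "0 \<le> t"
  shows "circle_energy p (g t) \<le> ennreal (1 / \<kappa> * exp (ln \<kappa> / 2 * t)) * circle_energy p (g 0)"
proof -
  have iter: "circle_energy p (g (2 * real m)) \<le> ennreal (\<kappa> ^ m) * circle_energy p (g 0)" for m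
  proof (induction m)
    case (Suc m)
    have "circle_energy p (g (2 * real (Suc m))) \<le> ennreal \<kappa> * circle_energy p (g (2 * real m))"
      using step[of "2 * real m"] by (simp add: algebra_simps)
    also have "\<dots> \<le> ennreal \<kappa> * (ennreal (\<kappa> ^ m) * circle_energy p (g 0))"
      by (intro mult_left_mono Suc) auto
    finally show ?case using k by (simp add: ennreal_mult mult.assoc)
  qed simp
  define m where "m = nat \<lfloor>t / 2\<rfloor>"
  have m: "2 * real m \<le> t" "t / 2 - 1 \<le> real m"
    using t unfolding m_def by (auto simp: of_nat_nat) linarith+
  have "circle_energy p (g t) \<le> circle_energy p (g (2 * real m))"
    by (rule energy_decreasing) (use m in auto)
  also have "\<dots> \<le> ennreal (\<kappa> ^ m) * circle_energy p (g 0)" by (rule iter)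
  also have "\<dots> \<le> ennreal (1 / \<kappa> * exp (ln \<kappa> / 2 * t)) * circle_energy p (g 0)"
  proof (intro mult_right_mono ennreal_leI)
    have "\<kappa> ^ m = exp (real m * ln \<kappa>)" using k by (simp add: exp_of_nat_mult)
    also have "\<dots> \<le> exp ((t / 2 - 1) * ln \<kappa>)"
      using m(2) k by (simp add: mult_right_mono_neg)
    also have "\<dots> = exp (ln \<kappa> / 2 * t) / exp (ln \<kappa>)"
      by (simp add: exp_diff[symmetric] algebra_simps)
    finally show "\<kappa> ^ m \<le> 1 / \<kappa> * exp (ln \<kappa> / 2 * t)" using k by simp
  qed auto
  finally show ?thesis .
qed

section \<open>Lebesgue measurable functions and their Borel representatives\<close>

lemma AE_lebesgue_on_iff:
  fixes S :: "'a::euclidean_space set"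
  assumes "S \<in> sets borel"
  shows "(AE x in lebesgue_on S. P x) \<longleftrightarrow> (AE x in lborel. x \<in> S \<longrightarrow> P x)"
  using assms by (simp add: AE_restrict_space_iff AE_completion_iff sets_completionI_sets)

lemma borel_measurable_lebesgue_onI:
  "f \<in> borel_measurable borel \<Longrightarrow> f \<in> borel_measurable (lebesgue_on S)"
  by (intro measurable_restrict_space1 measurable_completion) simp

lemma nn_integral_lebesgue_on:
  fixes S :: "'a::euclidean_space set"
  assumes "S \<in> sets borel"
  shows "(\<integral>\<^sup>+x. f x \<partial>lebesgue_on S) = (\<integral>\<^sup>+x\<in>S. f x \<partial>lborel)"
  using assms by (simp add: nn_integral_restrict_space nn_integral_completion sets_completionI_sets)

lemma borel_representative:
  fixes f :: "'a::euclidean_space \<Rightarrow> real"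
  assumes f: "f \<in> borel_measurable (lebesgue_on S)" and S: "S \<in> sets borel"
  shows "\<exists>h\<in>borel_measurable borel. AE x in lborel. x \<in> S \<longrightarrow> f x = h x"
proof -
  have "(\<lambda>x. indicator S x *\<^sub>R f x) \<in> borel_measurable lebesgue"
    using f S by (subst (asm) borel_measurable_restrict_space_iff) (auto intro: sets_completionI_sets)
  from completion_ex_borel_measurable_real[OF this] obtain h
    where h: "h \<in> borel_measurable lborel" "AE x in lborel. indicator S x *\<^sub>R f x = h x" by blast
  have "AE x in lborel. x \<in> S \<longrightarrow> f x = h x"
    using h(2) by eventually_elim (auto simp: indicator_def split: if_splits)
  with h(1) show ?thesis by auto
qed

text \<open>
  By completeness of the Lebesgue measure, a function that agrees almost everywhere with a measurable one is
  measurable.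
\<close>

lemma LINT_lebesgue_on_eq:
  fixes f h :: "'a::euclidean_space \<Rightarrow> real"
  assumes S: "S \<in> sets borel" and h: "set_borel_measurable lborel S h"
    and eq: "AE x in lborel. x \<in> S \<longrightarrow> f x = h x"
  shows "(LINT x|lebesgue_on S. f x) = (LINT x:S|lborel. h x)"
    and "integrable (lebesgue_on S) f \<longleftrightarrow> set_integrable lborel S h"
proof -
  have hm: "(\<lambda>x. indicator S x *\<^sub>R h x) \<in> borel_measurable lborel"
    using h by (simp add: set_borel_measurable_def)
  have eq': "AE x in lebesgue. indicator S x *\<^sub>R h x = indicator S x *\<^sub>R f x"
    using eq unfolding AE_completion_iff by eventually_elim (auto simp: indicator_def)
  have hl: "(\<lambda>x. indicator S x *\<^sub>R h x) \<in> borel_measurable lebesgue"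
    by (rule measurable_completion[OF hm])
  have fl: "(\<lambda>x. indicator S x *\<^sub>R f x) \<in> borel_measurable lebesgue"
    by (rule borel_measurable_AE[OF hl eq'])
  have S': "S \<inter> space lebesgue \<in> sets lebesgue" using S by (auto intro: sets_completionI_sets)
  have "(LINT x|lebesgue_on S. f x) = (LINT x|lebesgue. indicator S x *\<^sub>R f x)"
    by (rule integral_restrict_space[OF S'])
  also have "\<dots> = (LINT x|lebesgue. indicator S x *\<^sub>R h x)"
    by (rule integral_cong_AE[OF fl hl]) (use eq' in \<open>eventually_elim, auto\<close>)
  also have "\<dots> = (LINT x|lborel. indicator S x *\<^sub>R h x)"
    by (rule integral_completion[OF hm])
  finally show "(LINT x|lebesgue_on S. f x) = (LINT x:S|lborel. h x)"
    by (simp add: set_lebesgue_integral_def)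
  have "integrable (lebesgue_on S) f \<longleftrightarrow> integrable lebesgue (\<lambda>x. indicator S x *\<^sub>R f x)"
    using S' by (rule integrable_restrict_space)
  also have "\<dots> \<longleftrightarrow> integrable lebesgue (\<lambda>x. indicator S x *\<^sub>R h x)"
    by (rule integrable_cong_AE[OF fl hl]) (use eq' in \<open>eventually_elim, auto\<close>)
  also have "\<dots> \<longleftrightarrow> set_integrable lborel S h"
    unfolding set_integrable_def by (rule integrable_completion[OF hm])
  finally show "integrable (lebesgue_on S) f \<longleftrightarrow> set_integrable lborel S h" .
qed

section \<open>Null sets along characteristics\<close>

text \<open>
  Shearing \<open>(s, c) \<mapsto> (s, c + \<sigma> * s)\<close> preserves the area, so a null set of the
  plane meets almost every characteristic in a null set.
\<close>

lemma AE_lborel_shear: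
  fixes R :: "real \<Rightarrow> real \<Rightarrow> bool"
  assumes R: "AE z in lborel. R (fst z) (snd z)" and \<sigma>: "\<sigma> = 1 \<or> \<sigma> = -1"
  shows "AE c in lborel. AE s in lborel. R s (c + \<sigma> * s)"
proof -
  from R obtain N where N: "{z \<in> space lborel. \<not> R (fst z) (snd z)} \<subseteq> N" "emeasure lborel N = 0" "N \<in> sets lborel"
    by (rule AE_E)
  have NR: "R s y" if "(s, y) \<notin> N" for s y
  proof (rule ccontr)
    assume "\<not> R s y"
    then have "(s, y) \<in> {z \<in> space lborel. \<not> R (fst z) (snd z)}" by simp
    with N(1) that show False by blast
  qed
  have Nm: "N \<in> sets (borel \<Otimes>\<^sub>M borel)" using N(3) unfolding borel_prod by simp
  have [measurable]: "(\<lambda>x. indicator N (f x) :: ennreal) \<in> borel_measurable K"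
    if "f \<in> K \<rightarrow>\<^sub>M borel \<Otimes>\<^sub>M borel" for f and K :: "'k measure"
    using measurable_compose[OF that borel_measurable_indicator[OF Nm]] by simp
  have "(\<integral>\<^sup>+c. (\<integral>\<^sup>+s. indicator N (s, c + \<sigma> * s) \<partial>lborel) \<partial>lborel) =
      (\<integral>\<^sup>+s. (\<integral>\<^sup>+c. indicator N (s, c + \<sigma> * s) \<partial>lborel) \<partial>lborel)"
    by (rule lborel_pair.Fubini') (simp add: split_beta')
  also have "\<dots> = (\<integral>\<^sup>+s. (\<integral>\<^sup>+c. indicator N (s, c) \<partial>lborel) \<partial>lborel)"
    by (intro nn_integral_cong nn_integral_shift) measurable
  also have "\<dots> = (\<integral>\<^sup>+z. indicator N z \<partial>(lborel \<Otimes>\<^sub>M lborel))"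
    using Nm by (intro lborel.nn_integral_fst) simp
  also have "\<dots> = emeasure lborel N"
    using N(3) by (simp add: lborel_prod)
  finally have "(\<integral>\<^sup>+c. (\<integral>\<^sup>+s. indicator N (s, c + \<sigma> * s) \<partial>lborel) \<partial>lborel) = 0" using N by simp
  then have "AE c in lborel. (\<integral>\<^sup>+s. indicator N (s, c + \<sigma> * s) \<partial>lborel) = (0::ennreal)"
    by (subst (asm) nn_integral_0_iff_AE) auto
  then show ?thesis
  proof eventually_elim
    case (elim c)
    then have "AE s in lborel. indicator N (s, c + \<sigma> * s) = (0::ennreal)"
      by (subst (asm) nn_integral_0_iff_AE) auto
    then show ?case
      by eventually_elim (use NR in \<open>auto simp: indicator_def split: if_splits\<close>)
  qed
qed

text \<open>
  On each line of constant time the map \<open>x \<mapsto> x + \<sigma> * t\<close> is a translation, which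
  preserves null sets.
\<close>

lemma AE_lborel_pair_shear:
  fixes P :: "real \<Rightarrow> bool"
  assumes P: "AE c in lborel. P c" and \<sigma>: "\<sigma> = 1 \<or> \<sigma> = -1"
  shows "AE z in lborel. P (snd z + \<sigma> * fst z)"
proof -
  from P obtain N where N: "{c \<in> space lborel. \<not> P c} \<subseteq> N" "emeasure lborel N = 0" "N \<in> sets lborel"
    by (rule AE_E)
  have [measurable]: "N \<in> sets borel" using N(3) by simp
  have "(\<integral>\<^sup>+z. indicator N (snd z + \<sigma> * fst z) \<partial>(lborel \<Otimes>\<^sub>M lborel)) =
      (\<integral>\<^sup>+t. (\<integral>\<^sup>+x. indicator N (x + \<sigma> * t) \<partial>lborel) \<partial>lborel)"
    by (subst lborel.nn_integral_fst[symmetric]) auto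
  also have "\<dots> = integral\<^sup>N lborel (\<lambda>t::real. (\<integral>\<^sup>+x. indicator N x \<partial>lborel))"
    by (intro nn_integral_cong nn_integral_shift) measurable
  also have "\<dots> = 0" using N by simp
  finally have "AE z in lborel \<Otimes>\<^sub>M lborel. indicator N (snd z + \<sigma> * fst z) = (0::ennreal)"
    by (subst (asm) nn_integral_0_iff_AE) auto
  then show ?thesis
    unfolding lborel_prod by eventually_elim (use N(1) in \<open>auto simp: indicator_def split: if_splits\<close>)
qed

lemma AE_lborel_Pair:
  fixes R :: "real \<Rightarrow> real \<Rightarrow> bool"
  assumes "AE z in lborel. R (fst z) (snd z)"
  shows "AE t in lborel. AE x in lborel. R t x"
  using lborel_pair.AE_pair[of "\<lambda>z. R (fst z) (snd z)"] assms unfolding lborel_prod by simp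

section \<open>From the circle to broad solutions\<close>

lemma Lp_pair_norm_eq:
  assumes S: "S \<in> sets borel" and u: "u \<in> borel_measurable (lebesgue_on S)" and v: "v \<in> borel_measurable (lebesgue_on S)"
  shows "Lp_pair_norm p S u v =
    enn2real ((\<integral>\<^sup>+x\<in>S. ennreal (\<bar>u x\<bar> powr p) \<partial>lborel) + (\<integral>\<^sup>+x\<in>S. ennreal (\<bar>v x\<bar> powr p) \<partial>lborel)) powr (1 / p)"
proof -
  have "(LINT x|lebesgue_on S. \<bar>u x\<bar> powr p + \<bar>v x\<bar> powr p) =
      enn2real (\<integral>\<^sup>+x. ennreal (\<bar>u x\<bar> powr p + \<bar>v x\<bar> powr p) \<partial>lebesgue_on S)"
    by (rule integral_eq_nn_integral) (use u v in auto)
  also have "(\<integral>\<^sup>+x. ennreal (\<bar>u x\<bar> powr p + \<bar>v x\<bar> powr p) \<partial>lebesgue_on S) =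
     (\<integral>\<^sup>+x. ennreal (\<bar>u x\<bar> powr p) \<partial>lebesgue_on S) + (\<integral>\<^sup>+x. ennreal (\<bar>v x\<bar> powr p) \<partial>lebesgue_on S)"
    using u v by (subst nn_integral_add[symmetric]) (auto simp: ennreal_plus)
  finally show ?thesis
    by (simp add: Lp_pair_norm_def nn_integral_lebesgue_on[OF S])
qed

lemma Lp_spaceI:
  assumes S: "S \<in> sets borel" and u: "u \<in> borel_measurable borel"
    and fin: "(\<integral>\<^sup>+x\<in>S. ennreal (\<bar>u x\<bar> powr p) \<partial>lborel) < \<infinity>"
  shows "u \<in> Lp_space p S"
proof -
  have m: "u \<in> borel_measurable (lebesgue_on S)" by (rule borel_measurable_lebesgue_onI[OF u])
  have "integrable (lebesgue_on S) (\<lambda>x. \<bar>u x\<bar> powr p)"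
    by (rule integrableI_nonneg) (use m fin in \<open>auto simp: nn_integral_lebesgue_on[OF S]\<close>)
  with m show ?thesis by (simp add: Lp_space_def)
qed

lemma moving_slice_Lp:
  fixes P u :: "real \<Rightarrow> real \<Rightarrow> real"
  assumes p: "1 \<le> p" and I: "bounded I" and c: "c = 1 \<or> c = -1"
    and P[measurable]: "\<And>r. P r \<in> borel_measurable borel"
    and E[measurable]: "E \<in> borel_measurable borel"
    and bd: "\<And>r z. r \<in> I \<Longrightarrow> \<bar>P r z\<bar> \<le> E z"
    and fin: "\<And>R. (\<integral>\<^sup>+z\<in>{- R..R}. ennreal (E z powr p) \<partial>lborel) < \<infinity>"
    and cont: "\<And>z. continuous_on I (\<lambda>r. P r z)"
    and S: "S \<in> sets borel" "S \<subseteq> {0..L}" and u: "\<And>r w. r \<in> I \<Longrightarrow> w \<in> S \<Longrightarrow> u r w = P r (w + c * r)"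
    and r0: "r0 \<in> I"
  shows "(\<integral>\<^sup>+w\<in>S. ennreal (\<bar>u r0 w\<bar> powr p) \<partial>lborel) < \<infinity>"
    and "((\<lambda>r. \<integral>\<^sup>+w\<in>S. ennreal (\<bar>u r w - u r0 w\<bar> powr p) \<partial>lborel) \<longlongrightarrow> 0) (at r0 within I)"
proof -
  define R where "R = \<bar>L\<bar> + \<bar>r0\<bar>"
  have "(\<integral>\<^sup>+w\<in>S. ennreal (\<bar>u r0 w\<bar> powr p) \<partial>lborel) \<le>
      (\<integral>\<^sup>+w. ennreal (E (w + c * r0) powr p) * indicator {- R..R} (w + c * r0) \<partial>lborel)"
  proof (rule nn_integral_mono)
    fix w
    show "ennreal (\<bar>u r0 w\<bar> powr p) * indicator S w \<le> ennreal (E (w + c * r0) powr p) * indicator {- R..R} (w + c * r0)"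
    proof (cases "w \<in> S")
      case True
      then have "w + c * r0 \<in> {- R..R}" using S(2) c by (auto simp: R_def abs_if split: if_splits)
      moreover have "\<bar>u r0 w\<bar> powr p \<le> E (w + c * r0) powr p"
        using bd[OF r0] u[OF r0 True] p by (intro powr_mono2) auto
      ultimately show ?thesis using True by (simp add: ennreal_leI)
    qed simp
  qed
  also have "\<dots> = (\<integral>\<^sup>+z\<in>{- R..R}. ennreal (E z powr p) \<partial>lborel)"
    by (rule nn_integral_shift[of "\<lambda>z. ennreal (E z powr p) * indicator {- R..R} z"]) auto
  also have "\<dots> < \<infinity>" by (rule fin)
  finally show "(\<integral>\<^sup>+w\<in>S. ennreal (\<bar>u r0 w\<bar> powr p) \<partial>lborel) < \<infinity>" .
  show "((\<lambda>r. \<integral>\<^sup>+w\<in>S. ennreal (\<bar>u r w - u r0 w\<bar> powr p) \<partial>lborel) \<longlongrightarrow> 0) (at r0 within I)"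
  proof (rule tendsto_sandwich[OF _ _ tendsto_const tendsto_moving_slice[OF p I r0 c P E bd fin cont, of L]])
    show "\<forall>\<^sub>F r in at r0 within I. (\<integral>\<^sup>+w\<in>S. ennreal (\<bar>u r w - u r0 w\<bar> powr p) \<partial>lborel) \<le>
       (\<integral>\<^sup>+w\<in>{0..L}. ennreal (\<bar>P r (w + c * r) - P r0 (w + c * r0)\<bar> powr p) \<partial>lborel)"
      unfolding eventually_at_filter
      using S(2) u r0 by (intro always_eventually allI impI nn_integral_mono) (auto simp: indicator_def)
  qed auto
qed

lemma continuous_into_Lp_pairI:
  assumes p: "0 < p" and S: "S \<in> sets borel"
    and m: "\<And>r. r \<in> I \<Longrightarrow> u r \<in> borel_measurable borel" "\<And>r. r \<in> I \<Longrightarrow> v r \<in> borel_measurable borel"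
    and fin: "\<And>r. r \<in> I \<Longrightarrow> (\<integral>\<^sup>+x\<in>S. ennreal (\<bar>u r x\<bar> powr p) \<partial>lborel) < \<infinity>"
      "\<And>r. r \<in> I \<Longrightarrow> (\<integral>\<^sup>+x\<in>S. ennreal (\<bar>v r x\<bar> powr p) \<partial>lborel) < \<infinity>"
    and lim: "\<And>r0. r0 \<in> I \<Longrightarrow> ((\<lambda>r. \<integral>\<^sup>+x\<in>S. ennreal (\<bar>u r x - u r0 x\<bar> powr p) \<partial>lborel) \<longlongrightarrow> 0) (at r0 within I)"
      "\<And>r0. r0 \<in> I \<Longrightarrow> ((\<lambda>r. \<integral>\<^sup>+x\<in>S. ennreal (\<bar>v r x - v r0 x\<bar> powr p) \<partial>lborel) \<longlongrightarrow> 0) (at r0 within I)"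
  shows "continuous_into_Lp_pair p I S u v"
  unfolding continuous_into_Lp_pair_def
proof (intro conjI ballI)
  fix r0 assume r0: "r0 \<in> I"
  show "u r0 \<in> Lp_space p S" "v r0 \<in> Lp_space p S" using r0 by (auto intro!: Lp_spaceI S m fin)
  let ?X = "\<lambda>r. (\<integral>\<^sup>+x\<in>S. ennreal (\<bar>u r x - u r0 x\<bar> powr p) \<partial>lborel) + (\<integral>\<^sup>+x\<in>S. ennreal (\<bar>v r x - v r0 x\<bar> powr p) \<partial>lborel)"
  have "(?X \<longlongrightarrow> 0 + 0) (at r0 within I)" by (intro tendsto_add lim r0)
  then have "((\<lambda>r. enn2real (?X r)) \<longlongrightarrow> enn2real (0 + 0)) (at r0 within I)"
    by (intro tendsto_enn2real) auto
  then have "((\<lambda>r. enn2real (?X r) powr (1 / p)) \<longlongrightarrow> 0) (at r0 within I)"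
    by (intro tendsto_zero_powrI[OF _ tendsto_const]) (use p in auto)
  then show "((\<lambda>s. Lp_pair_norm p S (\<lambda>y. u s y - u r0 y) (\<lambda>y. v s y - v r0 y)) \<longlongrightarrow> 0) (at r0 within I)"
  proof (rule Lim_transform_eventually)
    show "\<forall>\<^sub>F r in at r0 within I. enn2real (?X r) powr (1 / p) = Lp_pair_norm p S (\<lambda>y. u r y - u r0 y) (\<lambda>y. v r y - v r0 y)"
      unfolding eventually_at_filter
      by (intro always_eventually allI impI Lp_pair_norm_eq[symmetric] S borel_measurable_lebesgue_onI borel_measurable_diff m r0)
  qed
qed

context circle_flow_Lp
begin

lemma g_continuous: "continuous_on {0..T} (\<lambda>t. g t z)"
proof (cases "0 \<le> T")
  case True
  show ?thesis
    by (rule powr_growth(1)[OF p_gt1 True rate_integrable[OF order_refl, of T z]]) (rule g_increment)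
qed simp

text \<open>
  For the traces at fixed \<open>x\<close> the time argument is clipped to \<open>[0, T]\<close>. It lies
  there for all points that occur in the trace itself, but not after the translation that compares two traces.
\<close>

lemma solution_space_of_flow:
  assumes T: "0 < T"
  shows "solution_space p T (\<lambda>t x. g t (x + t)) (\<lambda>t x. - g t (t - x))"
  unfolding solution_space_def
proof (intro conjI)
  obtain E where E: "E \<in> borel_measurable borel" "\<And>t z. t \<in> {0..T} \<Longrightarrow> \<bar>g t z\<bar> \<le> E z"
    "\<And>R. (\<integral>\<^sup>+z\<in>{- R..R}. ennreal (E z powr p) \<partial>lborel) < \<infinity>"
    using envelope[of T] by blast
  note [measurable] = E(1)
  have fin': "(\<integral>\<^sup>+z\<in>{- R..R}. ennreal (E (- z) powr p) \<partial>lborel) < \<infinity>" for R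
  proof -
    have "(\<integral>\<^sup>+z\<in>{- R..R}. ennreal (E z powr p) \<partial>lborel) =
      ennreal \<bar>-1\<bar> * (\<integral>\<^sup>+z. ennreal (E (0 + -1 * z) powr p) * indicator {- R..R} (0 + -1 * z) \<partial>lborel)"
      by (rule nn_integral_real_affine) auto
    also have "\<dots> = (\<integral>\<^sup>+z\<in>{- R..R}. ennreal (E (- z) powr p) \<partial>lborel)"
      by (simp, intro nn_integral_cong) (auto simp: indicator_def)
    finally show ?thesis using E(3)[of R] by simp
  qed
  show "(\<lambda>(t, x). g t (x + t)) \<in> borel_measurable (lebesgue_on ({0<..<T} \<times> {0<..<1}))"
    "(\<lambda>(t, x). - g t (t - x)) \<in> borel_measurable (lebesgue_on ({0<..<T} \<times> {0<..<1}))"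
    by (intro borel_measurable_lebesgue_onI; simp add: split_beta' borel_prod[symmetric])+
  note E3 = E(3)[unfolded infinity_ennreal_def] and E3' = fin'[unfolded infinity_ennreal_def]
  have p1: "1 \<le> p" "0 < p" using p_gt1 by auto
  note slices = moving_slice_Lp[OF p1(1)]
  define clip where "clip t = max 0 (min T t)" for t
  have clip: "clip t \<in> {0..T}" for t using T by (auto simp: clip_def)
  have clip_id: "clip t = t" if "t \<in> {0<..<T}" for t using that by (auto simp: clip_def)
  have [measurable]: "clip \<in> borel_measurable borel" unfolding clip_def[abs_def] by measurable
  have clip_cont: "continuous_on I (\<lambda>r. g (clip (h r)) z)" if "continuous_on I h" for I h z
  proof (rule continuous_on_compose2[OF g_continuous[of T z]])
    show "continuous_on I (\<lambda>r. clip (h r))" unfolding clip_def by (intro continuous_intros that)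
  qed (use clip in auto)
  show "continuous_into_Lp_pair p {0..T} {0<..<1} (\<lambda>t x. g t (x + t)) (\<lambda>t x. - g t (t - x))"
  proof (rule continuous_into_Lp_pairI[OF p1(2)])
    note S1 = slices[where I = "{0..T}" and S = "{0<..<1}" and L = 1 and c = 1 and P = g and E = E
        and u = "\<lambda>t x. g t (x + t)"]
    note S2 = slices[where I = "{0..T}" and S = "{0<..<1}" and L = 1 and c = "-1" and P = "\<lambda>r z. - g r (- z)" and E = "\<lambda>z. E (- z)"
        and u = "\<lambda>t x. - g t (t - x)"]
    fix r assume r: "r \<in> {0..T}"
    show "(\<integral>\<^sup>+x\<in>{0<..<1}. ennreal (\<bar>g r (x + r)\<bar> powr p) \<partial>lborel) < \<infinity>"
      "((\<lambda>s. \<integral>\<^sup>+x\<in>{0<..<1}. ennreal (\<bar>g s (x + s) - g r (x + r)\<bar> powr p) \<partial>lborel) \<longlongrightarrow> 0) (at r within {0..T})"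
      using r E3 by (intro S1; simp add: E g_continuous subset_iff)+
    show "(\<integral>\<^sup>+x\<in>{0<..<1}. ennreal (\<bar>- g r (r - x)\<bar> powr p) \<partial>lborel) < \<infinity>"
      "((\<lambda>s. \<integral>\<^sup>+x\<in>{0<..<1}. ennreal (\<bar>- g s (s - x) - - g r (r - x)\<bar> powr p) \<partial>lborel) \<longlongrightarrow> 0) (at r within {0..T})"
      using r E3' by (intro S2; simp add: E g_continuous continuous_on_minus subset_iff)+
  qed auto
  show "continuous_into_Lp_pair p {0..1} {0<..<T} (\<lambda>x t. g t (x + t)) (\<lambda>x t. - g t (t - x))"
  proof (rule continuous_into_Lp_pairI[OF p1(2)])
    note S1 = slices[where I = "{0..1}" and S = "{0<..<T}" and L = T and c = 1 and P = "\<lambda>r z. g (clip (z - r)) z" and E = E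
        and u = "\<lambda>x t. g t (x + t)"]
    note S2 = slices[where I = "{0..1}" and S = "{0<..<T}" and L = T and c = "-1" and P = "\<lambda>r z. - g (clip (z + r)) z" and E = E
        and u = "\<lambda>x t. - g t (t - x)"]
    fix r :: real assume r: "r \<in> {0..1}"
    show "(\<integral>\<^sup>+t\<in>{0<..<T}. ennreal (\<bar>g t (r + t)\<bar> powr p) \<partial>lborel) < \<infinity>"
      "((\<lambda>s. \<integral>\<^sup>+t\<in>{0<..<T}. ennreal (\<bar>g t (s + t) - g t (r + t)\<bar> powr p) \<partial>lborel) \<longlongrightarrow> 0) (at r within {0..1})"
      using r clip E3 by (intro S1; simp add: E clip_cont clip_id add.commute subset_iff continuous_intros)+
    show "(\<integral>\<^sup>+t\<in>{0<..<T}. ennreal (\<bar>- g t (t - r)\<bar> powr p) \<partial>lborel) < \<infinity>"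
      "((\<lambda>s. \<integral>\<^sup>+t\<in>{0<..<T}. ennreal (\<bar>- g t (t - s) - - g t (t - r)\<bar> powr p) \<partial>lborel) \<longlongrightarrow> 0) (at r within {0..1})"
      using r clip E3 by (intro S2; simp add: E clip_cont clip_id subset_iff continuous_intros continuous_on_minus)+
  qed auto
qed

end

lemma rectangle_borel: "{0<..<T::real} \<times> {0<..<1::real} \<in> sets borel"
  by (intro borel_open open_Times) auto

text \<open>
  The circle is cut open at \<open>-1\<close>; its two halves carry the two components of the system.
\<close>

lemma circle_energy_split:
  assumes f[measurable]: "f \<in> borel_measurable borel" and per: "\<And>z. f (z + 2) = f z"
  shows "circle_energy p f = (\<integral>\<^sup>+x\<in>{0<..<1}. ennreal (\<bar>f x\<bar> powr p) \<partial>lborel) + (\<integral>\<^sup>+x\<in>{0<..<1}. ennreal (\<bar>f (- x)\<bar> powr p) \<partial>lborel)"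
proof -
  let ?q = "\<lambda>y. ennreal (\<bar>f y\<bar> powr p)"
  have "(\<integral>\<^sup>+x\<in>{0<..<1}. ?q (- x) \<partial>lborel) = ennreal \<bar>-1\<bar> * (\<integral>\<^sup>+x. ?q (- (0 + -1 * x)) * indicator {0<..<1} (0 + -1 * x) \<partial>lborel)"
    by (rule nn_integral_real_affine) auto
  also have "\<dots> = (\<integral>\<^sup>+x\<in>{-1<..<0}. ?q x \<partial>lborel)"
    by simp (intro nn_integral_cong, auto simp: indicator_def)
  finally have refl: "(\<integral>\<^sup>+x\<in>{0<..<1}. ?q (- x) \<partial>lborel) = (\<integral>\<^sup>+x\<in>{-1<..<0}. ?q x \<partial>lborel)" .
  have "(\<integral>\<^sup>+x\<in>{0<..<1}. ?q x \<partial>lborel) + (\<integral>\<^sup>+x\<in>{0<..<1}. ?q (- x) \<partial>lborel) =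
     (\<integral>\<^sup>+x. ?q x * indicator {0<..<1} x + ?q x * indicator {-1<..<0} x \<partial>lborel)"
    unfolding refl by (rule nn_integral_add[symmetric]) auto
  also have "\<dots> = (\<integral>\<^sup>+x\<in>{-1..<-1 + 2}. ?q x \<partial>lborel)"
  proof (rule nn_integral_cong_AE)
    show "AE x in lborel. ?q x * indicator {0<..<1} x + ?q x * indicator {-1<..<0} x = ?q x * indicator {-1..<-1 + 2} x"
      using AE_lborel_singleton[of "0::real"] AE_lborel_singleton[of "-1::real"]
      by eventually_elim (auto simp: indicator_def)
  qed
  also have "\<dots> = circle_energy p f"
    unfolding circle_energy_def by (rule set_nn_integral_periodic_window) (auto simp: per)
  finally show ?thesis by simp
qed

context circle_flow_Lp
begin

text \<open>
  Each of the four characteristic rules is the integrated equation for \<open>g\<close> along one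
  characteristic, started at time zero or at the time when the characteristic left the boundary.
\<close>

lemma broad_solution_of_flow:
  assumes a: "AE z in lborel. 0 < fst z \<and> snd z \<in> {0<..<1} \<longrightarrow> a (fst z) (snd z) = b (fst z) (snd z + fst z)"
    and rho0: "AE x in lborel. x \<in> {0<..<1} \<longrightarrow> \<rho>0 x = g 0 x"
    and xi0: "AE x in lborel. x \<in> {0<..<1} \<longrightarrow> \<xi>0 x = - g 0 (- x)"
  shows "broad_solution p a \<rho>0 \<xi>0 (\<lambda>t x. g t (x + t)) (\<lambda>t x. - g t (t - x))"
proof -
  define R where "R s y \<longleftrightarrow> (0 < s \<and> y \<in> {0<..<1} \<longrightarrow> a s y = b s (y + s))" for s y
  have R: "AE z in lborel. R (fst z) (snd z)" using a by (simp add: R_def)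
  have ae1: "AE z in lborel. AE s in lborel. R s (snd z + 1 * fst z + - 1 * s)"
    by (rule AE_lborel_pair_shear[of "\<lambda>c. AE s in lborel. R s (c + - 1 * s)"]) (use AE_lborel_shear[OF R, where \<sigma> = "-1"] in auto)
  have ae2: "AE z in lborel. AE s in lborel. R s (snd z + - 1 * fst z + 1 * s)"
    by (rule AE_lborel_pair_shear[of "\<lambda>c. AE s in lborel. R s (c + 1 * s)"]) (use AE_lborel_shear[OF R, where \<sigma> = 1] in auto)
  have ae3: "AE z in lborel. snd z + 1 * fst z \<in> {0<..<1} \<longrightarrow> \<rho>0 (snd z + 1 * fst z) = g 0 (snd z + 1 * fst z)"
    by (rule AE_lborel_pair_shear[OF rho0]) simp
  have ae4: "AE z in lborel. snd z + - 1 * fst z \<in> {0<..<1} \<longrightarrow> \<xi>0 (snd z + - 1 * fst z) = - g 0 (- (snd z + - 1 * fst z))"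
    by (rule AE_lborel_pair_shear[OF xi0]) simp
  have sbm: "set_borel_measurable lborel {r..t} (\<lambda>s. c * (b s z * refl_sum s z))" for r t z c
    unfolding set_borel_measurable_def by measurable
  have Lrho: "(LINT s|lebesgue_on {r..t}. - (1 / 2) * a s (x + t - s) * (g s (x + t - s + s) - - g s (s - (x + t - s)))) =
      g t (x + t) - g r (x + t)"
    if r: "0 \<le> r" "r \<le> t" "0 < x" "x + t - r \<le> 1" and ae: "AE s in lborel. R s (x + t + - 1 * s)" for r t x
  proof -
    have "(LINT s|lebesgue_on {r..t}. - (1 / 2) * a s (x + t - s) * (g s (x + t - s + s) - - g s (s - (x + t - s)))) =
       (LINT s:{r..t}|lborel. - 1 / 2 * (b s (x + t) * refl_sum s (x + t)))"
    proof (rule LINT_lebesgue_on_eq(1)[OF _ sbm])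
      show "AE s in lborel. s \<in> {r..t} \<longrightarrow> - (1 / 2) * a s (x + t - s) * (g s (x + t - s + s) - - g s (s - (x + t - s)))
         = - 1 / 2 * (b s (x + t) * refl_sum s (x + t))"
        using ae AE_lborel_singleton[of r]
      proof eventually_elim
        case (elim s)
        show ?case
        proof
          assume "s \<in> {r..t}"
          then have eq: "a s (x + t - s) = b s (x + t)" using elim r by (simp add: R_def)
          have e: "s - (x + t - s) = 2 * s - (x + t)" "x + t - s + s = x + t" by simp_all
          show "- (1 / 2) * a s (x + t - s) * (g s (x + t - s + s) - - g s (s - (x + t - s)))
            = - 1 / 2 * (b s (x + t) * refl_sum s (x + t))" unfolding e eq refl_sum_def by simp
        qed
      qed
    qed simp
    then show ?thesis using g_increment[OF r(1,2), of "x + t"] by simp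
  qed
  have Lxi: "(LINT s|lebesgue_on {r..t}. (1 / 2) * a s (x - t + s) * (g s (x - t + s + s) - - g s (s - (x - t + s)))) =
      - g t (t - x) + g r (t - x)"
    if r: "0 \<le> r" "r \<le> t" "x < 1" "0 \<le> x - t + r" and ae: "AE s in lborel. R s (x + - 1 * t + 1 * s)" for r t x
  proof -
    have "(LINT s|lebesgue_on {r..t}. (1 / 2) * a s (x - t + s) * (g s (x - t + s + s) - - g s (s - (x - t + s)))) =
       (LINT s:{r..t}|lborel. 1 / 2 * (b s (t - x) * refl_sum s (t - x)))"
    proof (rule LINT_lebesgue_on_eq(1)[OF _ sbm])
      show "AE s in lborel. s \<in> {r..t} \<longrightarrow> (1 / 2) * a s (x - t + s) * (g s (x - t + s + s) - - g s (s - (x - t + s)))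
         = 1 / 2 * (b s (t - x) * refl_sum s (t - x))"
        using ae AE_lborel_singleton[of r]
      proof eventually_elim
        case (elim s)
        show ?case
        proof
          assume s: "s \<in> {r..t}"
          have "a s (x - t + s) = b s (x - t + s + s)" using elim r s by (simp add: R_def)
          also have "x - t + s + s = 2 * s - (t - x)" by simp
          finally have eq: "a s (x - t + s) = b s (t - x)" by (simp add: b_refl)
          have e: "s - (x - t + s) = t - x" "x - t + s + s = 2 * s - (t - x)" by simp_all
          show "(1 / 2) * a s (x - t + s) * (g s (x - t + s + s) - - g s (s - (x - t + s)))
            = 1 / 2 * (b s (t - x) * refl_sum s (t - x))" unfolding e eq refl_sum_def by simp
        qed
      qed
    qed simp
    also have "\<dots> = - (LINT s:{r..t}|lborel. - 1 / 2 * (b s (t - x) * refl_sum s (t - x)))"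
      using set_integral_mult_right[of lborel "{r..t}" "- 1 / 2" "\<lambda>s. b s (t - x) * refl_sum s (t - x)"]
        set_integral_mult_right[of lborel "{r..t}" "1 / 2" "\<lambda>s. b s (t - x) * refl_sum s (t - x)"] by simp
    finally show ?thesis using g_increment[OF r(1,2), of "t - x"] by simp
  qed
  have rules: "characteristic_rules T a \<rho>0 \<xi>0 (\<lambda>t x. g t (x + t)) (\<lambda>t x. - g t (t - x))" for T
    unfolding characteristic_rules_def Let_def AE_lebesgue_on_iff[OF rectangle_borel]
    using ae1 ae2 ae3 ae4
  proof eventually_elim
    case (elim z)
    obtain t x where z: "z = (t, x)" by (cases z)
    note el = elim[unfolded z fst_conv snd_conv]
    show ?case
      unfolding z prod.case
    proof (intro impI conjI)
      assume "(t, x) \<in> {0<..<T} \<times> {0<..<1}"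
      then have tx: "0 < t" "0 < x" "x < 1" by auto
      {
        assume lt: "x + t < 1"
        show "g t (x + t) = \<rho>0 (x + t) +
          (LINT s|lebesgue_on {0..t}. - (1 / 2) * a s (x + t - s) * (g s (x + t - s + s) - - g s (s - (x + t - s))))"
          using Lrho[of 0 t x] el(1,3) tx lt by simp
      next
        assume gt: "1 < x + t"
        show "g t (x + t) = g (t + x - 1) (1 + (t + x - 1)) +
          (LINT s|lebesgue_on {t + x - 1..t}. - (1 / 2) * a s (x + t - s) * (g s (x + t - s + s) - - g s (s - (x + t - s))))"
          using Lrho[of "t + x - 1" t x] el(1) tx gt by (simp add: add.commute)
      next
        assume lt: "t < x"
        show "- g t (t - x) = \<xi>0 (x - t) +
          (LINT s|lebesgue_on {0..t}. 1 / 2 * a s (x - t + s) * (g s (x - t + s + s) - - g s (s - (x - t + s))))"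
          by (subst Lxi) (use el(2,4) tx lt in auto)
      next
        assume gt: "x < t"
        show "- g t (t - x) = - g (t - x) (t - x - 0) +
          (LINT s|lebesgue_on {t - x..t}. 1 / 2 * a s (x - t + s) * (g s (x - t + s + s) - - g s (s - (x - t + s))))"
          by (subst Lxi) (use el(2) tx gt in auto)
      }
    qed
  qed
  have "AE x in lebesgue_on {0<..<1}. g 0 (x + 0) = \<rho>0 x \<and> - g 0 (0 - x) = \<xi>0 x"
    using rho0 xi0 by (subst AE_lebesgue_on_iff) auto
  moreover have "g t (1 + t) = g t (t - 1)" for t using g_per[of t "t - 1"] by (simp add: algebra_simps)
  ultimately show ?thesis
    unfolding broad_solution_def broad_solution_on_def
    using solution_space_of_flow rules by auto
qed

lemma Lp_pair_norm_of_flow: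
  "Lp_pair_norm p {0<..<1} (\<lambda>x. g t (x + t)) (\<lambda>x. - g t (t - x)) = enn2real (circle_energy p (g t)) powr (1 / p)"
proof -
  have "circle_energy p (\<lambda>z. g t (z + t)) = circle_energy p (g t)"
    unfolding circle_energy_def
    by (rule circle_integral_shift[of "\<lambda>z. ennreal (\<bar>g t z\<bar> powr p)"]) (auto simp: g_per)
  moreover have "g t (z + 2 + t) = g t (z + t)" for z
    using g_per[of t "z + t"] by (simp add: add_ac)
  then have "circle_energy p (\<lambda>z. g t (z + t)) =
      (\<integral>\<^sup>+x\<in>{0<..<1}. ennreal (\<bar>g t (x + t)\<bar> powr p) \<partial>lborel) + (\<integral>\<^sup>+x\<in>{0<..<1}. ennreal (\<bar>g t (- x + t)\<bar> powr p) \<partial>lborel)"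
    by (intro circle_energy_split) auto
  ultimately show ?thesis
    by (subst Lp_pair_norm_eq) (auto intro!: borel_measurable_lebesgue_onI simp: add.commute[of "- _"])
qed

end

section \<open>Continuous curves in \<open>L\<^sup>1\<close>\<close>

definition L1_norm :: "real set \<Rightarrow> (real \<Rightarrow> real) \<Rightarrow> ennreal" where
  "L1_norm S f = (\<integral>\<^sup>+x. ennreal \<bar>f x\<bar> \<partial>lebesgue_on S)"

definition continuous_into_L1 :: "real set \<Rightarrow> real set \<Rightarrow> (real \<Rightarrow> real \<Rightarrow> real) \<Rightarrow> bool" where
  "continuous_into_L1 I S u \<longleftrightarrow> (\<forall>r\<in>I. u r \<in> borel_measurable (lebesgue_on S) \<and> L1_norm S (u r) < \<infinity> \<and>
     ((\<lambda>s. L1_norm S (\<lambda>x. u s x - u r x)) \<longlongrightarrow> 0) (at r within I))"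

lemma L1_norm_triangle:
  assumes [measurable]: "f \<in> borel_measurable (lebesgue_on S)" "h \<in> borel_measurable (lebesgue_on S)"
  shows "L1_norm S (\<lambda>x. f x + h x) \<le> L1_norm S f + L1_norm S h"
proof -
  have "L1_norm S (\<lambda>x. f x + h x) \<le> (\<integral>\<^sup>+x. ennreal \<bar>f x\<bar> + ennreal \<bar>h x\<bar> \<partial>lebesgue_on S)"
    unfolding L1_norm_def by (intro nn_integral_mono) (simp flip: ennreal_plus add: ennreal_leI)
  also have "\<dots> = L1_norm S f + L1_norm S h"
    unfolding L1_norm_def by (rule nn_integral_add) auto
  finally show ?thesis .
qed

lemma L1_norm_diff_commute: "L1_norm S (\<lambda>x. f x - h x) = L1_norm S (\<lambda>x. h x - f x)"
  by (simp add: L1_norm_def abs_minus_commute)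

lemma continuous_into_L1_diff:
  assumes u: "continuous_into_L1 I S u" and v: "continuous_into_L1 I S v"
  shows "continuous_into_L1 I S (\<lambda>r x. u r x - v r x)"
  unfolding continuous_into_L1_def
proof (intro ballI conjI)
  fix r assume r: "r \<in> I"
  have m: "u s \<in> borel_measurable (lebesgue_on S)" "v s \<in> borel_measurable (lebesgue_on S)" if "s \<in> I" for s
    using u v that by (auto simp: continuous_into_L1_def)
  note [measurable] = m[OF r]
  show "(\<lambda>x. u r x - v r x) \<in> borel_measurable (lebesgue_on S)" by measurable
  have "L1_norm S (\<lambda>x. u r x - v r x) \<le> L1_norm S (u r) + L1_norm S (\<lambda>x. - v r x)"
    using L1_norm_triangle[of "u r" S "\<lambda>x. - v r x"] by simp
  also have "\<dots> < \<infinity>" using u v r by (auto simp: continuous_into_L1_def L1_norm_def)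
  finally show "L1_norm S (\<lambda>x. u r x - v r x) < \<infinity>" .
  have "((\<lambda>s. L1_norm S (\<lambda>x. u s x - u r x) + L1_norm S (\<lambda>x. v r x - v s x)) \<longlongrightarrow> 0 + 0) (at r within I)"
    using u v r unfolding L1_norm_diff_commute[of S "v r"] by (intro tendsto_add) (auto simp: continuous_into_L1_def)
  then show "((\<lambda>s. L1_norm S (\<lambda>x. u s x - v s x - (u r x - v r x))) \<longlongrightarrow> 0) (at r within I)"
    unfolding add_0
  proof (rule tendsto_sandwich[OF _ _ tendsto_const, rotated 2])
    show "\<forall>\<^sub>F s in at r within I. L1_norm S (\<lambda>x. u s x - v s x - (u r x - v r x)) \<le>
        L1_norm S (\<lambda>x. u s x - u r x) + L1_norm S (\<lambda>x. v r x - v s x)"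
      unfolding eventually_at_filter
    proof (intro always_eventually allI impI)
      fix s assume "s \<in> I"
      note [measurable] = m[OF this]
      have "L1_norm S (\<lambda>x. (u s x - u r x) + (v r x - v s x)) \<le>
        L1_norm S (\<lambda>x. u s x - u r x) + L1_norm S (\<lambda>x. v r x - v s x)"
        by (rule L1_norm_triangle) measurable
      then show "L1_norm S (\<lambda>x. u s x - v s x - (u r x - v r x)) \<le>
        L1_norm S (\<lambda>x. u s x - u r x) + L1_norm S (\<lambda>x. v r x - v s x)"
        by (simp add: algebra_simps)
    qed
  qed auto
qed

text \<open>
  This serves to carry a bound that is known for the slices at almost every parameter over to a given trace.
\<close>

lemma continuous_into_L1_limit_bound:
  assumes u: "continuous_into_L1 I S u" and r: "r \<in> I"
    and near: "\<And>d. 0 < d \<Longrightarrow> \<exists>s\<in>I. s \<noteq> r \<and> \<bar>s - r\<bar> < d \<and> L1_norm S (u s) \<le> B"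
  shows "L1_norm S (u r) \<le> B"
proof (rule ennreal_le_epsilon)
  fix e :: real assume e: "0 < e"
  have "((\<lambda>s. L1_norm S (\<lambda>x. u s x - u r x)) \<longlongrightarrow> 0) (at r within I)" using u r by (simp add: continuous_into_L1_def)
  then have "\<forall>\<^sub>F s in at r within I. L1_norm S (\<lambda>x. u s x - u r x) < ennreal e"
    by (rule order_tendstoD(2)) (use e in simp)
  then obtain d where d: "0 < d" "\<And>s. s \<in> I \<Longrightarrow> s \<noteq> r \<Longrightarrow> \<bar>s - r\<bar> < d \<Longrightarrow> L1_norm S (\<lambda>x. u s x - u r x) < ennreal e"
    unfolding eventually_at dist_real_def by blast
  from near[OF d(1)] obtain s where s: "s \<in> I" "s \<noteq> r" "\<bar>s - r\<bar> < d" "L1_norm S (u s) \<le> B" by blast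
  have [measurable]: "u s \<in> borel_measurable (lebesgue_on S)" "u r \<in> borel_measurable (lebesgue_on S)"
    using u r s by (auto simp: continuous_into_L1_def)
  have "L1_norm S (u r) = L1_norm S (\<lambda>x. u s x + (u r x - u s x))" by simp
  also have "\<dots> \<le> L1_norm S (u s) + L1_norm S (\<lambda>x. u r x - u s x)"
    by (rule L1_norm_triangle) measurable
  also have "\<dots> \<le> B + ennreal e"
    using s d(2)[OF s(1-3)] by (intro add_mono) (auto simp: L1_norm_diff_commute[of S "u r"] less_imp_le)
  finally show "L1_norm S (u r) \<le> B + ennreal e" .
qed

lemma continuous_into_L1_bounded:
  assumes u: "continuous_into_L1 {0..T} S u"
  shows "\<exists>C<\<infinity>. \<forall>r\<in>{0..T}. L1_norm S (u r) \<le> C"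
proof -
  define \<phi> where "\<phi> r = enn2real (L1_norm S (u r))" for r
  have fin: "L1_norm S (u r) < \<infinity>" and m[measurable]: "u r \<in> borel_measurable (lebesgue_on S)" if "r \<in> {0..T}" for r
    using u that by (auto simp: continuous_into_L1_def)
  have eq: "L1_norm S (u r) = ennreal (\<phi> r)" if "r \<in> {0..T}" for r
    using fin[OF that] by (simp add: \<phi>_def)
  have nn: "0 \<le> \<phi> r" for r by (simp add: \<phi>_def)
  have "continuous_on {0..T} \<phi>"
    unfolding continuous_on_def
  proof
    fix r assume r: "r \<in> {0..T}"
    let ?\<psi> = "\<lambda>s. L1_norm S (\<lambda>x. u s x - u r x)"
    have lim: "(?\<psi> \<longlongrightarrow> 0) (at r within {0..T})" using u r by (simp add: continuous_into_L1_def)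
    then have lim': "((\<lambda>s. enn2real (?\<psi> s)) \<longlongrightarrow> 0) (at r within {0..T})"
      using lim by (intro tendsto_enn2real) simp_all
    have "\<forall>\<^sub>F s in at r within {0..T}. ?\<psi> s < 1" by (rule order_tendstoD(2)[OF lim]) simp
    then have ev: "\<forall>\<^sub>F s in at r within {0..T}. norm (\<phi> s - \<phi> r) \<le> enn2real (?\<psi> s)"
      unfolding eventually_at_filter
    proof eventually_elim
      case (elim s)
      show ?case
      proof (intro impI)
        assume s: "s \<noteq> r" "s \<in> {0..T}"
        then have "?\<psi> s < 1" using elim by blast
        then obtain q where q: "?\<psi> s = ennreal q" "0 \<le> q" by (cases "?\<psi> s") auto
        note [measurable] = m[OF s(2)] m[OF r]
        have "L1_norm S (\<lambda>x. u r x + (u s x - u r x)) \<le> L1_norm S (u r) + ?\<psi> s"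
          by (rule L1_norm_triangle) measurable
        then have 1: "\<phi> s \<le> \<phi> r + q" using nn q eq[OF r] eq[OF s(2)] by (simp flip: ennreal_plus)
        have "L1_norm S (\<lambda>x. u s x + (u r x - u s x)) \<le> L1_norm S (u s) + L1_norm S (\<lambda>x. u r x - u s x)"
          by (rule L1_norm_triangle) measurable
        then have 2: "\<phi> r \<le> \<phi> s + q" using nn q eq[OF r] eq[OF s(2)]
          by (simp add: L1_norm_diff_commute[of S "u r"] flip: ennreal_plus)
        show "norm (\<phi> s - \<phi> r) \<le> enn2real (?\<psi> s)" using 1 2 q by simp
      qed
    qed
    have "((\<lambda>s. \<phi> s - \<phi> r) \<longlongrightarrow> 0) (at r within {0..T})"
      by (rule Lim_null_comparison[OF ev lim'])
    then show "(\<phi> \<longlongrightarrow> \<phi> r) (at r within {0..T})" by (rule LIM_zero_cancel)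
  qed
  then have "bounded (\<phi> ` {0..T})" by (intro compact_imp_bounded compact_continuous_image) auto
  then obtain C where C: "\<And>r. r \<in> {0..T} \<Longrightarrow> \<phi> r \<le> C"
    by (metis bounded_iff image_eqI real_norm_def abs_ge_self order_trans)
  then show ?thesis by (intro exI[of _ "ennreal C"]) (auto simp: eq ennreal_leI)
qed

text \<open>
  On a set of finite measure \<open>V\<close> the pointwise estimate
  \<open>\<bar>d\<bar> \<le> \<eta> + \<eta> powr (1 - p) * \<bar>d\<bar> powr p\<close> bounds the
  \<open>L\<^sup>1\<close>-norm; with the \<open>L\<^sup>p\<close>-norm \<open>n\<close> in the place of
  \<open>\<eta>\<close> the bound is \<open>n * (V + 1)\<close>.
\<close>

lemma continuous_into_Lp_imp_L1:
  assumes p: "1 < p" and S: "S \<in> sets borel" "emeasure lborel S < \<infinity>"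
    and uv: "continuous_into_Lp_pair p I S u v"
  shows "continuous_into_L1 I S u" "continuous_into_L1 I S v"
proof -
  have swap: "Lp_pair_norm p S f h = Lp_pair_norm p S h f" for f h
    by (simp add: Lp_pair_norm_def add.commute)
  have vu: "continuous_into_Lp_pair p I S v u"
    using uv unfolding continuous_into_Lp_pair_def by (subst swap) auto
  have main: "continuous_into_L1 I S u" if uv: "continuous_into_Lp_pair p I S u v" for u v
    unfolding continuous_into_L1_def
  proof (intro ballI conjI)
    fix r assume r: "r \<in> I"
    have Lp: "u s \<in> borel_measurable (lebesgue_on S)" "v s \<in> borel_measurable (lebesgue_on S)"
      "(\<integral>\<^sup>+x. ennreal (\<bar>u s x\<bar> powr p) \<partial>lebesgue_on S) < \<infinity>" "(\<integral>\<^sup>+x. ennreal (\<bar>v s x\<bar> powr p) \<partial>lebesgue_on S) < \<infinity>" if "s \<in> I" for s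
      using uv that by (auto simp: continuous_into_Lp_pair_def Lp_space_def integrable_iff_bounded)
    define V where "V = enn2real (emeasure lborel S)"
    have V: "emeasure (lebesgue_on S) S = ennreal V" "0 \<le> V"
      using S by (auto simp: V_def emeasure_restrict_space sets_completionI_sets)
    have young: "L1_norm S f \<le> ennreal (\<eta> * V) + ennreal (\<eta> powr (1 - p)) * (\<integral>\<^sup>+x. ennreal (\<bar>f x\<bar> powr p) \<partial>lebesgue_on S)"
      if \<eta>: "0 < \<eta>" and [measurable]: "f \<in> borel_measurable (lebesgue_on S)" for \<eta> f
    proof -
      have "L1_norm S f \<le> (\<integral>\<^sup>+x. ennreal \<eta> + ennreal (\<eta> powr (1 - p)) * ennreal (\<bar>f x\<bar> powr p) \<partial>lebesgue_on S)"
        unfolding L1_norm_def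
      proof (rule nn_integral_mono)
        fix x
        have "\<bar>f x\<bar> \<le> \<eta> + \<eta> powr (1 - p) * \<bar>f x\<bar> powr p"
        proof (cases "\<bar>f x\<bar> \<le> \<eta>")
          case False
          then have "\<bar>f x\<bar> = \<bar>f x\<bar> powr (1 - p) * \<bar>f x\<bar> powr p" using \<eta> by (simp flip: powr_add)
          also have "\<dots> \<le> \<eta> powr (1 - p) * \<bar>f x\<bar> powr p"
            using False \<eta> p by (intro mult_right_mono powr_mono2') auto
          finally show ?thesis using \<eta> by simp
        qed (simp add: add_increasing2)
        then show "ennreal \<bar>f x\<bar> \<le> ennreal \<eta> + ennreal (\<eta> powr (1 - p)) * ennreal (\<bar>f x\<bar> powr p)"
          using \<eta> by (simp add: ennreal_mult[symmetric] ennreal_plus[symmetric] ennreal_leI del: ennreal_plus)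
      qed
      also have "\<dots> = ennreal (\<eta> * V) + ennreal (\<eta> powr (1 - p)) * (\<integral>\<^sup>+x. ennreal (\<bar>f x\<bar> powr p) \<partial>lebesgue_on S)"
        using \<eta> V by (subst nn_integral_add) (auto simp: nn_integral_cmult ennreal_mult)
      finally show ?thesis .
    qed
    note [measurable] = Lp(1)[OF r] Lp(2)[OF r]
    show "u r \<in> borel_measurable (lebesgue_on S)" by measurable
    have "L1_norm S (u r) \<le> ennreal (1 * V) + ennreal (1 powr (1 - p)) * (\<integral>\<^sup>+x. ennreal (\<bar>u r x\<bar> powr p) \<partial>lebesgue_on S)"
      by (rule young) auto
    also have "\<dots> < \<infinity>" using Lp(3)[OF r] by simp
    finally show "L1_norm S (u r) < \<infinity>" .
    define n where "n s = Lp_pair_norm p S (\<lambda>y. u s y - u r y) (\<lambda>y. v s y - v r y)" for s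
    have n0: "(n \<longlongrightarrow> 0) (at r within I)" using uv r by (simp add: continuous_into_Lp_pair_def n_def[abs_def])
    have "L1_norm S (\<lambda>x. u s x - u r x) \<le> ennreal (n s * (V + 1))" if s: "s \<in> I" for s
    proof -
      note [measurable] = Lp(1)[OF s] Lp(2)[OF s]
      let ?X = "\<integral>\<^sup>+x. ennreal (\<bar>u s x - u r x\<bar> powr p) \<partial>lebesgue_on S"
      let ?Y = "\<integral>\<^sup>+x. ennreal (\<bar>v s x - v r x\<bar> powr p) \<partial>lebesgue_on S"
      have fin: "(\<integral>\<^sup>+x. ennreal (\<bar>f x - h x\<bar> powr p) \<partial>lebesgue_on S) < \<infinity>"
        if [measurable]: "f \<in> borel_measurable (lebesgue_on S)" "h \<in> borel_measurable (lebesgue_on S)"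
          and "(\<integral>\<^sup>+x. ennreal (\<bar>f x\<bar> powr p) \<partial>lebesgue_on S) < \<infinity>" "(\<integral>\<^sup>+x. ennreal (\<bar>h x\<bar> powr p) \<partial>lebesgue_on S) < \<infinity>" for f h
      proof -
        have "(\<integral>\<^sup>+x. ennreal (\<bar>f x - h x\<bar> powr p) \<partial>lebesgue_on S) \<le>
          (\<integral>\<^sup>+x. ennreal (2 powr p) * (ennreal (\<bar>f x\<bar> powr p) + ennreal (\<bar>h x\<bar> powr p)) \<partial>lebesgue_on S)"
          using abs_diff_powr_le[of p] p
          by (intro nn_integral_mono) (simp add: ennreal_mult[symmetric] ennreal_plus[symmetric] ennreal_leI del: ennreal_plus)
        also have "\<dots> < \<infinity>" using that by (simp add: nn_integral_cmult nn_integral_add ennreal_mult_less_top)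
        finally show ?thesis .
      qed
      have XY: "?X < \<infinity>" "?Y < \<infinity>" by (intro fin Lp r s)+
      have ns: "n s = enn2real (?X + ?Y) powr (1 / p)"
        unfolding n_def by (subst Lp_pair_norm_eq) (auto simp: S nn_integral_lebesgue_on)
      have "?X \<le> ?X + ?Y" by simp
      also have "\<dots> = ennreal (enn2real (?X + ?Y))" using XY by simp
      also have "enn2real (?X + ?Y) = n s powr p" unfolding ns using p by (simp add: powr_powr)
      finally have X: "?X \<le> ennreal (n s powr p)" .
      have nn: "0 \<le> n s" by (simp add: ns)
      show ?thesis
      proof (cases "n s = 0")
        case True
        then have "?X = 0" using X p by simp
        then have "AE x in lebesgue_on S. ennreal (\<bar>u s x - u r x\<bar> powr p) = 0"
          by (subst (asm) nn_integral_0_iff_AE) auto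
        then have "AE x in lebesgue_on S. ennreal \<bar>u s x - u r x\<bar> = 0"
          by eventually_elim (auto simp: ennreal_eq_0_iff)
        then have "L1_norm S (\<lambda>x. u s x - u r x) = 0"
          unfolding L1_norm_def by (subst nn_integral_0_iff_AE) auto
        then show ?thesis by simp
      next
        case False
        have "L1_norm S (\<lambda>x. u s x - u r x) \<le> ennreal (n s * V) + ennreal (n s powr (1 - p)) * ?X"
          by (rule young) (use False nn in auto)
        also have "\<dots> \<le> ennreal (n s * V) + ennreal (n s powr (1 - p)) * ennreal (n s powr p)"
          by (intro add_left_mono mult_left_mono X) auto
        also have "\<dots> = ennreal (n s * V + n s powr (1 - p) * n s powr p)"
          using nn V by (simp add: ennreal_mult[symmetric] ennreal_plus[symmetric] del: ennreal_plus)
        also have "n s powr (1 - p) * n s powr p = n s" using nn by (simp flip: powr_add)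
        finally show ?thesis by (simp add: distrib_left)
      qed
    qed
    then have ev: "\<forall>\<^sub>F s in at r within I. L1_norm S (\<lambda>x. u s x - u r x) \<le> ennreal (n s * (V + 1))"
      by (auto simp: eventually_at_filter)
    have "((\<lambda>s. ennreal (n s * (V + 1))) \<longlongrightarrow> ennreal (0 * (V + 1))) (at r within I)"
      by (intro tendsto_ennrealI tendsto_intros n0)
    then have lim0: "((\<lambda>s. ennreal (n s * (V + 1))) \<longlongrightarrow> 0) (at r within I)" by simp
    show "((\<lambda>s. L1_norm S (\<lambda>x. u s x - u r x)) \<longlongrightarrow> 0) (at r within I)"
      by (rule tendsto_sandwich[OF _ ev tendsto_const lim0]) simp
  qed
  show "continuous_into_L1 I S u" "continuous_into_L1 I S v" using main[OF uv] main[OF vu] by auto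
qed

section \<open>Transport inequalities in \<open>L\<^sup>1\<close>\<close>

lemma AE_lborel_reflect:
  fixes R :: "real \<Rightarrow> real \<Rightarrow> bool"
  assumes R: "AE z in lborel. R (fst z) (snd z)"
  shows "AE z in lborel. R (fst z) (1 - snd z)"
proof -
  from R obtain N where N: "{z \<in> space lborel. \<not> R (fst z) (snd z)} \<subseteq> N" "emeasure lborel N = 0" "N \<in> sets lborel"
    by (rule AE_E)
  have NR: "R s y" if "(s, y) \<notin> N" for s y
  proof (rule ccontr)
    assume "\<not> R s y"
    then have "(s, y) \<in> {z \<in> space lborel. \<not> R (fst z) (snd z)}" by simp
    with N(1) that show False by blast
  qed
  have Nm: "N \<in> sets (borel \<Otimes>\<^sub>M borel)" using N(3) unfolding borel_prod by simp
  have [measurable]: "(\<lambda>x. indicator N (f x) :: ennreal) \<in> borel_measurable K"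
    if "f \<in> K \<rightarrow>\<^sub>M borel \<Otimes>\<^sub>M borel" for f and K :: "'k measure"
    using measurable_compose[OF that borel_measurable_indicator[OF Nm]] by simp
  have "(\<integral>\<^sup>+z. indicator N (fst z, 1 - snd z) \<partial>(lborel \<Otimes>\<^sub>M lborel)) =
      (\<integral>\<^sup>+t. (\<integral>\<^sup>+x. indicator N (t, 1 - x) \<partial>lborel) \<partial>lborel)"
    by (subst lborel.nn_integral_fst[symmetric]) auto
  also have "\<dots> = (\<integral>\<^sup>+t. (\<integral>\<^sup>+x. indicator N (t, x) \<partial>lborel) \<partial>lborel)"
  proof (rule nn_integral_cong)
    fix t
    show "(\<integral>\<^sup>+x. indicator N (t, 1 - x) \<partial>lborel) = (\<integral>\<^sup>+x. indicator N (t, x) \<partial>lborel)"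
      using nn_integral_real_affine[of "\<lambda>x. indicator N (t, x)" "-1" 1] by simp
  qed
  also have "\<dots> = (\<integral>\<^sup>+z. indicator N z \<partial>(lborel \<Otimes>\<^sub>M lborel))"
    using Nm by (intro lborel.nn_integral_fst) simp
  also have "\<dots> = emeasure lborel N"
    unfolding lborel_prod using N(3) by simp
  finally have "(\<integral>\<^sup>+z. indicator N (fst z, 1 - snd z) \<partial>(lborel \<Otimes>\<^sub>M lborel)) = 0" using N(2) by simp
  then have "AE z in lborel \<Otimes>\<^sub>M lborel. indicator N (fst z, 1 - snd z) = (0::ennreal)"
    by (subst (asm) nn_integral_0_iff_AE) auto
  then show ?thesis
    unfolding lborel_prod by eventually_elim (use NR in \<open>auto simp: indicator_def split: if_splits\<close>)
qed

lemma AE_lborel_swap: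
  fixes R :: "real \<Rightarrow> real \<Rightarrow> bool"
  assumes R: "AE z in lborel. R (fst z) (snd z)"
  shows "AE z in lborel. R (snd z) (fst z)"
proof -
  have "AE z in distr (lborel \<Otimes>\<^sub>M lborel) (lborel \<Otimes>\<^sub>M lborel) (\<lambda>(x, y). (y, x)). R (fst z) (snd z)"
    using R unfolding lborel_pair.distr_pair_swap[symmetric] unfolding lborel_prod .
  from AE_distrD[OF measurable_pair_swap' this]
  show ?thesis unfolding lborel_prod by (simp add: split_beta')
qed

lemma AE_finite_along_characteristic:
  fixes k :: "real \<Rightarrow> real \<Rightarrow> ennreal"
  assumes k: "case_prod k \<in> borel_measurable (borel \<Otimes>\<^sub>M borel)"
    and fin: "(\<integral>\<^sup>+s. (\<integral>\<^sup>+y. k s y \<partial>lborel) \<partial>lborel) < \<infinity>"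
  shows "AE c in lborel. (\<integral>\<^sup>+s. k s (c + s) \<partial>lborel) < \<infinity>"
proof -
  note [measurable (raw)] = measurable_binary[OF k]
  have "(\<integral>\<^sup>+c. (\<integral>\<^sup>+s. k s (c + s) \<partial>lborel) \<partial>lborel) = (\<integral>\<^sup>+s. (\<integral>\<^sup>+c. k s (c + s) \<partial>lborel) \<partial>lborel)"
    by (rule lborel_pair.Fubini') measurable
  also have "\<dots> = (\<integral>\<^sup>+s. (\<integral>\<^sup>+c. k s c \<partial>lborel) \<partial>lborel)"
    by (intro nn_integral_cong nn_integral_shift) measurable
  finally have "(\<integral>\<^sup>+c. (\<integral>\<^sup>+s. k s (c + s) \<partial>lborel) \<partial>lborel) \<noteq> \<infinity>" using fin by simp
  from nn_integral_noteq_infinite[OF _ this]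
  have "AE c in lborel. (\<integral>\<^sup>+s. k s (c + s) \<partial>lborel) \<noteq> \<infinity>" by measurable
  then show ?thesis by eventually_elim (simp add: top.not_eq_extremum)
qed

text \<open>
  Two families that obey the same characteristic rule, with the same initial profile \<open>\<phi>\<close>,
  differ at a point at most by the difference of their values on the inflow boundary and by the accumulated
  difference of the sources. For \<open>t < x\<close> the characteristic comes from the initial line and
  \<open>\<beta>\<close> is taken at a negative time, where it will be zero; thus a single formula covers both
  kinds of characteristics.
\<close>

lemma transport_difference:
  fixes \<eta> \<eta>' H H' hb hb' :: "real \<Rightarrow> real \<Rightarrow> real" and k :: "real \<Rightarrow> real \<Rightarrow> ennreal"
  assumes rule: "AE z in lborel. z \<in> {0<..<T} \<times> {0<..<1} \<longrightarrow> (case z of (t, x) \<Rightarrow>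
      (t < x \<longrightarrow> \<eta> t x = \<phi> (x - t) + (LINT s|lebesgue_on {0..t}. H s (x - t + s))) \<and>
      (x < t \<longrightarrow> \<eta> t x = \<eta> (t - x) 0 + (LINT s|lebesgue_on {t - x..t}. H s (x - t + s))))"
    and rule': "AE z in lborel. z \<in> {0<..<T} \<times> {0<..<1} \<longrightarrow> (case z of (t, x) \<Rightarrow>
      (t < x \<longrightarrow> \<eta>' t x = \<phi> (x - t) + (LINT s|lebesgue_on {0..t}. H' s (x - t + s))) \<and>
      (x < t \<longrightarrow> \<eta>' t x = \<eta>' (t - x) 0 + (LINT s|lebesgue_on {t - x..t}. H' s (x - t + s))))"
    and hb: "case_prod hb \<in> borel_measurable (borel \<Otimes>\<^sub>M borel)" "case_prod hb' \<in> borel_measurable (borel \<Otimes>\<^sub>M borel)"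
    and hbint: "(\<integral>\<^sup>+s. (\<integral>\<^sup>+y. ennreal \<bar>hb s y\<bar> \<partial>lborel) \<partial>lborel) < \<infinity>" "(\<integral>\<^sup>+s. (\<integral>\<^sup>+y. ennreal \<bar>hb' s y\<bar> \<partial>lborel) \<partial>lborel) < \<infinity>"
    and eq: "AE z in lborel. z \<in> {0<..<T} \<times> {0<..<1} \<longrightarrow> H (fst z) (snd z) = hb (fst z) (snd z) \<and>
        H' (fst z) (snd z) = hb' (fst z) (snd z) \<and> ennreal \<bar>hb (fst z) (snd z) - hb' (fst z) (snd z)\<bar> \<le> k (fst z) (snd z)"
    and \<beta>: "AE \<tau> in lborel. \<tau> \<in> {0<..<T} \<longrightarrow> ennreal \<bar>\<eta> \<tau> 0 - \<eta>' \<tau> 0\<bar> \<le> \<beta> \<tau>"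
  shows "AE z in lborel. z \<in> {0<..<T} \<times> {0<..<1} \<longrightarrow>
    ennreal \<bar>\<eta> (fst z) (snd z) - \<eta>' (fst z) (snd z)\<bar> \<le>
      \<beta> (fst z - snd z) + (\<integral>\<^sup>+s\<in>{..fst z}. k s (snd z - fst z + s) \<partial>lborel)"
proof -
  let ?\<Omega> = "{0<..<T} \<times> {0<..<1::real}"
  note [measurable (raw)] = measurable_binary[OF hb(1)] measurable_binary[OF hb(2)]
  define R where "R s y \<longleftrightarrow> ((s, y) \<in> ?\<Omega> \<longrightarrow> H s y = hb s y \<and> H' s y = hb' s y \<and> ennreal \<bar>hb s y - hb' s y\<bar> \<le> k s y)" for s y
  have "AE z in lborel. R (fst z) (snd z)"
    using eq by eventually_elim (auto simp: R_def)
  from AE_lborel_shear[OF this, of 1] have 1: "AE c in lborel. AE s in lborel. R s (c + s)" by simp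
  have 2: "AE c in lborel. (\<integral>\<^sup>+s. ennreal \<bar>hb s (c + s)\<bar> \<partial>lborel) < \<infinity>"
    by (rule AE_finite_along_characteristic[OF _ hbint(1)]) (simp add: split_beta')
  have 3: "AE c in lborel. (\<integral>\<^sup>+s. ennreal \<bar>hb' s (c + s)\<bar> \<partial>lborel) < \<infinity>"
    by (rule AE_finite_along_characteristic[OF _ hbint(2)]) (simp add: split_beta')
  define good where "good c \<longleftrightarrow> (AE s in lborel. R s (c + s)) \<and> (\<integral>\<^sup>+s. ennreal \<bar>hb s (c + s)\<bar> \<partial>lborel) < \<infinity> \<and>
      (\<integral>\<^sup>+s. ennreal \<bar>hb' s (c + s)\<bar> \<partial>lborel) < \<infinity>" for c
  have good: "AE c in lborel. good c" using 1 2 3 by eventually_elim (simp add: good_def)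
  have ae1: "AE z in lborel. good (snd z + - 1 * fst z)"
    by (rule AE_lborel_pair_shear[OF good]) simp
  have ae2: "AE z in lborel. - (snd z + - 1 * fst z) \<in> {0<..<T} \<longrightarrow>
     ennreal \<bar>\<eta> (- (snd z + - 1 * fst z)) 0 - \<eta>' (- (snd z + - 1 * fst z)) 0\<bar> \<le> \<beta> (- (snd z + - 1 * fst z))"
  proof (rule AE_lborel_pair_shear[of "\<lambda>c. - c \<in> {0<..<T} \<longrightarrow> ennreal \<bar>\<eta> (- c) 0 - \<eta>' (- c) 0\<bar> \<le> \<beta> (- c)"])
    from \<beta> obtain N where N: "{\<tau> \<in> space lborel. \<not> (\<tau> \<in> {0<..<T} \<longrightarrow> ennreal \<bar>\<eta> \<tau> 0 - \<eta>' \<tau> 0\<bar> \<le> \<beta> \<tau>)} \<subseteq> N"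
      "emeasure lborel N = 0" "N \<in> sets lborel" by (rule AE_E)
    have [measurable]: "N \<in> sets borel" using N by simp
    have "(\<integral>\<^sup>+c. indicator N (- c) \<partial>lborel) = (\<integral>\<^sup>+c. indicator N c \<partial>lborel)"
      using nn_integral_real_affine[of "indicator N" "-1" 0] by simp
    then have "AE c in lborel. indicator N (- c) = (0::ennreal)"
      using N by (subst nn_integral_0_iff_AE[symmetric]) auto
    then show "AE c in lborel. - c \<in> {0<..<T} \<longrightarrow> ennreal \<bar>\<eta> (- c) 0 - \<eta>' (- c) 0\<bar> \<le> \<beta> (- c)"
    proof eventually_elim
      case (elim c)
      have NR: "\<tau> \<in> {0<..<T} \<longrightarrow> ennreal \<bar>\<eta> \<tau> 0 - \<eta>' \<tau> 0\<bar> \<le> \<beta> \<tau>" if "\<tau> \<notin> N" for \<tau>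
        using N(1) that by auto
      from elim have "- c \<notin> N" by (auto simp: indicator_def split: if_splits)
      then show ?case by (rule NR)
    qed
  qed simp
  have ae3: "AE z in lborel. snd z + - 1 * fst z \<noteq> (0::real)"
  proof (rule AE_lborel_pair_shear[of "\<lambda>c. c \<noteq> 0"])
    show "AE c in lborel. c \<noteq> (0::real)" by (rule AE_lborel_singleton)
  qed simp
  have seg: "ennreal \<bar>(LINT s|lebesgue_on {r..t}. H s (c + s)) - (LINT s|lebesgue_on {r..t}. H' s (c + s))\<bar> \<le>
      (\<integral>\<^sup>+s\<in>{..t}. k s (c + s) \<partial>lborel)"
    if c: "good c" and r: "0 \<le> r" "t < T" "0 \<le> c + r" "c + t < 1" for c r t
  proof -
    have mb: "set_borel_measurable lborel {r..t} (\<lambda>s. hb s (c + s))" "set_borel_measurable lborel {r..t} (\<lambda>s. hb' s (c + s))"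
      unfolding set_borel_measurable_def by measurable
    have in\<Omega>: "(s, c + s) \<in> ?\<Omega>" if "s \<in> {r..t}" "s \<noteq> r" for s
      using that r by auto
    have aeR: "AE s in lborel. s \<in> {r..t} \<longrightarrow> H s (c + s) = hb s (c + s) \<and> H' s (c + s) = hb' s (c + s) \<and> ennreal \<bar>hb s (c + s) - hb' s (c + s)\<bar> \<le> k s (c + s)"
      using c[unfolded good_def, THEN conjunct1] AE_lborel_singleton[of r]
      by eventually_elim (use in\<Omega> in \<open>auto simp: R_def\<close>)
    have L: "(LINT s|lebesgue_on {r..t}. H s (c + s)) = (LINT s:{r..t}|lborel. hb s (c + s))"
      by (rule LINT_lebesgue_on_eq(1)[OF _ mb(1)]) (use aeR in \<open>auto elim: eventually_mono\<close>)
    have L': "(LINT s|lebesgue_on {r..t}. H' s (c + s)) = (LINT s:{r..t}|lborel. hb' s (c + s))"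
      by (rule LINT_lebesgue_on_eq(1)[OF _ mb(2)]) (use aeR in \<open>auto elim: eventually_mono\<close>)
    have int: "set_integrable lborel {r..t} (\<lambda>s. q s (c + s))"
      if q: "case_prod q \<in> borel_measurable (borel \<Otimes>\<^sub>M borel)" "(\<integral>\<^sup>+s. ennreal \<bar>q s (c + s)\<bar> \<partial>lborel) < \<infinity>" for q :: "real \<Rightarrow> real \<Rightarrow> real"
    proof -
      note [measurable (raw)] = measurable_binary[OF q(1)]
      have "integrable lborel (\<lambda>s. q s (c + s))"
        by (rule integrableI_bounded) (use q(2) in auto)
      then show ?thesis unfolding set_integrable_def by (intro integrable_mult_indicator) auto
    qed
    have I: "set_integrable lborel {r..t} (\<lambda>s. hb s (c + s))" "set_integrable lborel {r..t} (\<lambda>s. hb' s (c + s))"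
      using c by (auto intro!: int hb simp: good_def)
    have "ennreal \<bar>(LINT s:{r..t}|lborel. hb s (c + s)) - (LINT s:{r..t}|lborel. hb' s (c + s))\<bar> =
       ennreal (norm (LINT s:{r..t}|lborel. hb s (c + s) - hb' s (c + s)))"
      using I by simp
    also have "\<dots> \<le> (\<integral>\<^sup>+s. ennreal (norm (indicator {r..t} s *\<^sub>R (hb s (c + s) - hb' s (c + s)))) \<partial>lborel)"
      unfolding set_lebesgue_integral_def
      by (rule integral_norm_bound_ennreal) (use set_integral_diff(1)[OF I] in \<open>simp add: set_integrable_def\<close>)
    also have "\<dots> \<le> (\<integral>\<^sup>+s\<in>{..t}. k s (c + s) \<partial>lborel)"
      by (rule nn_integral_mono_AE) (use aeR in \<open>eventually_elim, auto simp: indicator_def\<close>)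
    finally show ?thesis unfolding L L' .
  qed
  show ?thesis
    using rule rule' ae1 ae2 ae3
  proof eventually_elim
    case (elim z)
    obtain t x where z: "z = (t, x)" by (cases z)
    note el = elim[unfolded z fst_conv snd_conv prod.case]
    show ?case
      unfolding z fst_conv snd_conv
    proof
      assume \<Omega>: "(t, x) \<in> ?\<Omega>"
      then have tx: "0 < t" "t < T" "0 < x" "x < 1" by auto
      have g: "good (x - t)" using el(3) by simp
      show "ennreal \<bar>\<eta> t x - \<eta>' t x\<bar> \<le> \<beta> (t - x) + (\<integral>\<^sup>+s\<in>{..t}. k s (x - t + s) \<partial>lborel)"
      proof (cases "t < x")
        case True
        have "\<eta> t x - \<eta>' t x = (LINT s|lebesgue_on {0..t}. H s (x - t + s)) - (LINT s|lebesgue_on {0..t}. H' s (x - t + s))"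
          using el(1,2) \<Omega> True by simp
        also have "ennreal \<bar>\<dots>\<bar> \<le> (\<integral>\<^sup>+s\<in>{..t}. k s (x - t + s) \<partial>lborel)"
          using tx True by (intro seg g) auto
        finally show ?thesis by (rule add_increasing[rotated]) simp
      next
        case False
        then have lt: "x < t" using el(5) by simp
        have "\<eta> t x - \<eta>' t x = (\<eta> (t - x) 0 - \<eta>' (t - x) 0) +
           ((LINT s|lebesgue_on {t - x..t}. H s (x - t + s)) - (LINT s|lebesgue_on {t - x..t}. H' s (x - t + s)))"
          using el(1,2) \<Omega> lt by simp
        then have "ennreal \<bar>\<eta> t x - \<eta>' t x\<bar> \<le> ennreal \<bar>\<eta> (t - x) 0 - \<eta>' (t - x) 0\<bar> +
           ennreal \<bar>(LINT s|lebesgue_on {t - x..t}. H s (x - t + s)) - (LINT s|lebesgue_on {t - x..t}. H' s (x - t + s))\<bar>"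
          by (simp flip: ennreal_plus add: ennreal_leI)
        also have "\<dots> \<le> \<beta> (t - x) + (\<integral>\<^sup>+s\<in>{..t}. k s (x - t + s) \<partial>lborel)"
        proof (rule add_mono)
          show "ennreal \<bar>\<eta> (t - x) 0 - \<eta>' (t - x) 0\<bar> \<le> \<beta> (t - x)" using el(4) tx lt by simp
        qed (use tx lt in \<open>intro seg g; simp\<close>)
        finally show ?thesis .
      qed
    qed
  qed
qed

text \<open>
  The pointwise inequality integrated in space and in time, respectively; every point of the half-plane is met
  once, so the source contributes at most its total mass \<open>W\<close>. In the second bound the inflow
  arrives with a delay of \<open>x\<close>.
\<close>

lemma transport_L1_bounds:
  fixes k :: "real \<Rightarrow> real \<Rightarrow> ennreal" and \<beta> :: "real \<Rightarrow> ennreal"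
  assumes k: "case_prod k \<in> borel_measurable (borel \<Otimes>\<^sub>M borel)" and \<beta>[measurable]: "\<beta> \<in> borel_measurable borel"
    and V: "AE z in lborel. z \<in> {0<..<T} \<times> {0<..<1} \<longrightarrow>
      V (fst z) (snd z) \<le> \<beta> (fst z - snd z) + (\<integral>\<^sup>+s\<in>{..fst z}. k s (snd z - fst z + s) \<partial>lborel)"
  defines "W \<equiv> \<lambda>t. \<integral>\<^sup>+s\<in>{..t}. (\<integral>\<^sup>+y. k s y \<partial>lborel) \<partial>lborel"
  shows "AE t in lborel. t \<in> {0<..<T} \<longrightarrow> (\<integral>\<^sup>+x\<in>{0<..<1}. V t x \<partial>lborel) \<le> (\<integral>\<^sup>+\<tau>\<in>{..t}. \<beta> \<tau> \<partial>lborel) + W t"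
    and "AE x in lborel. x \<in> {0<..<1} \<longrightarrow>
      (\<integral>\<^sup>+t\<in>{0<..<T}. V t x \<partial>lborel) \<le> (\<integral>\<^sup>+\<tau>\<in>{..T - x}. \<beta> \<tau> \<partial>lborel) + W T"
proof -
  note [measurable (raw)] = measurable_binary[OF k]
  have R: "AE z in lborel. (\<lambda>t x. (t, x) \<in> {0<..<T} \<times> {0<..<1} \<longrightarrow>
      V t x \<le> \<beta> (t - x) + (\<integral>\<^sup>+s\<in>{..t}. k s (x - t + s) \<partial>lborel)) (fst z) (snd z)"
    using V by simp
  have shiftk: "(\<integral>\<^sup>+x. k s (x - t + s) \<partial>lborel) = (\<integral>\<^sup>+y. k s y \<partial>lborel)" for s t
    using nn_integral_shift[of "k s" "s - t"] by (simp add: algebra_simps)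
  have reflk: "(\<integral>\<^sup>+t. k s (x - t + s) \<partial>lborel) = (\<integral>\<^sup>+y. k s y \<partial>lborel)" for s x
    using nn_integral_real_affine[of "k s" "-1" "x + s"] by (simp add: algebra_simps)
  show "AE t in lborel. t \<in> {0<..<T} \<longrightarrow> (\<integral>\<^sup>+x\<in>{0<..<1}. V t x \<partial>lborel) \<le> (\<integral>\<^sup>+\<tau>\<in>{..t}. \<beta> \<tau> \<partial>lborel) + W t"
    using AE_lborel_Pair[OF R]
  proof eventually_elim
    case (elim t)
    show ?case
    proof
      assume t: "t \<in> {0<..<T}"
      have "(\<integral>\<^sup>+x\<in>{0<..<1}. V t x \<partial>lborel) \<le>
        (\<integral>\<^sup>+x. \<beta> (t - x) * indicator {..t} (t - x) + (\<integral>\<^sup>+s\<in>{..t}. k s (x - t + s) \<partial>lborel) \<partial>lborel)"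
      proof (rule nn_integral_mono_AE)
        show "AE x in lborel. V t x * indicator {0<..<1} x \<le>
            \<beta> (t - x) * indicator {..t} (t - x) + (\<integral>\<^sup>+s\<in>{..t}. k s (x - t + s) \<partial>lborel)"
          using elim by eventually_elim (use t in \<open>auto simp: indicator_def\<close>)
      qed
      also have "\<dots> = (\<integral>\<^sup>+x. \<beta> (t - x) * indicator {..t} (t - x) \<partial>lborel) + (\<integral>\<^sup>+x. (\<integral>\<^sup>+s\<in>{..t}. k s (x - t + s) \<partial>lborel) \<partial>lborel)"
        by (rule nn_integral_add) measurable
      also have "(\<integral>\<^sup>+x. \<beta> (t - x) * indicator {..t} (t - x) \<partial>lborel) = (\<integral>\<^sup>+\<tau>\<in>{..t}. \<beta> \<tau> \<partial>lborel)"
        using nn_integral_real_affine[of "\<lambda>\<tau>. \<beta> \<tau> * indicator {..t} \<tau>" "-1" t] by simp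
      also have "(\<integral>\<^sup>+x. (\<integral>\<^sup>+s\<in>{..t}. k s (x - t + s) \<partial>lborel) \<partial>lborel) = (\<integral>\<^sup>+s. (\<integral>\<^sup>+x. k s (x - t + s) * indicator {..t} s \<partial>lborel) \<partial>lborel)"
        by (rule lborel_pair.Fubini') measurable
      also have "\<dots> = W t"
        unfolding W_def by (intro nn_integral_cong) (simp add: nn_integral_multc shiftk)
      finally show "(\<integral>\<^sup>+x\<in>{0<..<1}. V t x \<partial>lborel) \<le> (\<integral>\<^sup>+\<tau>\<in>{..t}. \<beta> \<tau> \<partial>lborel) + W t" .
    qed
  qed
  note swap = AE_lborel_swap[OF R]
  show "AE x in lborel. x \<in> {0<..<1} \<longrightarrow>
      (\<integral>\<^sup>+t\<in>{0<..<T}. V t x \<partial>lborel) \<le> (\<integral>\<^sup>+\<tau>\<in>{..T - x}. \<beta> \<tau> \<partial>lborel) + W T"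
    using AE_lborel_Pair[OF swap]
  proof eventually_elim
    case (elim x)
    show ?case
    proof
      assume x: "x \<in> {0<..<1}"
      have "(\<integral>\<^sup>+t\<in>{0<..<T}. V t x \<partial>lborel) \<le>
        (\<integral>\<^sup>+t. \<beta> (t + - x) * indicator {..T - x} (t + - x) + (\<integral>\<^sup>+s\<in>{..T}. k s (x - t + s) \<partial>lborel) \<partial>lborel)"
      proof (rule nn_integral_mono_AE)
        show "AE t in lborel. V t x * indicator {0<..<T} t \<le> \<beta> (t + - x) * indicator {..T - x} (t + - x) + (\<integral>\<^sup>+s\<in>{..T}. k s (x - t + s) \<partial>lborel)"
          using elim
        proof eventually_elim
          case (elim t)
          have "(\<integral>\<^sup>+s\<in>{..t}. k s (x - t + s) \<partial>lborel) \<le> (\<integral>\<^sup>+s\<in>{..T}. k s (x - t + s) \<partial>lborel)" if "t < T"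
            using that by (intro nn_integral_mono) (auto simp: indicator_def)
          then show ?case using elim x by (auto simp: indicator_def intro: order_trans add_left_mono)
        qed
      qed
      also have "\<dots> = (\<integral>\<^sup>+t. \<beta> (t + - x) * indicator {..T - x} (t + - x) \<partial>lborel) + (\<integral>\<^sup>+t. (\<integral>\<^sup>+s\<in>{..T}. k s (x - t + s) \<partial>lborel) \<partial>lborel)"
        by (rule nn_integral_add) measurable
      also have "(\<integral>\<^sup>+t. \<beta> (t + - x) * indicator {..T - x} (t + - x) \<partial>lborel) = (\<integral>\<^sup>+\<tau>\<in>{..T - x}. \<beta> \<tau> \<partial>lborel)"
        by (rule nn_integral_shift[of "\<lambda>\<tau>. \<beta> \<tau> * indicator {..T - x} \<tau>"]) measurable
      also have "(\<integral>\<^sup>+t. (\<integral>\<^sup>+s\<in>{..T}. k s (x - t + s) \<partial>lborel) \<partial>lborel) = (\<integral>\<^sup>+s. (\<integral>\<^sup>+t. k s (x - t + s) * indicator {..T} s \<partial>lborel) \<partial>lborel)"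
        by (rule lborel_pair.Fubini') measurable
      also have "\<dots> = W T"
        unfolding W_def by (intro nn_integral_cong) (simp add: nn_integral_multc reflk)
      finally show "(\<integral>\<^sup>+t\<in>{0<..<T}. V t x \<partial>lborel) \<le> (\<integral>\<^sup>+\<tau>\<in>{..T - x}. \<beta> \<tau> \<partial>lborel) + W T" .
    qed
  qed
qed

text \<open>
  On an interval of length \<open>d\<close> with \<open>K * d \<le> 1 / 2\<close> that follows a zero of
  \<open>W\<close>, the hypothesis gives \<open>W \<le> W / 2\<close>; as \<open>W\<close> is finite it
  vanishes there too.
\<close>

lemma gronwall_zero:
  fixes \<Theta> :: "real \<Rightarrow> ennreal"
  assumes [measurable]: "\<Theta> \<in> borel_measurable borel" and K: "0 \<le> K"
    and fin: "(\<integral>\<^sup>+s. \<Theta> s \<partial>lborel) < \<infinity>" and neg: "\<And>t. t \<le> 0 \<Longrightarrow> \<Theta> t = 0"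
    and le: "AE t in lborel. \<Theta> t \<le> ennreal K * (\<integral>\<^sup>+s\<in>{..t}. \<Theta> s \<partial>lborel)"
  shows "(\<integral>\<^sup>+s\<in>{..T}. \<Theta> s \<partial>lborel) = 0"
proof -
  define W where "W t = (\<integral>\<^sup>+s\<in>{..t}. \<Theta> s \<partial>lborel)" for t
  have Wmono: "W s \<le> W t" if "s \<le> t" for s t
    unfolding W_def using that by (intro nn_integral_mono) (auto simp: indicator_def)
  have Wfin: "W t < \<infinity>" for t
  proof -
    have "W t \<le> (\<integral>\<^sup>+s. \<Theta> s \<partial>lborel)" unfolding W_def by (intro nn_integral_mono) (auto simp: indicator_def)
    then show ?thesis using fin by (rule le_less_trans)
  qed
  \<comment> \<open>Short enough for \<open>K * d \<le> 1 / 2\<close>, also if \<open>K = 0\<close>.\<close>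
  define d where "d = 1 / (2 * (K + 1))"
  have d: "0 < d" "K * d \<le> 1 / 2" using K by (auto simp: d_def field_simps)
  have zero: "W (real n * d) = 0" for n
  proof (induction n)
    case 0
    have "W 0 = integral\<^sup>N lborel (\<lambda>s::real. 0)"
      unfolding W_def by (intro nn_integral_cong) (auto simp: indicator_def neg)
    then show ?case by simp
  next
    case (Suc n)
    let ?a = "real n * d" and ?b = "real (Suc n) * d"
    have ab: "?b - ?a = d" "?a < ?b" using d by (auto simp: algebra_simps)
    have "W ?b \<le> (\<integral>\<^sup>+s. \<Theta> s * indicator {..?a} s + ennreal K * W ?b * indicator {?a<..?b} s \<partial>lborel)"
      unfolding W_def[of ?b]
    proof (rule nn_integral_mono_AE)
      show "AE s in lborel. \<Theta> s * indicator {..?b} s \<le> \<Theta> s * indicator {..?a} s + ennreal K * (\<integral>\<^sup>+s\<in>{..?b}. \<Theta> s \<partial>lborel) * indicator {?a<..?b} s"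
        using le
      proof eventually_elim
        case (elim s)
        have "ennreal K * (\<integral>\<^sup>+r\<in>{..s}. \<Theta> r \<partial>lborel) \<le> ennreal K * (\<integral>\<^sup>+r\<in>{..?b}. \<Theta> r \<partial>lborel)" if "s \<le> ?b"
          using Wmono[OF that] unfolding W_def by (rule mult_left_mono) simp
        then show ?case using elim by (auto simp: indicator_def intro: order_trans)
      qed
    qed
    also have "\<dots> = W ?a + (\<integral>\<^sup>+s. ennreal K * W ?b * indicator {?a<..?b} s \<partial>lborel)"
      unfolding W_def[of ?a] by (rule nn_integral_add) auto
    also have "(\<integral>\<^sup>+s. ennreal K * W ?b * indicator {?a<..?b} s \<partial>lborel) = ennreal K * W ?b * ennreal d"
      using ab by (subst nn_integral_cmult_indicator) auto
    finally have *: "W ?b \<le> ennreal K * W ?b * ennreal d" unfolding Suc by simp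
    obtain q where q: "W ?b = ennreal q" "0 \<le> q" using Wfin[of ?b] by (cases "W ?b") auto
    have "q \<le> K * q * d" using * K d q by (simp add: ennreal_mult[symmetric])
    also have "\<dots> \<le> q / 2" using mult_right_mono[OF d(2) q(2)] by (simp add: algebra_simps)
    finally show ?case using q by simp
  qed
  obtain n :: nat where "T / d < real n" using reals_Archimedean2 by blast
  then have "T \<le> real n * d" using d by (simp add: field_simps)
  then have "W T \<le> 0" using Wmono zero by metis
  then show ?thesis by (simp add: W_def)
qed

section \<open>Uniqueness\<close>

lemma AE_lborel_witness:
  fixes a b :: real
  assumes "AE x in lborel. P x" "a < b"
  shows "\<exists>x\<in>{a<..<b}. P x"
proof (rule ccontr)
  assume n: "\<not> (\<exists>x\<in>{a<..<b}. P x)"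
  from assms(1) obtain N where N: "{x \<in> space lborel. \<not> P x} \<subseteq> N" "emeasure lborel N = 0" "N \<in> sets lborel"
    by (rule AE_E)
  have "emeasure lborel {a<..<b} \<le> emeasure lborel N"
    by (rule emeasure_mono) (use n N in auto)
  then show False using N(2) assms(2) by simp
qed

lemma continuous_into_L1_reflect:
  assumes v: "continuous_into_L1 {0..1} S v"
  shows "continuous_into_L1 {0..1} S (\<lambda>x. v (1 - x))"
  unfolding continuous_into_L1_def
proof (intro ballI conjI)
  fix r :: real assume r: "r \<in> {0..1}"
  then have r': "1 - r \<in> {0..1}" by auto
  show "v (1 - r) \<in> borel_measurable (lebesgue_on S)" "L1_norm S (v (1 - r)) < \<infinity>"
    using v r' unfolding continuous_into_L1_def by blast+
  have lim: "((\<lambda>s. L1_norm S (\<lambda>x. v s x - v (1 - r) x)) \<longlongrightarrow> 0) (at (1 - r) within {0..1})"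
    using v r' unfolding continuous_into_L1_def by blast
  have "((\<lambda>s. 1 - s) \<longlongrightarrow> 1 - r) (at r within {0..1})" by (intro tendsto_intros)
  then have "filterlim (\<lambda>s. 1 - s) (at (1 - r) within {0..1}) (at r within {0..1})"
    unfolding filterlim_at by (auto simp: eventually_at_filter)
  from filterlim_compose[OF lim this]
  show "((\<lambda>s. L1_norm S (\<lambda>x. v (1 - s) x - v (1 - r) x)) \<longlongrightarrow> 0) (at r within {0..1})" .
qed

text \<open>
  The bound at almost every \<open>x < 1\<close> passes to the trace at the outflow boundary
  \<open>x = 1\<close>. Points with \<open>x > 1 / 2\<close> are used, so the inflow counts only up to half a
  unit of time earlier.
\<close>

lemma outflow_trace_bound:
  fixes k :: "real \<Rightarrow> real \<Rightarrow> ennreal" and \<beta> :: "real \<Rightarrow> ennreal"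
  assumes k: "case_prod k \<in> borel_measurable (borel \<Otimes>\<^sub>M borel)" and \<beta>: "\<beta> \<in> borel_measurable borel"
    and u: "continuous_into_L1 {0..1} {0<..<T} (\<lambda>x t. u t x)"
    and V: "AE z in lborel. z \<in> {0<..<T} \<times> {0<..<1} \<longrightarrow>
      ennreal \<bar>u (fst z) (snd z)\<bar> \<le> \<beta> (fst z - snd z) + (\<integral>\<^sup>+s\<in>{..fst z}. k s (snd z - fst z + s) \<partial>lborel)"
  shows "L1_norm {0<..<T} (\<lambda>t. u t 1) \<le>
    (\<integral>\<^sup>+\<tau>\<in>{..T - 1 / 2}. \<beta> \<tau> \<partial>lborel) + (\<integral>\<^sup>+s\<in>{..T}. (\<integral>\<^sup>+y. k s y \<partial>lborel) \<partial>lborel)"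
proof (rule continuous_into_L1_limit_bound[OF u])
  let ?W = "\<integral>\<^sup>+s\<in>{..T}. (\<integral>\<^sup>+y. k s y \<partial>lborel) \<partial>lborel"
  fix d :: real assume d: "0 < d"
  have "max (1 / 2) (1 - d) < 1" using d by simp
  from AE_lborel_witness[OF transport_L1_bounds(2)[OF k \<beta> V] this]
  obtain x where x: "max (1 / 2) (1 - d) < x" "x < 1"
    "x \<in> {0<..<1} \<longrightarrow> (\<integral>\<^sup>+t\<in>{0<..<T}. ennreal \<bar>u t x\<bar> \<partial>lborel) \<le> (\<integral>\<^sup>+\<tau>\<in>{..T - x}. \<beta> \<tau> \<partial>lborel) + ?W"
    by auto
  have "L1_norm {0<..<T} (\<lambda>t. u t x) \<le> (\<integral>\<^sup>+\<tau>\<in>{..T - x}. \<beta> \<tau> \<partial>lborel) + ?W"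
    using x by (simp add: L1_norm_def nn_integral_lebesgue_on)
  also have "(\<integral>\<^sup>+\<tau>\<in>{..T - x}. \<beta> \<tau> \<partial>lborel) \<le> (\<integral>\<^sup>+\<tau>\<in>{..T - 1 / 2}. \<beta> \<tau> \<partial>lborel)"
    using x by (intro nn_integral_mono) (auto simp: indicator_def)
  finally show "\<exists>s\<in>{0..1}. s \<noteq> 1 \<and> \<bar>s - 1\<bar> < d \<and> L1_norm {0<..<T} (\<lambda>t. u t s) \<le>
      (\<integral>\<^sup>+\<tau>\<in>{..T - 1 / 2}. \<beta> \<tau> \<partial>lborel) + ?W"
    using x by (intro bexI[of _ x]) (auto simp: add_right_mono)
qed simp

lemma slice_borel_representative:
  assumes u: "(\<lambda>(t, x). u t x) \<in> borel_measurable (lebesgue_on ({0<..<T} \<times> {0<..<1}))"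
    and c: "continuous_into_L1 {0..T} {0<..<1} u" and T: "0 < T"
  shows "\<exists>v. case_prod v \<in> borel_measurable (borel \<Otimes>\<^sub>M borel) \<and>
    (\<forall>t x. (t, x) \<notin> {0<..<T} \<times> {0<..<1} \<longrightarrow> v t x = (0::real)) \<and>
    (AE z in lborel. z \<in> {0<..<T} \<times> {0<..<1} \<longrightarrow> u (fst z) (snd z) = v (fst z) (snd z)) \<and>
    (\<integral>\<^sup>+s. (\<integral>\<^sup>+y. ennreal \<bar>v s y\<bar> \<partial>lborel) \<partial>lborel) < \<infinity>"
proof -
  let ?\<Omega> = "{0<..<T} \<times> {0<..<1::real}"
  from borel_representative[OF u rectangle_borel] obtain h
    where h: "h \<in> borel_measurable borel" "AE z in lborel. z \<in> ?\<Omega> \<longrightarrow> (case z of (t, x) \<Rightarrow> u t x) = h z" by blast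
  define v where "v t x = (if (t, x) \<in> ?\<Omega> then h (t, x) else 0)" for t x
  have hp[measurable]: "h \<in> borel_measurable (borel \<Otimes>\<^sub>M borel)" using h(1) unfolding borel_prod .
  have vm: "case_prod v \<in> borel_measurable (borel \<Otimes>\<^sub>M borel)"
    unfolding v_def[abs_def] split_beta' mem_Times_iff by simp
  note [measurable (raw)] = measurable_binary[OF vm]
  have eq: "AE z in lborel. z \<in> ?\<Omega> \<longrightarrow> u (fst z) (snd z) = v (fst z) (snd z)"
    using h(2) by eventually_elim (auto simp: v_def)
  obtain C where C: "C < \<infinity>" "\<And>r. r \<in> {0..T} \<Longrightarrow> L1_norm {0<..<1} (u r) \<le> C"
    using continuous_into_L1_bounded[OF c] by blast
  have "AE z in lborel. (\<lambda>t x. (t, x) \<in> ?\<Omega> \<longrightarrow> u t x = v t x) (fst z) (snd z)" using eq by simp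
  from AE_lborel_Pair[OF this]
  have "AE t in lborel. (\<integral>\<^sup>+y. ennreal \<bar>v t y\<bar> \<partial>lborel) \<le> C * indicator {0<..<T} t"
  proof eventually_elim
    case (elim t)
    show ?case
    proof (cases "t \<in> {0<..<T}")
      case True
      have "(\<integral>\<^sup>+y. ennreal \<bar>v t y\<bar> \<partial>lborel) = (\<integral>\<^sup>+y\<in>{0<..<1}. ennreal \<bar>u t y\<bar> \<partial>lborel)"
        by (rule nn_integral_cong_AE) (use elim in \<open>eventually_elim, use True in \<open>auto simp: v_def indicator_def\<close>\<close>)
      also have "\<dots> = L1_norm {0<..<1} (u t)" by (simp add: L1_norm_def nn_integral_lebesgue_on)
      finally show ?thesis using C(2)[of t] True by simp
    next
      case False
      then have "v t y = 0" for y by (auto simp: v_def)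
      then show ?thesis by simp
    qed
  qed
  then have "(\<integral>\<^sup>+s. (\<integral>\<^sup>+y. ennreal \<bar>v s y\<bar> \<partial>lborel) \<partial>lborel) \<le> (\<integral>\<^sup>+s. C * indicator {0<..<T} s \<partial>lborel)"
    by (rule nn_integral_mono_AE)
  also have "\<dots> < \<infinity>" using C T by (simp add: nn_integral_cmult_indicator ennreal_mult_less_top)
  finally show ?thesis using vm eq by (intro exI[of _ v]) (auto simp: v_def)
qed

lemma damping_borel_representative:
  fixes a :: "real \<Rightarrow> real \<Rightarrow> real"
  assumes a: "(\<lambda>(t, x). a t x) \<in> borel_measurable (lebesgue_on ({0<..} \<times> {0<..<1}))"
    and bd: "AE z in lborel. z \<in> {0<..} \<times> {0<..<1} \<longrightarrow> \<bar>a (fst z) (snd z)\<bar> \<le> M" and M: "0 \<le> M"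
  shows "\<exists>h. case_prod h \<in> borel_measurable (borel \<Otimes>\<^sub>M borel) \<and> (\<forall>t x. \<bar>h t x\<bar> \<le> M) \<and>
    (AE z in lborel. z \<in> {0<..} \<times> {0<..<1} \<longrightarrow> a (fst z) (snd z) = h (fst z) (snd z))"
proof -
  have "{0<..} \<times> {0<..<1} \<in> sets (borel :: (real \<times> real) measure)"
    by (intro borel_open open_Times) auto
  from borel_representative[OF a this] obtain h
    where h: "h \<in> borel_measurable borel" "AE z in lborel. z \<in> {0<..} \<times> {0<..<1} \<longrightarrow> (case z of (t, x) \<Rightarrow> a t x) = h z" by blast
  have [measurable]: "h \<in> borel_measurable (borel \<Otimes>\<^sub>M borel)" using h(1) unfolding borel_prod .
  show ?thesis
  proof (intro exI[of _ "\<lambda>t x. max (- M) (min M (h (t, x)))"] conjI allI)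
    show "(\<lambda>(t, x). max (- M) (min M (h (t, x)))) \<in> borel_measurable (borel \<Otimes>\<^sub>M borel)"
      unfolding split_beta' by simp
    show "\<bar>max (- M) (min M (h (t, x)))\<bar> \<le> M" for t x using M by auto
    show "AE z in lborel. z \<in> {0<..} \<times> {0<..<1} \<longrightarrow> a (fst z) (snd z) = max (- M) (min M (h (fst z, snd z)))"
      using h(2) bd by eventually_elim (auto simp: split_beta' abs_le_iff max_def min_def)
  qed
qed

lemma trace_borel_representative:
  fixes f :: "real \<Rightarrow> real"
  assumes "f \<in> borel_measurable (lebesgue_on {0<..<T})"
  shows "\<exists>\<beta>. \<beta> \<in> borel_measurable borel \<and> (\<forall>\<tau>. \<tau> \<notin> {0<..<T} \<longrightarrow> \<beta> \<tau> = 0) \<and>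
    (AE \<tau> in lborel. \<tau> \<in> {0<..<T} \<longrightarrow> ennreal \<bar>f \<tau>\<bar> = \<beta> \<tau>)"
proof -
  have "{0<..<T} \<in> sets borel" by simp
  from borel_representative[OF assms this] obtain h
    where h: "h \<in> borel_measurable borel" "AE \<tau> in lborel. \<tau> \<in> {0<..<T} \<longrightarrow> f \<tau> = h \<tau>" by blast
  note [measurable] = h(1)
  show ?thesis
  proof (intro exI[of _ "\<lambda>\<tau>. ennreal \<bar>h \<tau>\<bar> * indicator {0<..<T} \<tau>"] conjI)
    show "AE \<tau> in lborel. \<tau> \<in> {0<..<T} \<longrightarrow> ennreal \<bar>f \<tau>\<bar> = ennreal \<bar>h \<tau>\<bar> * indicator {0<..<T} \<tau>"
      using h(2) by eventually_elim auto
  qed auto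
qed

text \<open>
  What enters at one boundary has left through the other at least half a unit of time earlier. After finitely
  many such steps no inflow remains and the boundary terms are controlled by the sources alone.
\<close>

lemma two_sided_iteration:
  fixes A0 A1 W :: "real \<Rightarrow> ennreal"
  assumes neg: "\<And>t. t \<le> 0 \<Longrightarrow> A0 t = 0" "\<And>t. t \<le> 0 \<Longrightarrow> A1 t = 0" and Wmono: "\<And>s t. s \<le> t \<Longrightarrow> W s \<le> W t"
    and step: "\<And>t. 0 < t \<Longrightarrow> t \<le> T \<Longrightarrow> A1 t \<le> A0 (t - 1 / 2) + W t" "\<And>t. 0 < t \<Longrightarrow> t \<le> T \<Longrightarrow> A0 t \<le> A1 (t - 1 / 2) + W t"
  shows "\<exists>K\<ge>0. \<forall>t\<le>T. A0 t + A1 t \<le> ennreal K * W t"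
proof -
  have it: "t \<le> T \<Longrightarrow> t \<le> real n / 2 \<Longrightarrow> A0 t + A1 t \<le> of_nat (2 * n) * W t" for n t
  proof (induction n arbitrary: t)
    case 0
    then show ?case by (simp add: neg)
  next
    case (Suc n)
    show ?case
    proof (cases "0 < t")
      case True
      have "A0 t + A1 t \<le> (A1 (t - 1 / 2) + W t) + (A0 (t - 1 / 2) + W t)"
        using step True Suc.prems by (intro add_mono) auto
      also have "\<dots> = (A0 (t - 1 / 2) + A1 (t - 1 / 2)) + 2 * W t"
        by (simp only: mult_2 add_ac)
      also have "\<dots> \<le> of_nat (2 * n) * W (t - 1 / 2) + 2 * W t"
        using Suc.prems by (intro add_right_mono Suc.IH) (auto simp: field_simps)
      also have "\<dots> \<le> of_nat (2 * n) * W t + 2 * W t"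
        by (intro add_right_mono mult_left_mono Wmono) auto
      also have "\<dots> = of_nat (2 * Suc n) * W t"
      proof -
        have "(of_nat (2 * Suc n) :: ennreal) = of_nat (2 * n) + 2" by (simp add: add.commute)
        then show ?thesis by (simp only: distrib_right)
      qed
      finally show ?thesis .
    qed (simp add: neg)
  qed
  obtain n :: nat where "2 * T < real n" using reals_Archimedean2 by blast
  then have "A0 t + A1 t \<le> ennreal (real (2 * n)) * W t" if "t \<le> T" for t
    using it[of t n] that unfolding ennreal_of_nat_eq_real_of_nat by auto
  then show ?thesis by (intro exI[of _ "real (2 * n)"]) auto
qed

text \<open>
  The difference of two solutions is estimated in \<open>L\<^sup>1\<close>. The transport inequalities bound
  its boundary traces and then its spatial norm \<open>\<Theta> t\<close> (weighted by \<open>M / 2\<close>)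
  by \<open>W t\<close>, the integral of \<open>\<Theta>\<close> up to time \<open>t\<close>, and Gronwall's
  argument applies. The left-going family \<open>\<rho>\<close> becomes right-going after the reflection
  \<open>x \<mapsto> 1 - x\<close>, so one set of transport inequalities serves both.
\<close>

lemma broad_solution_AE_unique:
  assumes p: "1 < p" and T: "0 < T" and M: "0 < M"
    and a: "(\<lambda>(t, x). a t x) \<in> borel_measurable (lebesgue_on ({0<..} \<times> {0<..<1}))"
    and a_bd: "AE z in lborel. z \<in> {0<..} \<times> {0<..<1} \<longrightarrow> \<bar>a (fst z) (snd z)\<bar> \<le> M"
    and sol: "broad_solution p a \<rho>0 \<xi>0 \<rho> \<xi>" and sol': "broad_solution p a \<rho>0 \<xi>0 \<rho>' \<xi>'"
  shows "AE z in lborel. z \<in> {0<..<T} \<times> {0<..<1} \<longrightarrow>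
    \<rho> (fst z) (snd z) = \<rho>' (fst z) (snd z) \<and> \<xi> (fst z) (snd z) = \<xi>' (fst z) (snd z)"
proof -
  let ?\<Omega> = "{0<..<T} \<times> {0<..<1::real}"
  have ss: "solution_space p t \<rho> \<xi>" "solution_space p t \<rho>' \<xi>'" if "0 < t" for t
    using sol sol' that by (auto simp: broad_solution_def broad_solution_on_def)
  have cL: "continuous_into_L1 {0..t} {0<..<1} u" "continuous_into_L1 {0..t} {0<..<1} v"
    "continuous_into_L1 {0..1} {0<..<t} (\<lambda>x t. u t x)" "continuous_into_L1 {0..1} {0<..<t} (\<lambda>x t. v t x)"
    if "solution_space p t u v" "0 < t" for t u v
    using that continuous_into_Lp_imp_L1[OF p, of "{0<..<1}" "{0..t}" u v]
      continuous_into_Lp_imp_L1[OF p, of "{0<..<t}" "{0..1}" "\<lambda>x t. u t x" "\<lambda>x t. v t x"]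
    by (auto simp: solution_space_def)
  have jm: "(\<lambda>(t, x). u t x) \<in> borel_measurable (lebesgue_on ?\<Omega>)" "(\<lambda>(t, x). v t x) \<in> borel_measurable (lebesgue_on ?\<Omega>)"
    if "solution_space p T u v" for u v using that by (auto simp: solution_space_def)
  note reps = slice_borel_representative[OF jm(1) cL(1)] slice_borel_representative[OF jm(2) cL(2)]
  obtain r where r: "case_prod r \<in> borel_measurable (borel \<Otimes>\<^sub>M borel)" "\<And>t x. (t, x) \<notin> ?\<Omega> \<Longrightarrow> r t x = 0"
    "AE z in lborel. z \<in> ?\<Omega> \<longrightarrow> \<rho> (fst z) (snd z) = r (fst z) (snd z)" "(\<integral>\<^sup>+s. (\<integral>\<^sup>+y. ennreal \<bar>r s y\<bar> \<partial>lborel) \<partial>lborel) < \<infinity>"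
    using reps(1)[OF ss(1)[OF T] ss(1)[OF T] T T] by blast
  obtain r' where r': "case_prod r' \<in> borel_measurable (borel \<Otimes>\<^sub>M borel)" "\<And>t x. (t, x) \<notin> ?\<Omega> \<Longrightarrow> r' t x = 0"
    "AE z in lborel. z \<in> ?\<Omega> \<longrightarrow> \<rho>' (fst z) (snd z) = r' (fst z) (snd z)" "(\<integral>\<^sup>+s. (\<integral>\<^sup>+y. ennreal \<bar>r' s y\<bar> \<partial>lborel) \<partial>lborel) < \<infinity>"
    using reps(1)[OF ss(2)[OF T] ss(2)[OF T] T T] by blast
  obtain q where q: "case_prod q \<in> borel_measurable (borel \<Otimes>\<^sub>M borel)" "\<And>t x. (t, x) \<notin> ?\<Omega> \<Longrightarrow> q t x = 0"
    "AE z in lborel. z \<in> ?\<Omega> \<longrightarrow> \<xi> (fst z) (snd z) = q (fst z) (snd z)" "(\<integral>\<^sup>+s. (\<integral>\<^sup>+y. ennreal \<bar>q s y\<bar> \<partial>lborel) \<partial>lborel) < \<infinity>"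
    using reps(2)[OF ss(1)[OF T] ss(1)[OF T] T T] by blast
  obtain q' where q': "case_prod q' \<in> borel_measurable (borel \<Otimes>\<^sub>M borel)" "\<And>t x. (t, x) \<notin> ?\<Omega> \<Longrightarrow> q' t x = 0"
    "AE z in lborel. z \<in> ?\<Omega> \<longrightarrow> \<xi>' (fst z) (snd z) = q' (fst z) (snd z)" "(\<integral>\<^sup>+s. (\<integral>\<^sup>+y. ennreal \<bar>q' s y\<bar> \<partial>lborel) \<partial>lborel) < \<infinity>"
    using reps(2)[OF ss(2)[OF T] ss(2)[OF T] T T] by blast
  obtain h where h: "case_prod h \<in> borel_measurable (borel \<Otimes>\<^sub>M borel)" "\<And>t x. \<bar>h t x\<bar> \<le> M"
    "AE z in lborel. z \<in> {0<..} \<times> {0<..<1} \<longrightarrow> a (fst z) (snd z) = h (fst z) (snd z)"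
    using damping_borel_representative[OF a a_bd] M by auto
  note [measurable (raw)] = measurable_binary[OF r(1)] measurable_binary[OF r'(1)] measurable_binary[OF q(1)]
    measurable_binary[OF q'(1)] measurable_binary[OF h(1)]
  define k where "k s y = ennreal (M / 2) * (ennreal \<bar>r s y - r' s y\<bar> + ennreal \<bar>q s y - q' s y\<bar>)" for s y
  have km: "case_prod k \<in> borel_measurable (borel \<Otimes>\<^sub>M borel)"
    unfolding k_def[abs_def] split_beta' by measurable
  note [measurable (raw)] = measurable_binary[OF km]
  define G where "G u v s y = h s y / 2 * (u s y - v s y)" for u v :: "real \<Rightarrow> real \<Rightarrow> real" and s y
  have Gfin: "(\<integral>\<^sup>+s. (\<integral>\<^sup>+y. ennreal \<bar>G u v s y\<bar> \<partial>lborel) \<partial>lborel) < \<infinity>"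
    if uv: "case_prod u \<in> borel_measurable (borel \<Otimes>\<^sub>M borel)" "case_prod v \<in> borel_measurable (borel \<Otimes>\<^sub>M borel)"
      "(\<integral>\<^sup>+s. (\<integral>\<^sup>+y. ennreal \<bar>u s y\<bar> \<partial>lborel) \<partial>lborel) < \<infinity>" "(\<integral>\<^sup>+s. (\<integral>\<^sup>+y. ennreal \<bar>v s y\<bar> \<partial>lborel) \<partial>lborel) < \<infinity>" for u v
  proof -
    note [measurable (raw)] = measurable_binary[OF uv(1)] measurable_binary[OF uv(2)]
    have "ennreal \<bar>G u v s y\<bar> \<le> ennreal (M / 2) * (ennreal \<bar>u s y\<bar> + ennreal \<bar>v s y\<bar>)" for s y
    proof -
      have "\<bar>G u v s y\<bar> = \<bar>h s y\<bar> / 2 * \<bar>u s y - v s y\<bar>" by (simp add: G_def abs_mult)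
      also have "\<dots> \<le> M / 2 * (\<bar>u s y\<bar> + \<bar>v s y\<bar>)"
        using h(2)[of s y] by (intro mult_mono) auto
      finally show ?thesis using M by (simp add: ennreal_mult[symmetric] ennreal_plus[symmetric] ennreal_leI del: ennreal_plus)
    qed
    then have "(\<integral>\<^sup>+s. (\<integral>\<^sup>+y. ennreal \<bar>G u v s y\<bar> \<partial>lborel) \<partial>lborel) \<le>
       (\<integral>\<^sup>+s. (\<integral>\<^sup>+y. ennreal (M / 2) * (ennreal \<bar>u s y\<bar> + ennreal \<bar>v s y\<bar>) \<partial>lborel) \<partial>lborel)"
      by (intro nn_integral_mono)
    also have "\<dots> = ennreal (M / 2) * ((\<integral>\<^sup>+s. (\<integral>\<^sup>+y. ennreal \<bar>u s y\<bar> \<partial>lborel) \<partial>lborel) + (\<integral>\<^sup>+s. (\<integral>\<^sup>+y. ennreal \<bar>v s y\<bar> \<partial>lborel) \<partial>lborel))"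
      by (simp add: nn_integral_cmult nn_integral_add)
    also have "\<dots> < \<infinity>" using uv by (simp add: ennreal_mult_less_top)
    finally show ?thesis .
  qed
  have Gm: "case_prod (G r q) \<in> borel_measurable (borel \<Otimes>\<^sub>M borel)" "case_prod (G r' q') \<in> borel_measurable (borel \<Otimes>\<^sub>M borel)"
    unfolding G_def[abs_def] split_beta' by measurable
  note [measurable (raw)] = measurable_binary[OF Gm(1)] measurable_binary[OF Gm(2)]
  have Gk: "ennreal \<bar>G r q s y - G r' q' s y\<bar> \<le> k s y" for s y
  proof -
    have "\<bar>G r q s y - G r' q' s y\<bar> = \<bar>h s y\<bar> / 2 * \<bar>(r s y - r' s y) - (q s y - q' s y)\<bar>"
    proof -
      have eq: "G r q s y - G r' q' s y = h s y / 2 * ((r s y - r' s y) - (q s y - q' s y))"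
        by (simp add: G_def field_simps)
      show ?thesis unfolding eq by (simp add: abs_mult)
    qed
    also have "\<dots> \<le> M / 2 * (\<bar>r s y - r' s y\<bar> + \<bar>q s y - q' s y\<bar>)"
      using h(2)[of s y] by (intro mult_mono) auto
    finally show ?thesis using M by (simp add: k_def ennreal_mult[symmetric] ennreal_plus[symmetric] ennreal_leI del: ennreal_plus)
  qed
  define \<Theta> where "\<Theta> s = (\<integral>\<^sup>+y. k s y \<partial>lborel)" for s
  define W where "W t = (\<integral>\<^sup>+s\<in>{..t}. \<Theta> s \<partial>lborel)" for t
  have [measurable]: "\<Theta> \<in> borel_measurable borel" unfolding \<Theta>_def by measurable
  have reflk: "(\<integral>\<^sup>+y. k s (1 - y) \<partial>lborel) = \<Theta> s" for s
    using nn_integral_real_affine[of "k s" "-1" 1] by (simp add: \<Theta>_def)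
  have trm: "(\<lambda>\<tau>. u \<tau> x - u' \<tau> x) \<in> borel_measurable (lebesgue_on {0<..<T})"
    if "continuous_into_L1 {0..1} {0<..<T} (\<lambda>x t. u t x)" "continuous_into_L1 {0..1} {0<..<T} (\<lambda>x t. u' t x)" "x \<in> {0..1}"
    for u u' :: "real \<Rightarrow> real \<Rightarrow> real" and x
    using that by (auto simp: continuous_into_L1_def intro!: borel_measurable_diff)
  obtain \<beta>0 where b0[measurable]: "\<beta>0 \<in> borel_measurable borel" and b0z: "\<And>\<tau>. \<tau> \<notin> {0<..<T} \<Longrightarrow> \<beta>0 \<tau> = 0"
    and b0e: "AE \<tau> in lborel. \<tau> \<in> {0<..<T} \<longrightarrow> ennreal \<bar>\<xi> \<tau> 0 - \<xi>' \<tau> 0\<bar> = \<beta>0 \<tau>"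
    using trace_borel_representative[OF trm[OF cL(4)[OF ss(1)[OF T] T] cL(4)[OF ss(2)[OF T] T], of 0]] by auto
  obtain \<beta>1 where b1[measurable]: "\<beta>1 \<in> borel_measurable borel" and b1z: "\<And>\<tau>. \<tau> \<notin> {0<..<T} \<Longrightarrow> \<beta>1 \<tau> = 0"
    and b1e: "AE \<tau> in lborel. \<tau> \<in> {0<..<T} \<longrightarrow> ennreal \<bar>\<rho> \<tau> 1 - \<rho>' \<tau> 1\<bar> = \<beta>1 \<tau>"
    using trace_borel_representative[OF trm[OF cL(3)[OF ss(1)[OF T] T] cL(3)[OF ss(2)[OF T] T], of 1]] by auto
  have bc: "AE \<tau> in lborel. \<tau> \<in> {0<..<T} \<longrightarrow> \<rho> \<tau> 0 = - \<xi> \<tau> 0 \<and> \<rho> \<tau> 1 = - \<xi> \<tau> 1"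
    "AE \<tau> in lborel. \<tau> \<in> {0<..<T} \<longrightarrow> \<rho>' \<tau> 0 = - \<xi>' \<tau> 0 \<and> \<rho>' \<tau> 1 = - \<xi>' \<tau> 1"
    using sol sol' T unfolding broad_solution_def broad_solution_on_def by (auto simp: AE_lebesgue_on_iff)
  \<comment> \<open>On each boundary the two components are opposite, so their differences have the same size.\<close>
  have b0e': "AE \<tau> in lborel. \<tau> \<in> {0<..<T} \<longrightarrow> ennreal \<bar>\<rho> \<tau> 0 - \<rho>' \<tau> 0\<bar> = \<beta>0 \<tau>"
    using b0e bc by eventually_elim (auto simp: abs_minus_commute)
  have b1e': "AE \<tau> in lborel. \<tau> \<in> {0<..<T} \<longrightarrow> ennreal \<bar>\<xi> \<tau> 1 - \<xi>' \<tau> 1\<bar> = \<beta>1 \<tau>"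
    using b1e bc by eventually_elim (auto simp: abs_minus_commute)
  \<comment> \<open>The family \<open>\<xi>\<close> already travels to the right; \<open>\<rho>\<close> is reflected in \<open>x = 1 / 2\<close>.\<close>
  have rules: "characteristic_rules T a \<rho>0 \<xi>0 \<rho> \<xi>" "characteristic_rules T a \<rho>0 \<xi>0 \<rho>' \<xi>'"
    using sol sol' T by (auto simp: broad_solution_def broad_solution_on_def)
  note rules' = rules[unfolded characteristic_rules_def Let_def AE_lebesgue_on_iff[OF rectangle_borel]]
  have VX: "AE z in lborel. z \<in> ?\<Omega> \<longrightarrow> ennreal \<bar>\<xi> (fst z) (snd z) - \<xi>' (fst z) (snd z)\<bar> \<le>
      \<beta>0 (fst z - snd z) + (\<integral>\<^sup>+s\<in>{..fst z}. k s (snd z - fst z + s) \<partial>lborel)"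
  proof (rule transport_difference[where \<phi> = \<xi>0 and H = "\<lambda>t x. (1 / 2) * a t x * (\<rho> t x - \<xi> t x)"
        and H' = "\<lambda>t x. (1 / 2) * a t x * (\<rho>' t x - \<xi>' t x)" and hb = "G r q" and hb' = "G r' q'"])
    show "AE z in lborel. z \<in> ?\<Omega> \<longrightarrow> (case z of (t, x) \<Rightarrow>
        (t < x \<longrightarrow> \<xi> t x = \<xi>0 (x - t) + (LINT s|lebesgue_on {0..t}. (1 / 2) * a s (x - t + s) * (\<rho> s (x - t + s) - \<xi> s (x - t + s)))) \<and>
        (x < t \<longrightarrow> \<xi> t x = \<xi> (t - x) 0 + (LINT s|lebesgue_on {t - x..t}. (1 / 2) * a s (x - t + s) * (\<rho> s (x - t + s) - \<xi> s (x - t + s)))))"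
      using rules'(1) by eventually_elim auto
    show "AE z in lborel. z \<in> ?\<Omega> \<longrightarrow> (case z of (t, x) \<Rightarrow>
        (t < x \<longrightarrow> \<xi>' t x = \<xi>0 (x - t) + (LINT s|lebesgue_on {0..t}. (1 / 2) * a s (x - t + s) * (\<rho>' s (x - t + s) - \<xi>' s (x - t + s)))) \<and>
        (x < t \<longrightarrow> \<xi>' t x = \<xi>' (t - x) 0 + (LINT s|lebesgue_on {t - x..t}. (1 / 2) * a s (x - t + s) * (\<rho>' s (x - t + s) - \<xi>' s (x - t + s)))))"
      using rules'(2) by eventually_elim auto
    show "AE z in lborel. z \<in> ?\<Omega> \<longrightarrow>
        (1 / 2) * a (fst z) (snd z) * (\<rho> (fst z) (snd z) - \<xi> (fst z) (snd z)) = G r q (fst z) (snd z) \<and>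
        (1 / 2) * a (fst z) (snd z) * (\<rho>' (fst z) (snd z) - \<xi>' (fst z) (snd z)) = G r' q' (fst z) (snd z) \<and>
        ennreal \<bar>G r q (fst z) (snd z) - G r' q' (fst z) (snd z)\<bar> \<le> k (fst z) (snd z)"
      using r(3) r'(3) q(3) q'(3) h(3)
    proof eventually_elim
      case (elim z)
      then show ?case using Gk[of "fst z" "snd z"] by (auto simp: G_def)
    qed
    show "AE \<tau> in lborel. \<tau> \<in> {0<..<T} \<longrightarrow> ennreal \<bar>\<xi> \<tau> 0 - \<xi>' \<tau> 0\<bar> \<le> \<beta>0 \<tau>"
      using b0e by eventually_elim auto
  qed (intro Gm Gfin r q r' q')+
  have VR: "AE z in lborel. z \<in> ?\<Omega> \<longrightarrow> ennreal \<bar>\<rho> (fst z) (1 - snd z) - \<rho>' (fst z) (1 - snd z)\<bar> \<le>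
      \<beta>1 (fst z - snd z) + (\<integral>\<^sup>+s\<in>{..fst z}. k s (1 - (snd z - fst z + s)) \<partial>lborel)"
  proof (rule transport_difference[where \<eta> = "\<lambda>t x. \<rho> t (1 - x)" and \<eta>' = "\<lambda>t x. \<rho>' t (1 - x)" and \<phi> = "\<lambda>x. \<rho>0 (1 - x)"
        and H = "\<lambda>t x. - (1 / 2) * a t (1 - x) * (\<rho> t (1 - x) - \<xi> t (1 - x))"
        and H' = "\<lambda>t x. - (1 / 2) * a t (1 - x) * (\<rho>' t (1 - x) - \<xi>' t (1 - x))"
        and hb = "\<lambda>s y. - G r q s (1 - y)" and hb' = "\<lambda>s y. - G r' q' s (1 - y)" and k = "\<lambda>s y. k s (1 - y)"])
    have conv: "AE z in lborel. z \<in> ?\<Omega> \<longrightarrow> (case z of (t, x) \<Rightarrow>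
        (t < x \<longrightarrow> u t (1 - x) = \<rho>0 (1 - (x - t)) + (LINT s|lebesgue_on {0..t}. - (1 / 2) * a s (1 - (x - t + s)) * (u s (1 - (x - t + s)) - v s (1 - (x - t + s))))) \<and>
        (x < t \<longrightarrow> u t (1 - x) = u (t - x) (1 - 0) + (LINT s|lebesgue_on {t - x..t}. - (1 / 2) * a s (1 - (x - t + s)) * (u s (1 - (x - t + s)) - v s (1 - (x - t + s))))))"
      if uv: "characteristic_rules T a \<rho>0 \<xi>0 u v" for u v
    proof -
      define P where "P t x \<longleftrightarrow> ((t, x) \<in> ?\<Omega> \<longrightarrow>
         (x + t < 1 \<longrightarrow> u t x = \<rho>0 (x + t) + (LINT s|lebesgue_on {0..t}. - (1 / 2) * a s (x + t - s) * (u s (x + t - s) - v s (x + t - s)))) \<and>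
         (x + t > 1 \<longrightarrow> u t x = u (t + x - 1) 1 + (LINT s|lebesgue_on {t + x - 1..t}. - (1 / 2) * a s (x + t - s) * (u s (x + t - s) - v s (x + t - s)))))" for t x
      have "AE z in lborel. P (fst z) (snd z)"
        using uv[unfolded characteristic_rules_def Let_def AE_lebesgue_on_iff[OF rectangle_borel]]
        by eventually_elim (auto simp: P_def)
      from AE_lborel_reflect[OF this] show ?thesis
      proof eventually_elim
        case (elim z)
        obtain t x where z: "z = (t, x)" by (cases z)
        have e1: "1 - x + t = 1 - (x - t)" "t + (1 - x) - 1 = t - x" by simp_all
        have e2: "1 - (x - t) - s = 1 - (x - t + s)" for s by simp
        show ?case
          using elim unfolding z fst_conv snd_conv prod.case P_def e1 e2 by auto
      qed
    qed
    show "AE z in lborel. z \<in> ?\<Omega> \<longrightarrow> (case z of (t, x) \<Rightarrow>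
        (t < x \<longrightarrow> \<rho> t (1 - x) = \<rho>0 (1 - (x - t)) + (LINT s|lebesgue_on {0..t}. - (1 / 2) * a s (1 - (x - t + s)) * (\<rho> s (1 - (x - t + s)) - \<xi> s (1 - (x - t + s))))) \<and>
        (x < t \<longrightarrow> \<rho> t (1 - x) = \<rho> (t - x) (1 - 0) + (LINT s|lebesgue_on {t - x..t}. - (1 / 2) * a s (1 - (x - t + s)) * (\<rho> s (1 - (x - t + s)) - \<xi> s (1 - (x - t + s))))))"
      by (rule conv[OF rules(1)])
    show "AE z in lborel. z \<in> ?\<Omega> \<longrightarrow> (case z of (t, x) \<Rightarrow>
        (t < x \<longrightarrow> \<rho>' t (1 - x) = \<rho>0 (1 - (x - t)) + (LINT s|lebesgue_on {0..t}. - (1 / 2) * a s (1 - (x - t + s)) * (\<rho>' s (1 - (x - t + s)) - \<xi>' s (1 - (x - t + s))))) \<and>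
        (x < t \<longrightarrow> \<rho>' t (1 - x) = \<rho>' (t - x) (1 - 0) + (LINT s|lebesgue_on {t - x..t}. - (1 / 2) * a s (1 - (x - t + s)) * (\<rho>' s (1 - (x - t + s)) - \<xi>' s (1 - (x - t + s))))))"
      by (rule conv[OF rules(2)])
    define P where "P t x \<longleftrightarrow> ((t, x) \<in> ?\<Omega> \<longrightarrow> (1 / 2) * a t x * (\<rho> t x - \<xi> t x) = G r q t x \<and> (1 / 2) * a t x * (\<rho>' t x - \<xi>' t x) = G r' q' t x)" for t x
    have "AE z in lborel. P (fst z) (snd z)"
      using r(3) r'(3) q(3) q'(3) h(3) by eventually_elim (auto simp: G_def P_def)
    from AE_lborel_reflect[OF this]
    show "AE z in lborel. z \<in> ?\<Omega> \<longrightarrow>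
        - (1 / 2) * a (fst z) (1 - snd z) * (\<rho> (fst z) (1 - snd z) - \<xi> (fst z) (1 - snd z)) = - G r q (fst z) (1 - snd z) \<and>
        - (1 / 2) * a (fst z) (1 - snd z) * (\<rho>' (fst z) (1 - snd z) - \<xi>' (fst z) (1 - snd z)) = - G r' q' (fst z) (1 - snd z) \<and>
        ennreal \<bar>- G r q (fst z) (1 - snd z) - - G r' q' (fst z) (1 - snd z)\<bar> \<le> k (fst z) (1 - snd z)"
    proof eventually_elim
      case (elim z)
      have "\<bar>- G r q (fst z) (1 - snd z) - - G r' q' (fst z) (1 - snd z)\<bar> = \<bar>G r q (fst z) (1 - snd z) - G r' q' (fst z) (1 - snd z)\<bar>"
        by simp
      then show ?case using elim Gk[of "fst z" "1 - snd z"] by (auto simp: P_def)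
    qed
    show "AE \<tau> in lborel. \<tau> \<in> {0<..<T} \<longrightarrow> ennreal \<bar>\<rho> \<tau> (1 - 0) - \<rho>' \<tau> (1 - 0)\<bar> \<le> \<beta>1 \<tau>"
      using b1e by eventually_elim auto
    show "(\<lambda>(s, y). - G r q s (1 - y)) \<in> borel_measurable (borel \<Otimes>\<^sub>M borel)" "(\<lambda>(s, y). - G r' q' s (1 - y)) \<in> borel_measurable (borel \<Otimes>\<^sub>M borel)"
      unfolding split_beta' by measurable
    have "(\<integral>\<^sup>+y. ennreal \<bar>- f (1 - y)\<bar> \<partial>lborel) = (\<integral>\<^sup>+y. ennreal \<bar>f y\<bar> \<partial>lborel)"
      if [measurable]: "f \<in> borel_measurable borel" for f :: "real \<Rightarrow> real"
      using nn_integral_real_affine[of "\<lambda>y. ennreal \<bar>f y\<bar>" "-1" 1] by simp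
    then show "(\<integral>\<^sup>+s. (\<integral>\<^sup>+y. ennreal \<bar>- G r q s (1 - y)\<bar> \<partial>lborel) \<partial>lborel) < \<infinity>" "(\<integral>\<^sup>+s. (\<integral>\<^sup>+y. ennreal \<bar>- G r' q' s (1 - y)\<bar> \<partial>lborel) \<partial>lborel) < \<infinity>"
      using Gfin[OF r(1) q(1) r(4) q(4)] Gfin[OF r'(1) q'(1) r'(4) q'(4)] by simp_all
  qed
  have km': "(\<lambda>(s, y). k s (1 - y)) \<in> borel_measurable (borel \<Otimes>\<^sub>M borel)" unfolding split_beta' by measurable
  define A0 where "A0 t = (\<integral>\<^sup>+\<tau>\<in>{..t}. \<beta>0 \<tau> \<partial>lborel)" for t
  define A1 where "A1 t = (\<integral>\<^sup>+\<tau>\<in>{..t}. \<beta>1 \<tau> \<partial>lborel)" for t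
  have L1A: "L1_norm {0<..<t} f = (\<integral>\<^sup>+\<tau>\<in>{..t}. \<beta> \<tau> \<partial>lborel)"
    if "t \<le> T" "\<And>\<tau>. \<tau> \<notin> {0<..<T} \<Longrightarrow> \<beta> \<tau> = 0" "AE \<tau> in lborel. \<tau> \<in> {0<..<T} \<longrightarrow> ennreal \<bar>f \<tau>\<bar> = \<beta> \<tau>" for t f and \<beta> :: "real \<Rightarrow> ennreal"
  proof -
    have "L1_norm {0<..<t} f = (\<integral>\<^sup>+\<tau>\<in>{0<..<t}. ennreal \<bar>f \<tau>\<bar> \<partial>lborel)" by (simp add: L1_norm_def nn_integral_lebesgue_on)
    also have "\<dots> = (\<integral>\<^sup>+\<tau>\<in>{..t}. \<beta> \<tau> \<partial>lborel)"
    proof (rule nn_integral_cong_AE)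
      show "AE \<tau> in lborel. ennreal \<bar>f \<tau>\<bar> * indicator {0<..<t} \<tau> = \<beta> \<tau> * indicator {..t} \<tau>"
        using that(3) AE_lborel_singleton[of t] by eventually_elim (use that(1,2) in \<open>auto simp: indicator_def\<close>)
    qed
    finally show ?thesis .
  qed
  have step1: "A1 t \<le> A0 (t - 1 / 2) + W t" if t: "0 < t" "t \<le> T" for t
  proof -
    have "L1_norm {0<..<t} (\<lambda>\<tau>. \<xi> \<tau> 1 - \<xi>' \<tau> 1) \<le> A0 (t - 1 / 2) + W t"
      unfolding A0_def W_def \<Theta>_def
    proof (rule outflow_trace_bound[OF km b0, where u = "\<lambda>t x. \<xi> t x - \<xi>' t x"])
      show "continuous_into_L1 {0..1} {0<..<t} (\<lambda>x t. \<xi> t x - \<xi>' t x)"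
        by (intro continuous_into_L1_diff cL(4)[OF ss(1)[OF t(1)] t(1)] cL(4)[OF ss(2)[OF t(1)] t(1)])
      show "AE z in lborel. z \<in> {0<..<t} \<times> {0<..<1} \<longrightarrow> ennreal \<bar>\<xi> (fst z) (snd z) - \<xi>' (fst z) (snd z)\<bar> \<le>
          \<beta>0 (fst z - snd z) + (\<integral>\<^sup>+s\<in>{..fst z}. k s (snd z - fst z + s) \<partial>lborel)"
        using VX by eventually_elim (use t in auto)
    qed
    then show ?thesis using L1A[OF t(2) b1z b1e'] by (simp add: A1_def)
  qed
  have step0: "A0 t \<le> A1 (t - 1 / 2) + W t" if t: "0 < t" "t \<le> T" for t
  proof -
    have "L1_norm {0<..<t} (\<lambda>\<tau>. \<rho> \<tau> (1 - 1) - \<rho>' \<tau> (1 - 1)) \<le> A1 (t - 1 / 2) + W t"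
      unfolding A1_def W_def reflk[symmetric]
    proof (rule outflow_trace_bound[OF km' b1, where u = "\<lambda>t x. \<rho> t (1 - x) - \<rho>' t (1 - x)"])
      have "continuous_into_L1 {0..1} {0<..<t} (\<lambda>x t. \<rho> t x - \<rho>' t x)"
        by (intro continuous_into_L1_diff cL(3)[OF ss(1)[OF t(1)] t(1)] cL(3)[OF ss(2)[OF t(1)] t(1)])
      from continuous_into_L1_reflect[OF this]
      show "continuous_into_L1 {0..1} {0<..<t} (\<lambda>x t. \<rho> t (1 - x) - \<rho>' t (1 - x))" .
      show "AE z in lborel. z \<in> {0<..<t} \<times> {0<..<1} \<longrightarrow> ennreal \<bar>\<rho> (fst z) (1 - snd z) - \<rho>' (fst z) (1 - snd z)\<bar> \<le>
          \<beta>1 (fst z - snd z) + (\<integral>\<^sup>+s\<in>{..fst z}. k s (1 - (snd z - fst z + s)) \<partial>lborel)"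
        using VR by eventually_elim (use t in auto)
    qed
    then show ?thesis using L1A[OF t(2) b0z b0e'] by (simp add: A0_def)
  qed
  have Wmono: "W s \<le> W t" if "s \<le> t" for s t
    unfolding W_def using that by (intro nn_integral_mono) (auto simp: indicator_def)
  have A0neg: "A0 t = 0" if "t \<le> 0" for t
  proof -
    have "A0 t = integral\<^sup>N lborel (\<lambda>s::real. 0)"
      unfolding A0_def using that b0z by (intro nn_integral_cong) (auto simp: indicator_def)
    then show ?thesis by simp
  qed
  have A1neg: "A1 t = 0" if "t \<le> 0" for t
  proof -
    have "A1 t = integral\<^sup>N lborel (\<lambda>s::real. 0)"
      unfolding A1_def using that b1z by (intro nn_integral_cong) (auto simp: indicator_def)
    then show ?thesis by simp
  qed
  obtain K where K: "0 \<le> K" "\<And>t. t \<le> T \<Longrightarrow> A0 t + A1 t \<le> ennreal K * W t"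
    using two_sided_iteration[of A0 A1 W T, OF A0neg A1neg Wmono step1 step0] by blast
  have k0: "k s y = 0" if "(s, y) \<notin> ?\<Omega>" for s y
    using r(2)[OF that] r'(2)[OF that] q(2)[OF that] q'(2)[OF that] by (simp add: k_def)
  have \<Theta>0: "\<Theta> t = 0" if "t \<notin> {0<..<T}" for t
  proof -
    have "k t y = 0" for y using that by (intro k0) auto
    then show ?thesis by (simp add: \<Theta>_def)
  qed
  have slices: "AE t in lborel. AE x in lborel. (t, x) \<in> ?\<Omega> \<longrightarrow> \<xi> t x - \<xi>' t x = q t x - q' t x"
  proof (rule AE_lborel_Pair)
    show "AE z in lborel. (fst z, snd z) \<in> ?\<Omega> \<longrightarrow> \<xi> (fst z) (snd z) - \<xi>' (fst z) (snd z) = q (fst z) (snd z) - q' (fst z) (snd z)"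
      using q(3) q'(3) by eventually_elim auto
  qed
  have slicesR: "AE t in lborel. AE x in lborel. (t, 1 - x) \<in> ?\<Omega> \<longrightarrow> \<rho> t (1 - x) - \<rho>' t (1 - x) = r t (1 - x) - r' t (1 - x)"
  proof (rule AE_lborel_Pair, rule AE_lborel_reflect)
    show "AE z in lborel. (fst z, snd z) \<in> ?\<Omega> \<longrightarrow> \<rho> (fst z) (snd z) - \<rho>' (fst z) (snd z) = r (fst z) (snd z) - r' (fst z) (snd z)"
      using r(3) r'(3) by eventually_elim auto
  qed
  have le: "AE t in lborel. \<Theta> t \<le> ennreal (M / 2 * (K + 2)) * W t"
    using slices slicesR transport_L1_bounds(1)[OF km b0 VX] transport_L1_bounds(1)[OF km' b1 VR]
  proof eventually_elim
    case (elim t)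
    show ?case
    proof (cases "t \<in> {0<..<T}")
      case True
      have "(\<integral>\<^sup>+y. ennreal \<bar>q t y - q' t y\<bar> \<partial>lborel) = (\<integral>\<^sup>+x\<in>{0<..<1}. ennreal \<bar>\<xi> t x - \<xi>' t x\<bar> \<partial>lborel)"
      proof (rule nn_integral_cong_AE)
        show "AE y in lborel. ennreal \<bar>q t y - q' t y\<bar> = ennreal \<bar>\<xi> t y - \<xi>' t y\<bar> * indicator {0<..<1} y"
          using elim(1) by eventually_elim (use True q(2) q'(2) in \<open>auto simp: indicator_def\<close>)
      qed
      also have "\<dots> \<le> A0 t + W t" using elim(3) True by (simp add: A0_def W_def \<Theta>_def)
      finally have X: "(\<integral>\<^sup>+y. ennreal \<bar>q t y - q' t y\<bar> \<partial>lborel) \<le> A0 t + W t" .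
      have "(\<integral>\<^sup>+y. ennreal \<bar>r t y - r' t y\<bar> \<partial>lborel) = (\<integral>\<^sup>+y. ennreal \<bar>r t (1 - y) - r' t (1 - y)\<bar> \<partial>lborel)"
        using nn_integral_real_affine[of "\<lambda>y. ennreal \<bar>r t y - r' t y\<bar>" "-1" 1] by simp
      also have "\<dots> = (\<integral>\<^sup>+x\<in>{0<..<1}. ennreal \<bar>\<rho> t (1 - x) - \<rho>' t (1 - x)\<bar> \<partial>lborel)"
      proof (rule nn_integral_cong_AE)
        show "AE y in lborel. ennreal \<bar>r t (1 - y) - r' t (1 - y)\<bar> = ennreal \<bar>\<rho> t (1 - y) - \<rho>' t (1 - y)\<bar> * indicator {0<..<1} y"
          using elim(2) by eventually_elim (use True r(2) r'(2) in \<open>auto simp: indicator_def\<close>)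
      qed
      also have "\<dots> \<le> A1 t + W t" using elim(4) True by (simp add: A1_def W_def reflk)
      finally have R: "(\<integral>\<^sup>+y. ennreal \<bar>r t y - r' t y\<bar> \<partial>lborel) \<le> A1 t + W t" .
      have "\<Theta> t = ennreal (M / 2) * ((\<integral>\<^sup>+y. ennreal \<bar>r t y - r' t y\<bar> \<partial>lborel) + (\<integral>\<^sup>+y. ennreal \<bar>q t y - q' t y\<bar> \<partial>lborel))"
        unfolding \<Theta>_def k_def by (simp add: nn_integral_cmult nn_integral_add)
      also have "\<dots> \<le> ennreal (M / 2) * ((A1 t + W t) + (A0 t + W t))"
        by (intro mult_left_mono add_mono X R) auto
      also have "(A1 t + W t) + (A0 t + W t) = (A0 t + A1 t) + 2 * W t" by (simp only: mult_2 add_ac)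
      also have "ennreal (M / 2) * ((A0 t + A1 t) + 2 * W t) \<le> ennreal (M / 2) * (ennreal K * W t + 2 * W t)"
        using K(2)[of t] True by (intro mult_left_mono add_right_mono) auto
      also have "\<dots> = ennreal (M / 2 * (K + 2)) * W t"
      proof -
        have "ennreal (K + 2) = ennreal K + 2" using K by (subst ennreal_plus) auto
        then show ?thesis using M K by (simp only: ennreal_mult' add_nonneg_nonneg zero_le_numeral distrib_right mult.assoc)
      qed
      finally show ?thesis .
    qed (simp add: \<Theta>0)
  qed
  have fin: "(\<integral>\<^sup>+s. \<Theta> s \<partial>lborel) < \<infinity>"
  proof -
    have "(\<integral>\<^sup>+s. \<Theta> s \<partial>lborel) \<le> (\<integral>\<^sup>+s. (\<integral>\<^sup>+y. ennreal (M / 2) * ((ennreal \<bar>r s y\<bar> + ennreal \<bar>r' s y\<bar>) + (ennreal \<bar>q s y\<bar> + ennreal \<bar>q' s y\<bar>)) \<partial>lborel) \<partial>lborel)"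
      unfolding \<Theta>_def k_def
      by (intro nn_integral_mono mult_left_mono add_mono) (simp_all flip: ennreal_plus add: ennreal_leI)
    also have "\<dots> = ennreal (M / 2) * (((\<integral>\<^sup>+s. (\<integral>\<^sup>+y. ennreal \<bar>r s y\<bar> \<partial>lborel) \<partial>lborel) + (\<integral>\<^sup>+s. (\<integral>\<^sup>+y. ennreal \<bar>r' s y\<bar> \<partial>lborel) \<partial>lborel)) +
       ((\<integral>\<^sup>+s. (\<integral>\<^sup>+y. ennreal \<bar>q s y\<bar> \<partial>lborel) \<partial>lborel) + (\<integral>\<^sup>+s. (\<integral>\<^sup>+y. ennreal \<bar>q' s y\<bar> \<partial>lborel) \<partial>lborel)))"
      by (simp add: nn_integral_cmult nn_integral_add)
    also have "\<dots> < \<infinity>" using r(4) r'(4) q(4) q'(4) by (simp add: ennreal_mult_less_top)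
    finally show ?thesis .
  qed
  have "W T = 0"
    unfolding W_def
  proof (rule gronwall_zero[of \<Theta> "M / 2 * (K + 2)"])
    show "\<And>t. t \<le> 0 \<Longrightarrow> \<Theta> t = 0" by (intro \<Theta>0) auto
  qed (use M K fin le in \<open>auto simp: W_def\<close>)
  also have "W T = (\<integral>\<^sup>+s. \<Theta> s \<partial>lborel)"
    unfolding W_def using \<Theta>0 by (intro nn_integral_cong) (auto simp: indicator_def)
  also have "\<dots> = (\<integral>\<^sup>+z. case_prod k z \<partial>(lborel \<Otimes>\<^sub>M lborel))"
    unfolding \<Theta>_def by (subst lborel.nn_integral_fst[symmetric]) (use km in auto)
  finally have "AE z in lborel \<Otimes>\<^sub>M lborel. case_prod k z = 0"
    using km by (subst (asm) nn_integral_0_iff_AE) auto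
  then have "AE z in lborel. case_prod k z = 0" unfolding lborel_prod .
  then show ?thesis
    using r(3) r'(3) q(3) q'(3)
  proof eventually_elim
    case (elim z)
    have "ennreal \<bar>r (fst z) (snd z) - r' (fst z) (snd z)\<bar> = 0 \<and> ennreal \<bar>q (fst z) (snd z) - q' (fst z) (snd z)\<bar> = 0"
      using elim(1) M by (auto simp: k_def split_beta')
    then show ?case using elim by auto
  qed
qed

text \<open>
  Equality almost everywhere in the plane gives equality of almost all slices, and continuity of the traces
  gives equality of all of them.
\<close>

lemma broad_solution_unique:
  assumes p: "1 < p" and M: "0 < M"
    and a: "(\<lambda>(t, x). a t x) \<in> borel_measurable (lebesgue_on ({0<..} \<times> {0<..<1}))"
    and a_bd: "AE z in lborel. z \<in> {0<..} \<times> {0<..<1} \<longrightarrow> \<bar>a (fst z) (snd z)\<bar> \<le> M"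
    and sol: "broad_solution p a \<rho>0 \<xi>0 \<rho> \<xi>" and sol': "broad_solution p a \<rho>0 \<xi>0 \<rho>' \<xi>'"
  shows "same_solution \<rho> \<xi> \<rho>' \<xi>'"
proof -
  have ss: "solution_space p t \<rho> \<xi>" "solution_space p t \<rho>' \<xi>'" if "0 < t" for t
    using sol sol' that by (auto simp: broad_solution_def broad_solution_on_def)
  have cL: "continuous_into_L1 {0..t} {0<..<1} (\<lambda>r x. \<rho> r x - \<rho>' r x)" "continuous_into_L1 {0..t} {0<..<1} (\<lambda>r x. \<xi> r x - \<xi>' r x)"
    "continuous_into_L1 {0..1} {0<..<t} (\<lambda>x s. \<rho> s x - \<rho>' s x)" "continuous_into_L1 {0..1} {0<..<t} (\<lambda>x s. \<xi> s x - \<xi>' s x)"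
    if t: "0 < t" for t
    using ss[OF t] t unfolding solution_space_def
    by (auto intro!: continuous_into_L1_diff intro: continuous_into_Lp_imp_L1[OF p])
  have zero: "AE x in lebesgue_on S. u x = v x"
    if "continuous_into_L1 I S w" "r \<in> I" "w r = (\<lambda>x. u x - v x)" and
      near: "\<And>d. 0 < d \<Longrightarrow> \<exists>s\<in>I. s \<noteq> r \<and> \<bar>s - r\<bar> < d \<and> L1_norm S (w s) \<le> 0" for I S w r u v
  proof -
    have "L1_norm S (w r) \<le> 0" by (rule continuous_into_L1_limit_bound[OF that(1,2) near])
    moreover have "w r \<in> borel_measurable (lebesgue_on S)" using that by (auto simp: continuous_into_L1_def)
    ultimately have "AE x in lebesgue_on S. ennreal \<bar>w r x\<bar> = 0"
      unfolding L1_norm_def by (subst nn_integral_0_iff_AE[symmetric]) auto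
    then show ?thesis by eventually_elim (simp add: that)
  qed
  have slice0: "L1_norm S f \<le> 0" if "AE x in lborel. x \<in> S \<longrightarrow> f x = 0" "S \<in> sets borel" for S f
  proof -
    have "L1_norm S f = (\<integral>\<^sup>+x. 0 \<partial>lebesgue_on S)"
      unfolding L1_norm_def by (rule nn_integral_cong_AE) (use that in \<open>simp add: AE_lebesgue_on_iff\<close>)
    then show ?thesis by simp
  qed
  have eq: "AE z in lborel. (\<lambda>t x. (t, x) \<in> {0<..<T} \<times> {0<..<1} \<longrightarrow> \<rho> t x = \<rho>' t x \<and> \<xi> t x = \<xi>' t x) (fst z) (snd z)" if "0 < T" for T
    using broad_solution_AE_unique[OF p that M a a_bd sol sol'] by simp
  have time: "AE x in lebesgue_on {0<..<1}. \<rho> t x = \<rho>' t x \<and> \<xi> t x = \<xi>' t x" if t: "0 \<le> t" for t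
  proof -
    have T: "0 < t + 1" using t by simp
    have good: "AE s in lborel. s \<in> {0<..<t + 1} \<longrightarrow>
        L1_norm {0<..<1} (\<lambda>x. \<rho> s x - \<rho>' s x) \<le> 0 \<and> L1_norm {0<..<1} (\<lambda>x. \<xi> s x - \<xi>' s x) \<le> 0"
      using AE_lborel_Pair[OF eq[OF T]]
    proof eventually_elim
      case (elim s)
      show ?case
      proof (intro impI conjI slice0)
        assume s: "s \<in> {0<..<t + 1}"
        show "AE x in lborel. x \<in> {0<..<1} \<longrightarrow> \<rho> s x - \<rho>' s x = 0" "AE x in lborel. x \<in> {0<..<1} \<longrightarrow> \<xi> s x - \<xi>' s x = 0"
          using elim by (eventually_elim, use s in auto)+
      qed auto
    qed
    have near: "\<exists>s\<in>{0..t + 1}. s \<noteq> t \<and> \<bar>s - t\<bar> < d \<and>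
        L1_norm {0<..<1} (\<lambda>x. \<rho> s x - \<rho>' s x) \<le> 0 \<and> L1_norm {0<..<1} (\<lambda>x. \<xi> s x - \<xi>' s x) \<le> 0" if d: "0 < d" for d
    proof -
      have "t < min (t + d) (t + 1)" using d by simp
      from AE_lborel_witness[OF good this] obtain s where "t < s" "s < min (t + d) (t + 1)"
        "s \<in> {0<..<t + 1} \<longrightarrow> L1_norm {0<..<1} (\<lambda>x. \<rho> s x - \<rho>' s x) \<le> 0 \<and> L1_norm {0<..<1} (\<lambda>x. \<xi> s x - \<xi>' s x) \<le> 0" by auto
      then show ?thesis using t by (intro bexI[of _ s]) auto
    qed
    have "AE x in lebesgue_on {0<..<1}. \<rho> t x = \<rho>' t x"
      by (rule zero[OF cL(1)[OF T], where r = t, OF _ refl]) (use t in simp, use near in blast)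
    moreover have "AE x in lebesgue_on {0<..<1}. \<xi> t x = \<xi>' t x"
      by (rule zero[OF cL(2)[OF T], where r = t, OF _ refl]) (use t in simp, use near in blast)
    ultimately show ?thesis by eventually_elim simp
  qed
  have space: "AE t in lebesgue_on {0<..}. \<rho> t x = \<rho>' t x \<and> \<xi> t x = \<xi>' t x" if x: "x \<in> {0..1}" for x
  proof -
    have "AE t in lborel. t \<in> {0<..<T} \<longrightarrow> \<rho> t x = \<rho>' t x \<and> \<xi> t x = \<xi>' t x" if T: "0 < T" for T
    proof -
      have good: "AE y in lborel. y \<in> {0<..<1} \<longrightarrow>
          L1_norm {0<..<T} (\<lambda>s. \<rho> s y - \<rho>' s y) \<le> 0 \<and> L1_norm {0<..<T} (\<lambda>s. \<xi> s y - \<xi>' s y) \<le> 0"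
        using AE_lborel_Pair[OF AE_lborel_swap[OF eq[OF T]]]
      proof eventually_elim
        case (elim y)
        show ?case
        proof (intro impI conjI slice0)
          assume y: "y \<in> {0<..<1}"
          show "AE s in lborel. s \<in> {0<..<T} \<longrightarrow> \<rho> s y - \<rho>' s y = 0" "AE s in lborel. s \<in> {0<..<T} \<longrightarrow> \<xi> s y - \<xi>' s y = 0"
            using elim by (eventually_elim, use y in auto)+
        qed auto
      qed
      have near: "\<exists>y\<in>{0..1}. y \<noteq> x \<and> \<bar>y - x\<bar> < d \<and>
          L1_norm {0<..<T} (\<lambda>s. \<rho> s y - \<rho>' s y) \<le> 0 \<and> L1_norm {0<..<T} (\<lambda>s. \<xi> s y - \<xi>' s y) \<le> 0" if d: "0 < d" for d
      proof -
        \<comment> \<open>An interval inside \<open>(0, 1)\<close> next to \<open>x\<close>, on the left of it only if \<open>x = 1\<close>.\<close>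
        define lo hi where "lo = (if x < 1 then x else max 0 (1 - d))" and "hi = (if x < 1 then min 1 (x + d) else 1)"
        have "lo < hi" using x d by (auto simp: lo_def hi_def)
        from AE_lborel_witness[OF good this] obtain y where y: "y \<in> {lo<..<hi}"
          "y \<in> {0<..<1} \<longrightarrow> L1_norm {0<..<T} (\<lambda>s. \<rho> s y - \<rho>' s y) \<le> 0 \<and> L1_norm {0<..<T} (\<lambda>s. \<xi> s y - \<xi>' s y) \<le> 0" by blast
        then show ?thesis using x d by (intro bexI[of _ y]) (auto simp: lo_def hi_def split: if_splits)
      qed
      have "AE t in lebesgue_on {0<..<T}. \<rho> t x = \<rho>' t x"
        by (rule zero[OF cL(3)[OF T] x refl]) (use near in blast)
      moreover have "AE t in lebesgue_on {0<..<T}. \<xi> t x = \<xi>' t x"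
        by (rule zero[OF cL(4)[OF T] x refl]) (use near in blast)
      ultimately have "AE t in lebesgue_on {0<..<T}. \<rho> t x = \<rho>' t x \<and> \<xi> t x = \<xi>' t x" by eventually_elim simp
      moreover have iff: "(AE t in lebesgue_on {0<..<T}. P t) \<longleftrightarrow> (AE t in lborel. t \<in> {0<..<T} \<longrightarrow> P t)" for P :: "real \<Rightarrow> bool"
        by (rule AE_lebesgue_on_iff) simp
      ultimately show ?thesis by (simp only: iff)
    qed
    then have "AE t in lborel. \<forall>n::nat. t \<in> {0<..<real n + 1} \<longrightarrow> \<rho> t x = \<rho>' t x \<and> \<xi> t x = \<xi>' t x"
      by (subst AE_all_countable) auto
    then have "AE t in lborel. t \<in> {0<..} \<longrightarrow> \<rho> t x = \<rho>' t x \<and> \<xi> t x = \<xi>' t x"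
    proof eventually_elim
      case (elim t)
      obtain n :: nat where "t < real n" using reals_Archimedean2 by blast
      then show ?case using elim[rule_format, of n] by auto
    qed
    moreover have iff: "(AE t in lebesgue_on {0<..}. P t) \<longleftrightarrow> (AE t in lborel. t \<in> {0<..} \<longrightarrow> P t)" for P :: "real \<Rightarrow> bool"
      by (rule AE_lebesgue_on_iff) simp
    ultimately show ?thesis by (simp only: iff)
  qed
  show ?thesis unfolding same_solution_def using time space by auto
qed

section \<open>Well-posedness and exponential decay\<close>

text \<open>
  The even, two-periodic function that is the identity on \<open>[0, 1]\<close>.
\<close>

definition triangle_wave :: "real \<Rightarrow> real" where
  "triangle_wave y = arccos (cos (pi * y)) / pi"

lemma triangle_wave_id: "0 \<le> y \<Longrightarrow> y \<le> 1 \<Longrightarrow> triangle_wave y = y"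
  by (simp add: triangle_wave_def arccos_cos)

lemma triangle_wave_minus: "triangle_wave (- y) = triangle_wave y"
  by (simp add: triangle_wave_def)

lemma triangle_wave_periodic: "triangle_wave (y + 2) = triangle_wave y"
  using cos_periodic[of "pi * y"] by (simp add: triangle_wave_def distrib_left mult.commute[of pi 2])

lemma triangle_wave_measurable [measurable]: "triangle_wave \<in> borel_measurable borel"
proof -
  have "continuous_on UNIV (\<lambda>y. arccos (cos (pi * y)) / pi)"
    by (intro continuous_on_divide continuous_on_arccos continuous_intros) auto
  then show ?thesis unfolding triangle_wave_def[abs_def] by (rule borel_measurable_continuous_onI)
qed

text \<open>
  If the essential supremum were \<open>- \<infinity>\<close>, almost no point would lie in \<open>D\<close>;
  so it does no harm that its conversion to a real number sends infinite values to zero.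
\<close>

lemma Linf_bound:
  assumes "(\<lambda>(t, x). a t x) \<in> Linf_space D" "D \<in> sets borel"
  shows "AE z in lborel. z \<in> D \<longrightarrow> \<bar>a (fst z) (snd z)\<bar> \<le> Linf_norm D (\<lambda>(t, x). a t x)"
proof -
  let ?E = "esssup (lebesgue_on D) (\<lambda>z. ereal \<bar>case z of (t, x) \<Rightarrow> a t x\<bar>)"
  have "AE z in lebesgue_on D. ereal \<bar>case z of (t, x) \<Rightarrow> a t x\<bar> \<le> ?E" by (rule esssup_AE)
  moreover have "?E < \<infinity>" using assms(1) by (simp add: Linf_space_def)
  ultimately have "AE z in lebesgue_on D. \<bar>a (fst z) (snd z)\<bar> \<le> real_of_ereal ?E"
    by (elim eventually_mono) (cases ?E; auto simp: split_beta')
  then show ?thesis using assms(2) by (simp add: AE_lebesgue_on_iff Linf_norm_def)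
qed

lemma Lp_pair_norm_cong_AE:
  assumes "u \<in> borel_measurable (lebesgue_on S)" "v \<in> borel_measurable (lebesgue_on S)"
    "u' \<in> borel_measurable (lebesgue_on S)" "v' \<in> borel_measurable (lebesgue_on S)"
    and eq: "AE x in lebesgue_on S. u x = u' x \<and> v x = v' x"
  shows "Lp_pair_norm p S u v = Lp_pair_norm p S u' v'"
proof -
  have "(LINT x|lebesgue_on S. \<bar>u x\<bar> powr p + \<bar>v x\<bar> powr p) = (LINT x|lebesgue_on S. \<bar>u' x\<bar> powr p + \<bar>v' x\<bar> powr p)"
    by (rule integral_cong_AE) (use assms(1-4) in measurable, use eq in \<open>eventually_elim, simp\<close>)
  then show ?thesis by (simp add: Lp_pair_norm_def)
qed

text \<open>
  The coefficient is replaced by a Borel function with the required bounds at every point and extended to the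
  circle by means of the triangle wave. The initial value on the circle is \<open>\<rho>0\<close> on
  \<open>(0, 1)\<close> and, by the sign of the sine, the negative of the reflection of \<open>\<xi>0\<close>
  on \<open>(-1, 0)\<close>.
\<close>

lemma ex_flow_solution:
  fixes a :: "real \<Rightarrow> real \<Rightarrow> real"
  assumes p: "1 < p" and lam: "0 < lam" "lam \<le> M"
    and a: "(\<lambda>(t, x). a t x) \<in> borel_measurable (lebesgue_on ({0<..} \<times> {0<..<1}))"
    and a_bd: "AE z in lborel. z \<in> {0<..} \<times> {0<..<1} \<longrightarrow> \<bar>a (fst z) (snd z)\<bar> \<le> M"
    and a_nn: "AE z in lborel. z \<in> {0<..} \<times> {0<..<1} \<longrightarrow> 0 \<le> a (fst z) (snd z)"
    and strip: "0 \<le> x0 - \<epsilon>" "x0 + \<epsilon> \<le> 1"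
    and a_lam: "AE z in lborel. z \<in> {0<..} \<times> {x0 - \<epsilon><..<x0 + \<epsilon>} \<longrightarrow> lam \<le> a (fst z) (snd z)"
    and rho0: "\<rho>0 \<in> Lp_space p {0<..<1}" and xi0: "\<xi>0 \<in> Lp_space p {0<..<1}"
  shows "\<exists>b g. circle_flow_Lp b M g p \<and> (\<forall>x y. 0 \<le> x \<longrightarrow> y \<in> {x0 - \<epsilon><..<x0 + \<epsilon>} \<longrightarrow> lam \<le> b x (x + y)) \<and>
    broad_solution p a \<rho>0 \<xi>0 (\<lambda>t x. g t (x + t)) (\<lambda>t x. - g t (t - x)) \<and>
    Lp_pair_norm p {0<..<1} \<rho>0 \<xi>0 = enn2real (circle_energy p (g 0)) powr (1 / p)"
proof -
  obtain h where h: "case_prod h \<in> borel_measurable (borel \<Otimes>\<^sub>M borel)" "\<And>t x. \<bar>h t x\<bar> \<le> M"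
    "AE z in lborel. z \<in> {0<..} \<times> {0<..<1} \<longrightarrow> a (fst z) (snd z) = h (fst z) (snd z)"
    using damping_borel_representative[OF a a_bd] lam by auto
  note [measurable (raw)] = measurable_binary[OF h(1)]
  define \<alpha> where "\<alpha> t y = max (if y \<in> {x0 - \<epsilon><..<x0 + \<epsilon>} then lam else 0) (h t y)" for t y
  have am: "case_prod \<alpha> \<in> borel_measurable (borel \<Otimes>\<^sub>M borel)"
    unfolding \<alpha>_def[abs_def] split_beta' greaterThanLessThan_iff by measurable
  note [measurable (raw)] = measurable_binary[OF am]
  define b where "b s z = \<alpha> s (triangle_wave (z - s))" for s z
  have damp: "damping b M"
  proof
    show "case_prod b \<in> borel_measurable (borel \<Otimes>\<^sub>M borel)"
      unfolding b_def[abs_def] split_beta' by measurable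
    show "0 \<le> b s z" for s z using lam by (auto simp: b_def \<alpha>_def)
    show "b s z \<le> M" for s z using lam h(2)[of s "triangle_wave (z - s)"] by (auto simp: b_def \<alpha>_def abs_le_iff)
    show "0 < M" using lam by simp
    show "b s (z + 2) = b s z" for s z
      using triangle_wave_periodic[of "z - s"] by (simp add: b_def algebra_simps)
    show "b s (2 * s - z) = b s z" for s z
      using triangle_wave_minus[of "z - s"] by (simp add: b_def)
  qed
  then interpret damping b M .
  have b_id: "b s (y + s) = \<alpha> s y" if "0 \<le> y" "y \<le> 1" for s y
    using that by (simp add: b_def triangle_wave_id)
  have b_strip: "lam \<le> b x (x + y)" if "y \<in> {x0 - \<epsilon><..<x0 + \<epsilon>}" for x y
    using that strip b_id[of y x] by (simp add: \<alpha>_def add.commute)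
  have ab: "AE z in lborel. 0 < fst z \<and> snd z \<in> {0<..<1} \<longrightarrow> a (fst z) (snd z) = b (fst z) (snd z + fst z)"
    using h(3) a_nn a_lam
  proof eventually_elim
    case (elim z)
    show ?case
    proof
      assume z: "0 < fst z \<and> snd z \<in> {0<..<1}"
      then have zD: "z \<in> {0<..} \<times> {0<..<1}" by (auto simp: mem_Times_iff)
      have "b (fst z) (snd z + fst z) = \<alpha> (fst z) (snd z)" using z by (intro b_id) auto
      also have "\<dots> = a (fst z) (snd z)"
        using elim zD z by (auto simp: \<alpha>_def mem_Times_iff max_def split: if_splits)
      finally show "a (fst z) (snd z) = b (fst z) (snd z + fst z)" ..
    qed
  qed
  have S: "{0<..<1::real} \<in> sets borel" by simp
  have rm: "\<rho>0 \<in> borel_measurable (lebesgue_on {0<..<1})" and xm: "\<xi>0 \<in> borel_measurable (lebesgue_on {0<..<1})"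
    using rho0 xi0 by (auto simp: Lp_space_def)
  obtain r where r[measurable]: "r \<in> borel_measurable borel" and re: "AE x in lborel. x \<in> {0<..<1} \<longrightarrow> \<rho>0 x = r x"
    using borel_representative[OF rm S] by blast
  obtain q where q[measurable]: "q \<in> borel_measurable borel" and qe: "AE x in lborel. x \<in> {0<..<1} \<longrightarrow> \<xi>0 x = q x"
    using borel_representative[OF xm S] by blast
  define f where "f z = (if 0 \<le> sin (pi * z) then r (triangle_wave z) else - q (triangle_wave z))" for z
  have fm[measurable]: "f \<in> borel_measurable borel" unfolding f_def[abs_def] by measurable
  have fper: "f (z + 2) = f z" for z
    using sin_periodic[of "pi * z"] by (simp add: f_def triangle_wave_periodic distrib_left mult.commute[of pi 2])
  have f_pos: "f x = r x" and f_neg: "f (- x) = - q x" if "x \<in> {0<..<1}" for x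
  proof -
    have "0 < sin (pi * x)" using that by (intro sin_gt_zero) auto
    then show "f x = r x" "f (- x) = - q x" using that by (auto simp: f_def triangle_wave_id triangle_wave_minus)
  qed
  have fin: "(\<integral>\<^sup>+x\<in>{0<..<1}. ennreal (\<bar>u x\<bar> powr p) \<partial>lborel) < \<infinity>" if "u \<in> Lp_space p {0<..<1}" for u
    using that by (simp add: Lp_space_def integrable_iff_bounded nn_integral_lebesgue_on)
  have E: "circle_energy p f = (\<integral>\<^sup>+x\<in>{0<..<1}. ennreal (\<bar>\<rho>0 x\<bar> powr p) \<partial>lborel) + (\<integral>\<^sup>+x\<in>{0<..<1}. ennreal (\<bar>\<xi>0 x\<bar> powr p) \<partial>lborel)"
  proof -
    have "(\<integral>\<^sup>+x\<in>{0<..<1}. ennreal (\<bar>f x\<bar> powr p) \<partial>lborel) = (\<integral>\<^sup>+x\<in>{0<..<1}. ennreal (\<bar>\<rho>0 x\<bar> powr p) \<partial>lborel)"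
      by (rule nn_integral_cong_AE) (use re in \<open>eventually_elim, use f_pos in \<open>auto simp: indicator_def\<close>\<close>)
    moreover have "(\<integral>\<^sup>+x\<in>{0<..<1}. ennreal (\<bar>f (- x)\<bar> powr p) \<partial>lborel) = (\<integral>\<^sup>+x\<in>{0<..<1}. ennreal (\<bar>\<xi>0 x\<bar> powr p) \<partial>lborel)"
      by (rule nn_integral_cong_AE) (use qe in \<open>eventually_elim, use f_neg in \<open>auto simp: indicator_def\<close>\<close>)
    ultimately show ?thesis by (simp add: circle_energy_split[OF fm fper])
  qed
  have Efin: "circle_energy p f < \<infinity>" unfolding E using fin[OF rho0] fin[OF xi0] by simp
  have "(\<integral>\<^sup>+z\<in>{0..<2}. ennreal \<bar>f z\<bar> \<partial>lborel) \<le> (\<integral>\<^sup>+z. indicator {0..<2} z + ennreal (\<bar>f z\<bar> powr p) * indicator {0..<2} z \<partial>lborel)"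
  proof (rule nn_integral_mono)
    fix z
    have "\<bar>f z\<bar> \<le> 1 + \<bar>f z\<bar> powr p"
    proof (cases "\<bar>f z\<bar> \<le> 1")
      case False
      then have "\<bar>f z\<bar> powr 1 \<le> \<bar>f z\<bar> powr p" using p by (intro powr_mono) auto
      then show ?thesis using False by simp
    qed (simp add: add_increasing2)
    then have "ennreal \<bar>f z\<bar> \<le> ennreal (1 + \<bar>f z\<bar> powr p)" by (rule ennreal_leI)
    then show "ennreal \<bar>f z\<bar> * indicator {0..<2} z \<le> indicator {0..<2} z + ennreal (\<bar>f z\<bar> powr p) * indicator {0..<2} z"
      by (cases "z \<in> {0..<2}") simp_all
  qed
  also have "\<dots> = 2 + circle_energy p f"
    by (simp add: nn_integral_add circle_energy_def)
  also have "\<dots> < \<infinity>" using Efin by simp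
  finally obtain g where g: "circle_flow b M g" "g 0 = f"
    using ex_circle_flow[OF fm fper] by blast
  interpret circle_flow b M g by (rule g(1))
  have flow: "circle_flow_Lp b M g p"
    by unfold_locales (use p Efin g(2) in auto)
  interpret circle_flow_Lp b M g p by (rule flow)
  have "broad_solution p a \<rho>0 \<xi>0 (\<lambda>t x. g t (x + t)) (\<lambda>t x. - g t (t - x))"
  proof (rule broad_solution_of_flow[OF ab])
    show "AE x in lborel. x \<in> {0<..<1} \<longrightarrow> \<rho>0 x = g 0 x"
      using re by eventually_elim (simp add: g(2) f_pos)
    show "AE x in lborel. x \<in> {0<..<1} \<longrightarrow> \<xi>0 x = - g 0 (- x)"
      using qe by eventually_elim (simp add: g(2) f_neg)
  qed
  moreover have "Lp_pair_norm p {0<..<1} \<rho>0 \<xi>0 = enn2real (circle_energy p (g 0)) powr (1 / p)"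
    by (simp add: Lp_pair_norm_eq[OF S rm xm] E g(2))
  ultimately show ?thesis using flow b_strip by blast
qed

theorem theorem5p2:
  fixes p \<epsilon>\<^sub>0 lam M :: real
  assumes "1 < p" and "0 < \<epsilon>\<^sub>0" and "0 < lam"
  shows "\<exists>C \<gamma>. 0 < C \<and> 0 < \<gamma> \<and>
    (\<forall>(a :: real \<Rightarrow> real \<Rightarrow> real) (x\<^sub>0 :: real).
       (\<lambda>(t, x). a t x) \<in> Linf_space ({0<..} \<times> {0<..<1}) \<longrightarrow>
       Linf_norm ({0<..} \<times> {0<..<1}) (\<lambda>(t, x). a t x) = M \<longrightarrow>
       (AE (t, x) in lebesgue_on ({0<..} \<times> {0<..<1}). 0 \<le> a t x) \<longrightarrow>
       x\<^sub>0 \<in> {0<..<1} \<longrightarrow>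
       {x\<^sub>0 - \<epsilon>\<^sub>0<..<x\<^sub>0 + \<epsilon>\<^sub>0} \<subseteq> {0<..<1} \<longrightarrow>
       (AE (t, x) in lebesgue_on ({0<..} \<times> {x\<^sub>0 - \<epsilon>\<^sub>0<..<x\<^sub>0 + \<epsilon>\<^sub>0}). lam \<le> a t x) \<longrightarrow>
       (\<forall>\<rho>\<^sub>0 \<in> Lp_space p {0<..<1}. \<forall>\<xi>\<^sub>0 \<in> Lp_space p {0<..<1}.
          (\<exists>\<rho> \<xi>. broad_solution p a \<rho>\<^sub>0 \<xi>\<^sub>0 \<rho> \<xi>) \<and>
          (\<forall>\<rho> \<xi> \<rho>' \<xi>'. broad_solution p a \<rho>\<^sub>0 \<xi>\<^sub>0 \<rho> \<xi> \<longrightarrow> broad_solution p a \<rho>\<^sub>0 \<xi>\<^sub>0 \<rho>' \<xi>' \<longrightarrow>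
             same_solution \<rho> \<xi> \<rho>' \<xi>') \<and>
          (\<forall>\<rho> \<xi>. broad_solution p a \<rho>\<^sub>0 \<xi>\<^sub>0 \<rho> \<xi> \<longrightarrow>
             (\<forall>t\<ge>0. Lp_pair_norm p {0<..<1} (\<rho> t) (\<xi> t)
                \<le> C * exp (- \<gamma> * t) * Lp_pair_norm p {0<..<1} \<rho>\<^sub>0 \<xi>\<^sub>0))))"
proof -
  \<comment> \<open>If \<open>M < lam\<close>, no coefficient satisfies the hypotheses, but constants must be found all the same.\<close>
  define N where "N = max M lam"
  have N: "0 < N" "lam \<le> N" "M \<le> N" using assms(3) by (auto simp: N_def)
  obtain \<kappa> where \<kappa>: "0 < \<kappa>" "\<kappa> < 1" and contraction: "\<And>b g x0 s. circle_flow_Lp b N g p \<Longrightarrow> 0 \<le> x0 - \<epsilon>\<^sub>0 \<Longrightarrow> x0 + \<epsilon>\<^sub>0 \<le> 1 \<Longrightarrow>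
    (\<forall>x y. 0 \<le> x \<longrightarrow> y \<in> {x0 - \<epsilon>\<^sub>0<..<x0 + \<epsilon>\<^sub>0} \<longrightarrow> lam \<le> b x (x + y)) \<Longrightarrow> 0 \<le> s \<Longrightarrow>
    circle_energy p (g (s + 2)) \<le> ennreal \<kappa> * circle_energy p (g s)"
    using uniform_contraction[OF assms(1) N(1) assms(3,2)] by blast
  show ?thesis
  proof (rule exI[of _ "(1 / \<kappa>) powr (1 / p)"], rule exI[of _ "- ln \<kappa> / (2 * p)"], intro conjI allI impI ballI)
    show "0 < (1 / \<kappa>) powr (1 / p)" using \<kappa> by simp
    have "ln \<kappa> < 0" using \<kappa> by simp
    then show "0 < - ln \<kappa> / (2 * p)" using assms(1) by (simp add: divide_neg_pos)
    fix a :: "real \<Rightarrow> real \<Rightarrow> real" and x0 :: real and \<rho>0 \<xi>0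
    assume Linf: "(\<lambda>(t, x). a t x) \<in> Linf_space ({0<..} \<times> {0<..<1})" and
      norm: "Linf_norm ({0<..} \<times> {0<..<1}) (\<lambda>(t, x). a t x) = M" and
      nn: "AE (t, x) in lebesgue_on ({0<..} \<times> {0<..<1}). 0 \<le> a t x" and
      x0: "x0 \<in> {0<..<1}" and sub: "{x0 - \<epsilon>\<^sub>0<..<x0 + \<epsilon>\<^sub>0} \<subseteq> {0<..<1}" and
      lamb: "AE (t, x) in lebesgue_on ({0<..} \<times> {x0 - \<epsilon>\<^sub>0<..<x0 + \<epsilon>\<^sub>0}). lam \<le> a t x" and
      rho0: "\<rho>0 \<in> Lp_space p {0<..<1}" and xi0: "\<xi>0 \<in> Lp_space p {0<..<1}"
    have Db: "{0<..} \<times> {c<..<d} \<in> sets (borel :: (real \<times> real) measure)" for c d :: real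
      by (intro borel_open open_Times) auto
    have am: "(\<lambda>(t, x). a t x) \<in> borel_measurable (lebesgue_on ({0<..} \<times> {0<..<1}))"
      using Linf by (simp add: Linf_space_def)
    have bd: "AE z in lborel. z \<in> {0<..} \<times> {0<..<1} \<longrightarrow> \<bar>a (fst z) (snd z)\<bar> \<le> N"
      using Linf_bound[OF Linf Db] unfolding norm by eventually_elim (use N in auto)
    have nn': "AE z in lborel. z \<in> {0<..} \<times> {0<..<1} \<longrightarrow> 0 \<le> a (fst z) (snd z)"
      using nn unfolding AE_lebesgue_on_iff[OF Db] by (simp add: split_beta')
    have lamb': "AE z in lborel. z \<in> {0<..} \<times> {x0 - \<epsilon>\<^sub>0<..<x0 + \<epsilon>\<^sub>0} \<longrightarrow> lam \<le> a (fst z) (snd z)"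
      using lamb unfolding AE_lebesgue_on_iff[OF Db] by (simp add: split_beta')
    have strip: "0 \<le> x0 - \<epsilon>\<^sub>0" "x0 + \<epsilon>\<^sub>0 \<le> 1"
      using sub assms(2) by (simp_all add: greaterThanLessThan_subseteq_greaterThanLessThan)
    obtain b g where flow: "circle_flow_Lp b N g p"
      and bl: "\<forall>x y. 0 \<le> x \<longrightarrow> y \<in> {x0 - \<epsilon>\<^sub>0<..<x0 + \<epsilon>\<^sub>0} \<longrightarrow> lam \<le> b x (x + y)"
      and sol: "broad_solution p a \<rho>0 \<xi>0 (\<lambda>t x. g t (x + t)) (\<lambda>t x. - g t (t - x))"
      and n0: "Lp_pair_norm p {0<..<1} \<rho>0 \<xi>0 = enn2real (circle_energy p (g 0)) powr (1 / p)"
      using ex_flow_solution[OF assms(1,3) N(2) am bd nn' strip lamb' rho0 xi0] by blast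
    interpret circle_flow_Lp b N g p by (rule flow)
    show "\<exists>\<rho> \<xi>. broad_solution p a \<rho>0 \<xi>0 \<rho> \<xi>" using sol by blast
    note unique = broad_solution_unique[OF assms(1) N(1) am bd]
    show "same_solution \<rho> \<xi> \<rho>' \<xi>'" if "broad_solution p a \<rho>0 \<xi>0 \<rho> \<xi>" "broad_solution p a \<rho>0 \<xi>0 \<rho>' \<xi>'" for \<rho> \<xi> \<rho>' \<xi>'
      by (rule unique[OF that])
    fix \<rho> \<xi> t assume sol': "broad_solution p a \<rho>0 \<xi>0 \<rho> \<xi>" and t: "0 \<le> (t::real)"
    have "solution_space p (t + 1) \<rho> \<xi>"
      using sol' t by (auto simp: broad_solution_def broad_solution_on_def)
    then have meas: "\<rho> t \<in> borel_measurable (lebesgue_on {0<..<1})" "\<xi> t \<in> borel_measurable (lebesgue_on {0<..<1})"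
      using t by (auto simp: solution_space_def continuous_into_Lp_pair_def Lp_space_def)
    \<comment> \<open>By uniqueness the trace at time \<open>t\<close> is that of the constructed solution.\<close>
    have "Lp_pair_norm p {0<..<1} (\<rho> t) (\<xi> t) = Lp_pair_norm p {0<..<1} (\<lambda>x. g t (x + t)) (\<lambda>x. - g t (t - x))"
    proof (rule Lp_pair_norm_cong_AE[OF meas])
      show "AE x in lebesgue_on {0<..<1}. \<rho> t x = g t (x + t) \<and> \<xi> t x = - g t (t - x)"
        using unique[OF sol' sol] t unfolding same_solution_def by blast
    qed (intro borel_measurable_lebesgue_onI, measurable)+
    also have "\<dots> = enn2real (circle_energy p (g t)) powr (1 / p)" by (rule Lp_pair_norm_of_flow)
    also have "\<dots> \<le> (1 / \<kappa> * exp (ln \<kappa> / 2 * t) * enn2real (circle_energy p (g 0))) powr (1 / p)"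
    proof (rule powr_mono2)
      have "circle_energy p (g t) \<le> ennreal (1 / \<kappa> * exp (ln \<kappa> / 2 * t)) * circle_energy p (g 0)"
        by (rule energy_exponential_decay[OF \<kappa> _ t]) (rule contraction[OF flow strip bl])
      then have "enn2real (circle_energy p (g t)) \<le> enn2real (ennreal (1 / \<kappa> * exp (ln \<kappa> / 2 * t)) * circle_energy p (g 0))"
        by (rule enn2real_mono) (use Lp0 in \<open>simp add: ennreal_mult_less_top\<close>)
      then show "enn2real (circle_energy p (g t)) \<le> 1 / \<kappa> * exp (ln \<kappa> / 2 * t) * enn2real (circle_energy p (g 0))"
        using \<kappa> by (simp add: enn2real_mult)
    qed (use assms(1) in auto)
    also have "\<dots> = (1 / \<kappa>) powr (1 / p) * exp (- (- ln \<kappa> / (2 * p)) * t) * Lp_pair_norm p {0<..<1} \<rho>0 \<xi>0"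
    proof -
      have "exp (ln \<kappa> / 2 * t) powr (1 / p) = exp (- (- ln \<kappa> / (2 * p)) * t)"
        using assms(1) by (simp add: powr_def field_simps)
      then show ?thesis unfolding n0 by (simp only: powr_mult)
    qed
    finally show "Lp_pair_norm p {0<..<1} (\<rho> t) (\<xi> t) \<le>
      (1 / \<kappa>) powr (1 / p) * exp (- (- ln \<kappa> / (2 * p)) * t) * Lp_pair_norm p {0<..<1} \<rho>0 \<xi>0" .
  qed
qed

end
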